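(* The following pairs of dual polytopes in $\mathbb{R}^4$ provide hybrid designs on $\mathbb{S}^3$. (a) Let $\gamma$ be the geodesic cycle derived from the edges of the $600$-cell and $X$ be the vertices of the (dual) $120$-cell. Then $(\gamma,X)$ is a hybrid $19$-design with balancing factor $\beta_{600/120}=\frac{176}{301}$. (b) Let $\gamma$ be the geodesic cycle derived from the edges of the $24$-cell and $X$ be the vertices of its dual $24$-cell. Then $(\gamma,X)$ is a hybrid $7$-design with balancing factor $\beta_{24}=\frac{5}{14}$. (c) Let $\gamma$ be the geodesic cycle derived from the edges of the $4$-dimensional regular tetrahedron ($4$-simplex) and $X$ be the vertices of its dual $4$-tetrahedron. Then $(\gamma,X)$ is a hybrid $3$-design with balancing factor $\beta_{tetra}=\dfrac{8\sqrt{15}}{8\sqrt{15}+27\arccos(-\frac14)}$.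
   Context: $\mathbb{S}^3$ is the unit sphere in $\mathbb{R}^4$; $\int_{\mathbb{S}^3}$ is with respect to the normalized orthogonally invariant measure; $\mathrm{Pol}_{\le t}$ is the space of real polynomials of total degree at most $t$ in $4$ variables restricted to $\mathbb{S}^3$. For $x,y\in\mathbb{S}^3$, $y\ne\pm x$, the geodesic arc $\gamma_{x,y}$ is the shortest great-circle arc between them, of length $\arccos\langle x,y\rangle$. A geodesic cycle $\gamma$ is a closed chain of finitely many geodesic arcs; $\int_\gamma p$ is the sum of the arc-length integrals over the arcs and $\ell(\gamma)=\int_\gamma1$. The geodesic cycle derived from the edges of a polytope is the radial projection onto the sphere of any Euler cycle of its edge graph (closed walk traversing each edge exactly once; in all three cases every vertex degree is even). Hybrid design: for a closed curve $\gamma$ and a finite set $X\subseteq\mathbb{S}^3$, the pair $(\gamma,X)$ is a hybrid $t$-design with balancing factor $\beta\in[0,1]$ if $\frac{\beta}{|X|}\sum_{x\in X}p(x)+\frac{1-\beta}{\ell(\gamma)}\int_\gamma p=\int_{\mathbb{S}^3}p$ for all $p\in\mathrm{Pol}_{\le t}$. Realizations (vertices on $\mathbb{S}^3$, $\phi=\frac{1+\sqrt5}{2}$; the dual of a regular polytope has as vertices the facet centers, projected onto the sphere): - $600$-cell: the $120$ vertices are the $16$ points $\frac12(\pm1,\pm1,\pm1,\pm1)$, the $8$ permutations of $(\pm1,0,0,0)$, and the $96$ even permutations of $\frac12(\pm\phi,\pm1,\pm\phi^{-1},0)$. Its $720$ edges are the pairs of vertices with inner product $\phi/2$. The dual $120$-cell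 has as its $600$ vertices the normalized sums of quadruples of pairwise adjacent vertices of the $600$-cell (for instance $(0,0,\frac1{\sqrt2},\frac1{\sqrt2})$). - $24$-cell: vertices are all permutations of $(\pm\frac1{\sqrt2},\pm\frac1{\sqrt2},0,0)$; its $96$ edges are the pairs with inner product $\frac12$. The dual $24$-cell has vertices $\pm e_i$ ($i=1,\dots,4$) and $\frac12(\pm1,\pm1,\pm1,\pm1)$. - $4$-tetrahedron: five unit vectors $v_1,\dots,v_5\in\mathbb{R}^4$ with pairwise inner products $-\frac14$, all $10$ pairs being edges; the dual $4$-tetrahedron has vertices $-v_1,\dots,-v_5$. *)

theory Defs
  imports "HOL-Analysis.Analysis" "HOL-Probability.Probability_Measure"
begin

section \<open>Integration and polynomials on the unit sphere\<close>

text \<open>The normalized orthogonally invariant measure, given by its defining properties.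
  Existence is lemma \<open>invariant_sphere_measure_exists\<close> below.\<close>

definition invariant_sphere_measure :: "(real ^ 'n) measure \<Rightarrow> bool" where
  "invariant_sphere_measure \<sigma> \<longleftrightarrow>
     prob_space \<sigma> \<and> sets \<sigma> = sets (restrict_space borel (sphere 0 1)) \<and>
     (\<forall>f. orthogonal_transformation f \<longrightarrow> distr \<sigma> \<sigma> f = \<sigma>)"

text \<open>Real polynomial functions of total degree at most \<open>t\<close>. They are kept as functions on the
  whole space; everything below evaluates them on the unit sphere only.\<close>

definition Pol_le :: "nat \<Rightarrow> (real ^ 'n \<Rightarrow> real) set" where
  "Pol_le t = {p. \<exists>c :: ('n \<Rightarrow> nat) \<Rightarrow> real.
     p = (\<lambda>x. \<Sum>\<alpha> | (\<Sum>i\<in>UNIV. \<alpha> i) \<le> t. c \<alpha> * (\<Prod>i\<in>UNIV. (x $ i) ^ \<alpha> i))}"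

lemma finite_exponents: "finite {\<alpha> :: 'n::finite \<Rightarrow> nat. (\<Sum>i\<in>UNIV. \<alpha> i) \<le> t}"
proof (rule finite_subset)
  show "{\<alpha> :: 'n \<Rightarrow> nat. (\<Sum>i\<in>UNIV. \<alpha> i) \<le> t} \<subseteq> PiE UNIV (\<lambda>_. {..t})"
  proof
    fix \<alpha> :: "'n \<Rightarrow> nat"
    assume "\<alpha> \<in> {\<alpha>. (\<Sum>i\<in>UNIV. \<alpha> i) \<le> t}"
    moreover have "\<alpha> i \<le> (\<Sum>i\<in>UNIV. \<alpha> i)" for i
      by (rule member_le_sum) simp_all
    ultimately have "\<alpha> i \<le> t" for i
      using order_trans by blast
    then show "\<alpha> \<in> PiE UNIV (\<lambda>_. {..t})"
      by (simp add: PiE_UNIV_domain)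
  qed
  show "finite (PiE (UNIV :: 'n set) (\<lambda>_. {..t}))"
    by (intro finite_PiE) auto
qed


section \<open>Geodesic cycles\<close>

text \<open>For unit vectors \<open>x\<close> and \<open>y \<noteq> \<plusminus>x\<close>, the shortest great-circle arc from \<open>x\<close> to \<open>y\<close>,
  parametrized by arc length over \<open>{0..arccos (x \<bullet> y)}\<close>; see the lemmas in the last section.\<close>

definition geodesic_arc :: "'a::real_inner \<Rightarrow> 'a \<Rightarrow> real \<Rightarrow> 'a" where
  "geodesic_arc x y s =
     (sin (arccos (x \<bullet> y) - s) *\<^sub>R x + sin s *\<^sub>R y) /\<^sub>R sin (arccos (x \<bullet> y))"

text \<open>A geodesic cycle is given by the list of its successive corners, the first one being
  repeated at the end.\<close>

definition arcs :: "'a list \<Rightarrow> ('a \<times> 'a) list" where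
  "arcs vs = zip vs (tl vs)"

definition geodesic_cycle :: "'a::real_inner list \<Rightarrow> bool" where
  "geodesic_cycle vs \<longleftrightarrow>
     length vs \<ge> 2 \<and> hd vs = last vs \<and> set vs \<subseteq> sphere 0 1 \<and>
     (\<forall>(x, y) \<in> set (arcs vs). y \<noteq> x \<and> y \<noteq> - x)"

definition cycle_integral :: "'a::real_inner list \<Rightarrow> ('a \<Rightarrow> real) \<Rightarrow> real" where
  "cycle_integral vs p =
     (\<Sum>(x, y) \<leftarrow> arcs vs. integral {0..arccos (x \<bullet> y)} (\<lambda>s. p (geodesic_arc x y s)))"

definition cycle_length :: "'a::real_inner list \<Rightarrow> real" where
  "cycle_length vs = cycle_integral vs (\<lambda>_. 1)"

text \<open>Closed walks traversing each edge of a graph with edge set \<open>E\<close> exactly once. If the vertices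
  lie on the unit sphere, then the radial projection of such a walk is the geodesic cycle with the
  same list of corners, see \<open>radial_projection_closed_segment\<close> below.\<close>

definition euler_cycle :: "'a set set \<Rightarrow> 'a list \<Rightarrow> bool" where
  "euler_cycle E vs \<longleftrightarrow>
     vs \<noteq> [] \<and> hd vs = last vs \<and>
     distinct (map (\<lambda>(x, y). {x, y}) (arcs vs)) \<and> set (map (\<lambda>(x, y). {x, y}) (arcs vs)) = E"


section \<open>Hybrid designs\<close>

definition hybrid_design ::
  "(real ^ 'n) measure \<Rightarrow> nat \<Rightarrow> real \<Rightarrow> (real ^ 'n) list \<Rightarrow> (real ^ 'n) set \<Rightarrow> bool" where
  "hybrid_design \<sigma> t \<beta> \<gamma> X \<longleftrightarrow>
     geodesic_cycle \<gamma> \<and> finite X \<and> X \<noteq> {} \<and> X \<subseteq> sphere 0 1 \<and> 0 \<le> \<beta> \<and> \<beta> \<le> 1 \<and>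
     (\<forall>p \<in> Pol_le t.
        \<beta> / real (card X) * (\<Sum>x\<in>X. p x) + (1 - \<beta>) / cycle_length \<gamma> * cycle_integral \<gamma> p
          = (\<integral>x. p x \<partial>\<sigma>))"


section \<open>The polytopes\<close>

definition coord_perms :: "real ^ 4 \<Rightarrow> (real ^ 4) set" where
  "coord_perms w = {\<chi> i. w $ \<pi> i | \<pi>. \<pi> permutes UNIV}"

definition even_coord_perms :: "real ^ 4 \<Rightarrow> (real ^ 4) set" where
  "even_coord_perms w = {\<chi> i. w $ \<pi> i | \<pi>. \<pi> permutes UNIV \<and> evenperm \<pi>}"

text \<open>The library has no analogue of \<open>vector_3\<close> in dimension 4.\<close>

lemma vector_4:
  "(vector [a, b, c, d] :: 'a::zero ^ 4) $ 1 = a"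
  "(vector [a, b, c, d] :: 'a::zero ^ 4) $ 2 = b"
  "(vector [a, b, c, d] :: 'a::zero ^ 4) $ 3 = c"
  "(vector [a, b, c, d] :: 'a::zero ^ 4) $ 4 = d"
  unfolding vector_def by simp_all

definition golden_ratio :: real where
  "golden_ratio = (1 + sqrt 5) / 2"

definition half_sign_vectors :: "(real ^ 4) set" where
  "half_sign_vectors = {(1/2) *\<^sub>R vector [a, b, c, d] | a b c d.
     a \<in> {1, -1} \<and> b \<in> {1, -1} \<and> c \<in> {1, -1} \<and> d \<in> {1, -1}}"

definition vertices_600cell :: "(real ^ 4) set" where
  "vertices_600cell =
     half_sign_vectors \<union>
     (\<Union>a\<in>{1, -1}. coord_perms (vector [a, 0, 0, 0])) \<union>
     (\<Union>a\<in>{1, -1}. \<Union>b\<in>{1, -1}. \<Union>c\<in>{1, -1}.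
        even_coord_perms ((1/2) *\<^sub>R vector [a * golden_ratio, b, c * inverse golden_ratio, 0]))"

definition edges_600cell :: "(real ^ 4) set set" where
  "edges_600cell =
     {{x, y} | x y. x \<in> vertices_600cell \<and> y \<in> vertices_600cell \<and> x \<bullet> y = golden_ratio / 2}"

text \<open>Quadruples of pairwise adjacent vertices are the facets of the 600-cell, and \<open>sgn\<close> is
  the radial projection to the unit sphere.\<close>

definition vertices_120cell :: "(real ^ 4) set" where
  "vertices_120cell =
     {sgn (w + x + y + z) | w x y z.
        {w, x} \<in> edges_600cell \<and> {w, y} \<in> edges_600cell \<and> {w, z} \<in> edges_600cell \<and>
        {x, y} \<in> edges_600cell \<and> {x, z} \<in> edges_600cell \<and> {y, z} \<in> edges_600cell}"

definition vertices_24cell :: "(real ^ 4) set" where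
  "vertices_24cell =
     (\<Union>a\<in>{1, -1}. \<Union>b\<in>{1, -1}. coord_perms (vector [a / sqrt 2, b / sqrt 2, 0, 0]))"

definition edges_24cell :: "(real ^ 4) set set" where
  "edges_24cell = {{x, y} | x y. x \<in> vertices_24cell \<and> y \<in> vertices_24cell \<and> x \<bullet> y = 1/2}"

definition vertices_dual_24cell :: "(real ^ 4) set" where
  "vertices_dual_24cell = {axis i a | i a. a \<in> {1, -1}} \<union> half_sign_vectors"

text \<open>The vertex sets of the regular 4-simplices inscribed in the unit sphere.\<close>

definition regular_4simplex :: "(real ^ 4) set \<Rightarrow> bool" where
  "regular_4simplex V \<longleftrightarrow>
     card V = 5 \<and> V \<subseteq> sphere 0 1 \<and> (\<forall>x\<in>V. \<forall>y\<in>V. x \<noteq> y \<longrightarrow> x \<bullet> y = - 1/4)"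

definition complete_edges :: "'a set \<Rightarrow> 'a set set" where
  "complete_edges V = {{x, y} | x y. x \<in> V \<and> y \<in> V \<and> x \<noteq> y}"


section \<open>Existence and basic properties of the objects defined above\<close>

lemma invariant_sphere_measure_exists:
  "\<exists>\<sigma> :: (real ^ 4) measure. invariant_sphere_measure \<sigma>"
proof -
  define A where "A = cball (0 :: real ^ 4) 1 - {0}"
  define U where "U = uniform_measure (restrict_space lborel A) A"
  define \<sigma> where "\<sigma> = distr U (restrict_space borel (sphere 0 1)) sgn"
  have A: "A \<in> sets borel" by (simp add: A_def)
  have sU: "sets U = sets (restrict_space borel A)" "space U = A"
    by (simp_all add: U_def sets_restrict_space space_restrict_space)
  have eA: "emeasure (restrict_space lborel A) A = emeasure lborel A"
    using A by (simp add: emeasure_restrict_space)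
  have fin: "emeasure lborel A \<noteq> \<infinity>"
  proof -
    have "emeasure lborel A \<le> emeasure lborel (cball (0 :: real ^ 4) 1)"
      by (rule emeasure_mono) (auto simp: A_def)
    also have "\<dots> < \<infinity>" by (rule emeasure_bounded_finite) simp
    finally show ?thesis by simp
  qed
  have nz: "emeasure lborel A \<noteq> 0"
  proof
    assume "emeasure lborel A = 0"
    then have "A \<in> null_sets lborel" using A by (simp add: null_sets_def)
    then have "negligible A"
      using null_sets_completionI negligible_iff_null_sets by blast
    then have "negligible (A \<union> {0})" by (simp add: negligible_Un)
    moreover have "ball 0 1 \<subseteq> A \<union> {0}" by (auto simp: A_def)
    ultimately have "negligible (ball (0 :: real ^ 4) 1)"
      using negligible_subset by blast
    then show False using open_not_negligible[of "ball (0 :: real ^ 4) 1"] by simp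
  qed
  interpret U: prob_space U
    unfolding U_def by (rule prob_space_uniform_measure) (use eA nz fin in auto)
  have sgn_m: "sgn \<in> measurable U (restrict_space borel (sphere 0 1))"
  proof (rule measurable_restrict_space2)
    show "sgn \<in> space U \<rightarrow> sphere 0 1"
      by (auto simp: sU A_def norm_sgn)
    have "(sgn :: real ^ 4 \<Rightarrow> _) \<in> measurable borel borel"
      unfolding sgn_div_norm[abs_def] by measurable
    then have "(sgn :: real ^ 4 \<Rightarrow> _) \<in> measurable (restrict_space borel A) borel"
      by (rule measurable_restrict_space1)
    then show "sgn \<in> measurable U borel"
      by (simp add: measurable_cong_sets[OF sU(1) refl])
  qed
  have s\<sigma>: "sets \<sigma> = sets (restrict_space borel (sphere 0 1))"
    by (simp add: \<sigma>_def)
  have "distr \<sigma> \<sigma> f = \<sigma>" if f: "orthogonal_transformation f" for f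
  proof -
    have lin: "linear f" using f by (rule orthogonal_transformation_linear)
    have nf: "norm (f x) = norm x" for x using f by (rule orthogonal_transformation_norm)
    have fm: "f \<in> measurable borel borel"
      using lin by (intro borel_measurable_continuous_onI linear_continuous_on linear_conv_bounded_linear[THEN iffD1])
    have fU: "f \<in> measurable U U"
    proof -
      have "f \<in> measurable (restrict_space borel A) (restrict_space borel A)"
        using nf norm_eq_zero
        by (intro measurable_restrict_space3 fm) (auto simp: A_def, metis norm_eq_zero)
      then show ?thesis by (simp add: measurable_cong_sets[OF sU(1) sU(1)])
    qed
    have f\<sigma>: "f \<in> measurable (restrict_space borel (sphere 0 1)) (restrict_space borel (sphere 0 1))"
      using nf by (intro measurable_restrict_space3 fm) auto
    have fs: "f (sgn x) = sgn (f x)" for x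
      by (simp add: sgn_div_norm nf linear_scale[OF lin])
    have inv: "distr U U f = U"
    proof (rule measure_eqI)
      fix B assume "B \<in> sets (distr U U f)"
      then have B: "B \<in> sets U" by simp
      then have BA: "B \<subseteq> A" "B \<in> sets borel"
        using A by (auto simp: sU sets_restrict_space_iff)
      define C where "C = f -` B \<inter> A"
      have CU: "C \<in> sets U"
        using measurable_sets[OF fU B] by (simp add: C_def sU)
      then have CA: "C \<subseteq> A" "C \<in> sets borel"
        using A by (auto simp: sU sets_restrict_space_iff)
      have fC: "f ` C = B"
      proof (intro equalityI subsetI)
        fix y assume y: "y \<in> B"
        obtain x where x: "y = f x"
          using orthogonal_transformation_surj[OF f] by (metis surjD)
        have "x \<in> A"
        proof -
          have "f x \<in> A" using y BA(1) x by auto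
          then have "norm x \<le> 1" "norm x \<noteq> 0"
            using nf[of x] by (auto simp: A_def)
          then show ?thesis by (simp add: A_def)
        qed
        with y x show "y \<in> f ` C" by (auto simp: C_def)
      qed (auto simp: C_def)
      have fin': "emeasure lborel S \<noteq> \<infinity>" if "S \<subseteq> A" for S
        using emeasure_mono[OF that, of lborel] fin A by (auto simp: top_unique)
      have lm: "C \<in> lmeasurable"
        using CA fin'[OF CA(1)] by (intro fmeasurableI) (auto simp: less_top)
      have "measure lebesgue (f ` C) = measure lebesgue C"
        by (rule measure_orthogonal_image[OF f lm])
      then have "measure lborel B = measure lborel C"
        using fC BA CA by (simp add: measure_completion)
      then have "emeasure lborel B = emeasure lborel C"
        using fin'[OF BA(1)] fin'[OF CA(1)] by (simp add: emeasure_eq_ennreal_measure)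
      moreover have "emeasure U S = emeasure lborel S / emeasure lborel A"
        if "S \<subseteq> A" "S \<in> sets borel" for S
      proof -
        have "S \<in> sets (restrict_space lborel A)" "A \<in> sets (restrict_space lborel A)"
          using that A by (simp_all add: sets_restrict_space_iff)
        then show ?thesis
          unfolding U_def using that A
          by (simp add: emeasure_uniform_measure emeasure_restrict_space Int_absorb1)
      qed
      ultimately have "emeasure U C = emeasure U B"
        using BA CA by simp
      then show "emeasure (distr U U f) B = emeasure U B"
        using fU B by (simp add: emeasure_distr C_def sU)
    qed simp
    have "distr \<sigma> \<sigma> f = distr \<sigma> (restrict_space borel (sphere 0 1)) f"
      by (rule distr_cong) (simp_all add: s\<sigma>)
    also have "\<dots> = distr U (restrict_space borel (sphere 0 1)) (f \<circ> sgn)"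
      unfolding \<sigma>_def by (rule distr_distr[OF f\<sigma> sgn_m])
    also have "f \<circ> sgn = sgn \<circ> f" by (auto simp: fs)
    also have "distr U (restrict_space borel (sphere 0 1)) (sgn \<circ> f) =
        distr (distr U U f) (restrict_space borel (sphere 0 1)) sgn"
      by (rule distr_distr[OF sgn_m fU, symmetric])
    also have "\<dots> = \<sigma>" by (simp add: inv \<sigma>_def)
    finally show ?thesis .
  qed
  moreover have "prob_space \<sigma>"
    unfolding \<sigma>_def by (rule U.prob_space_distr[OF sgn_m])
  ultimately show ?thesis
    using s\<sigma> unfolding invariant_sphere_measure_def by blast
qed

lemma sin_arccos_inner_pos:
  fixes x y :: "'a::real_inner"
  assumes "norm x = 1" "norm y = 1" "y \<noteq> x" "y \<noteq> - x"
  shows "0 < sin (arccos (x \<bullet> y))" "cos (arccos (x \<bullet> y)) = x \<bullet> y"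
    "0 < arccos (x \<bullet> y)" "arccos (x \<bullet> y) < pi"
proof -
  have xx: "x \<bullet> x = 1" "y \<bullet> y = 1"
    using assms by (simp_all add: dot_square_norm)
  have "0 < (y - x) \<bullet> (y - x)" "0 < (y + x) \<bullet> (y + x)"
    using assms by (simp_all add: eq_neg_iff_add_eq_0)
  then have "x \<bullet> y < 1" "- 1 < x \<bullet> y"
    by (simp_all add: inner_diff inner_add xx inner_commute)
  then show "0 < arccos (x \<bullet> y)" "arccos (x \<bullet> y) < pi" "cos (arccos (x \<bullet> y)) = x \<bullet> y"
    using arccos_lt_bounded[of "x \<bullet> y"] by (auto intro: cos_arccos)
  then show "0 < sin (arccos (x \<bullet> y))"
    by (simp add: sin_gt_zero)
qed

lemma geodesic_arc_endpoints:
  fixes x y :: "'a::real_inner"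
  assumes "norm x = 1" "norm y = 1" "y \<noteq> x" "y \<noteq> - x"
  shows "geodesic_arc x y 0 = x" "geodesic_arc x y (arccos (x \<bullet> y)) = y"
  using sin_arccos_inner_pos(1)[OF assms] by (simp_all add: geodesic_arc_def)

lemma norm_geodesic_arc:
  fixes x y :: "'a::real_inner"
  assumes "norm x = 1" "norm y = 1" "y \<noteq> x" "y \<noteq> - x"
  shows "norm (geodesic_arc x y s) = 1"
proof -
  define L where "L = arccos (x \<bullet> y)"
  define a where "a = L - s"
  have L: "L = a + s" by (simp add: a_def)
  note pos = sin_arccos_inner_pos[OF assms, folded L_def]
  have xx: "x \<bullet> x = 1" "y \<bullet> y = 1" "y \<bullet> x = cos L" "x \<bullet> y = cos L"
    using assms pos(2) by (simp_all add: dot_square_norm inner_commute)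
  define z where "z = sin a *\<^sub>R x + sin s *\<^sub>R y"
  have "z \<bullet> z = (sin a)\<^sup>2 + (sin s)\<^sup>2 + 2 * sin a * sin s * cos L"
    unfolding z_def by (simp add: inner_add xx power2_eq_square algebra_simps)
  also have "\<dots> = (sin L)\<^sup>2"
  proof -
    have "(sin a)\<^sup>2 + (cos a)\<^sup>2 = 1" "(sin s)\<^sup>2 + (cos s)\<^sup>2 = 1" by simp_all
    then show ?thesis unfolding L sin_add cos_add by algebra
  qed
  finally have "norm z = sin L"
    using pos(1) by (simp add: norm_eq_sqrt_inner)
  then show ?thesis
    using pos(1) by (simp add: geodesic_arc_def z_def a_def L_def)
qed

lemma geodesic_arc_unit_speed:
  fixes x y :: "'a::real_inner"
  assumes "norm x = 1" "norm y = 1" "y \<noteq> x" "y \<noteq> - x"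
  obtains d where "(geodesic_arc x y has_vector_derivative d) (at s)" "norm d = 1"
proof
  define L where "L = arccos (x \<bullet> y)"
  define a where "a = L - s"
  have L: "L = a + s" by (simp add: a_def)
  note pos = sin_arccos_inner_pos[OF assms, folded L_def]
  have xx: "x \<bullet> x = 1" "y \<bullet> y = 1" "y \<bullet> x = cos L" "x \<bullet> y = cos L"
    using assms pos(2) by (simp_all add: dot_square_norm inner_commute)
  define z where "z = (- cos a) *\<^sub>R x + cos s *\<^sub>R y"
  have "z \<bullet> z = (cos a)\<^sup>2 + (cos s)\<^sup>2 - 2 * cos a * cos s * cos L"
    unfolding z_def by (simp add: inner_add inner_diff xx power2_eq_square algebra_simps)
  also have "\<dots> = (sin L)\<^sup>2"
  proof -
    have "(sin a)\<^sup>2 + (cos a)\<^sup>2 = 1" "(sin s)\<^sup>2 + (cos s)\<^sup>2 = 1" by simp_all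
    then show ?thesis unfolding L sin_add cos_add by algebra
  qed
  finally have "norm z = sin L"
    using pos(1) by (simp add: norm_eq_sqrt_inner)
  then show "norm (z /\<^sub>R sin L) = 1"
    using pos(1) by simp
  show "(geodesic_arc x y has_vector_derivative (z /\<^sub>R sin L)) (at s)"
    unfolding geodesic_arc_def[abs_def] L_def[symmetric] z_def a_def
    by (auto intro!: derivative_eq_intros simp: has_real_derivative_iff_has_vector_derivative[symmetric])
qed

lemma radial_projection_closed_segment:
  fixes x y :: "'a::real_inner"
  assumes "norm x = 1" "norm y = 1" "y \<noteq> x" "y \<noteq> - x"
  shows "sgn ` closed_segment x y = geodesic_arc x y ` {0..arccos (x \<bullet> y)}"
proof -
  define L where "L = arccos (x \<bullet> y)"
  note pos = sin_arccos_inner_pos[OF assms, folded L_def]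
  have nn: "0 \<le> sin s" "0 \<le> sin (L - s)" if "s \<in> {0..L}" for s
    using that pos(4) by (auto intro!: sin_ge_zero)
  have pp: "0 < sin s + sin (L - s)" if s: "s \<in> {0..L}" for s
  proof (cases "s = 0")
    case True
    then show ?thesis using pos(1) by simp
  next
    case False
    then have "0 < sin s" using s pos(4) by (intro sin_gt_zero) auto
    then show ?thesis using nn(2)[OF s] by simp
  qed
  have key: "sgn ((1 - u) *\<^sub>R x + u *\<^sub>R y) = geodesic_arc x y s"
    if s: "s \<in> {0..L}" and u: "(1 - u) * sin s = u * sin (L - s)" for s u
  proof -
    define T where "T = sin s + sin (L - s)"
    have T: "0 < T" using pp[OF s] by (simp add: T_def)
    have e: "T * (1 - u) = sin (L - s)" "T * u = sin s"
      using u by (simp_all add: T_def algebra_simps)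
    have "(T / sin L) *\<^sub>R ((1 - u) *\<^sub>R x + u *\<^sub>R y) = geodesic_arc x y s"
      unfolding geodesic_arc_def L_def[symmetric]
      by (simp add: scaleR_add_right e[symmetric] divide_inverse mult_ac)
    then have "sgn (geodesic_arc x y s) = sgn (T / sin L) *\<^sub>R sgn ((1 - u) *\<^sub>R x + u *\<^sub>R y)"
      by (metis sgn_scaleR)
    moreover have "sgn (geodesic_arc x y s) = geodesic_arc x y s"
      by (simp add: sgn_div_norm norm_geodesic_arc[OF assms])
    ultimately show ?thesis using T pos(1) by simp
  qed
  show ?thesis
  proof (intro equalityI subsetI)
    fix w assume "w \<in> sgn ` closed_segment x y"
    then obtain u where u: "0 \<le> u" "u \<le> 1" "w = sgn ((1 - u) *\<^sub>R x + u *\<^sub>R y)"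
      by (auto simp: closed_segment_def)
    have "\<exists>s. 0 \<le> s \<and> s \<le> L \<and> (1 - u) * sin s - u * sin (L - s) = 0"
      using u pos by (intro IVT') (auto intro!: continuous_intros)
    then obtain s where "s \<in> {0..L}" "(1 - u) * sin s = u * sin (L - s)" by auto
    with key u(3) show "w \<in> geodesic_arc x y ` {0..arccos (x \<bullet> y)}"
      unfolding L_def by blast
  next
    fix w assume "w \<in> geodesic_arc x y ` {0..arccos (x \<bullet> y)}"
    then obtain s where s: "s \<in> {0..L}" "w = geodesic_arc x y s" by (auto simp: L_def)
    define u where "u = sin s / (sin s + sin (L - s))"
    have u: "0 \<le> u" "u \<le> 1" "(1 - u) * sin s = u * sin (L - s)"
      using nn[OF s(1)] pp[OF s(1)] by (auto simp: u_def field_simps)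
    from key[OF s(1) u(3)] u(1,2) s(2) show "w \<in> sgn ` closed_segment x y"
      unfolding closed_segment_def by (auto intro!: image_eqI[of _ sgn])
  qed
qed

lemma regular_4simplex_exists: "\<exists>V. regular_4simplex V"
proof -
  define c where "c = sqrt 5 / 4"
  define d :: real where "d = - 1 / 4"
  define v1 where "v1 = (vector [c, c, c, d] :: real ^ 4)"
  define v2 where "v2 = (vector [c, - c, - c, d] :: real ^ 4)"
  define v3 where "v3 = (vector [- c, c, - c, d] :: real ^ 4)"
  define v4 where "v4 = (vector [- c, - c, c, d] :: real ^ 4)"
  define v5 where "v5 = (vector [0, 0, 0, 1] :: real ^ 4)"
  note defs = v1_def v2_def v3_def v4_def v5_def
  have cc: "c * c = 5 / 16" by (simp add: c_def)
  have ips: "v1 \<bullet> v1 = 1" "v2 \<bullet> v2 = 1" "v3 \<bullet> v3 = 1" "v4 \<bullet> v4 = 1" "v5 \<bullet> v5 = 1"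
    "v1 \<bullet> v2 = - 1/4" "v1 \<bullet> v3 = - 1/4" "v1 \<bullet> v4 = - 1/4" "v1 \<bullet> v5 = - 1/4"
    "v2 \<bullet> v3 = - 1/4" "v2 \<bullet> v4 = - 1/4" "v2 \<bullet> v5 = - 1/4"
    "v3 \<bullet> v4 = - 1/4" "v3 \<bullet> v5 = - 1/4" "v4 \<bullet> v5 = - 1/4"
    by (simp_all add: defs inner_vec_def sum_4 vector_4 cc d_def)
  have ne: "v1 \<noteq> v2" "v1 \<noteq> v3" "v1 \<noteq> v4" "v1 \<noteq> v5" "v2 \<noteq> v3" "v2 \<noteq> v4" "v2 \<noteq> v5"
    "v3 \<noteq> v4" "v3 \<noteq> v5" "v4 \<noteq> v5"
    using ips by auto
  have "regular_4simplex {v1, v2, v3, v4, v5}"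
    unfolding regular_4simplex_def using ips ne
    by (simp add: norm_eq_sqrt_inner inner_commute)
  then show ?thesis by blast
qed

end

theory Submission
  imports Defs
begin

text \<open>Write \<open>L\<close> for the functional on the left of the identity that defines a hybrid design, and \<open>\<Lambda>\<close> for the
difference of \<open>L\<close> and the integral over the sphere. Two facts make the theorem a finite computation.

First, \<open>\<Lambda>\<close> kills all forms of degree \<open>k\<close> as soon as one number, its energy, is zero. If \<open>\<Lambda>\<close> is applied to
\<open>(x \<bullet> z) ^ k\<close> in both variables, then expanding the power gives the sum of the squares of the values of \<open>\<Lambda>\<close> at
all words \<open>x\<^sub>i\<^sub>1 \<cdots> x\<^sub>i\<^sub>k\<close>, so energy zero implies that \<open>\<Lambda>\<close> vanishes on forms of degree \<open>k\<close>
(\<open>words_vanish_if_energy_zero\<close>). Lower degrees of the same parity follow by multiplying with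
\<open>x \<bullet> x = 1\<close>, and odd degrees vanish for antipodally symmetric \<open>\<Lambda>\<close>. So only the exponents 18, 6, and 2 and 3 matter in
the three cases. As the integral of \<open>(x \<bullet> z) ^ k\<close> over the sphere is constant in the unit vector \<open>z\<close>
(\<open>integral_inner_power\<close>), the energy is easy to find if \<open>L\<close> takes \<open>(x \<bullet> z) ^ k\<close> to a combination of the powers \<open>(y \<bullet> z) ^ k\<close> of finitely many unit vectors
\<open>y\<close>. It is zero once this combination has that constant value at each of these vectors \<open>z = y\<close>
(\<open>energy_zero_if_zero_on_support\<close>).

Second, on these powers \<open>L\<close> is a finite sum in the first two cases. The edges of the 600-cell and of the 24-cell join
up to great circles that are divided into 10 and 6 equal arcs. The mean of a polynomial over a circle is
its mean over more than degree many equidistant points of the circle, and the end points and midpoints of the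
edges provide 20 and 12 such points. Hence the mean over the edges is half the mean over the vertices plus half the
mean over the edge midpoints (\<open>sum_arc_integrals_rotation_closed\<close>).

What remains is to evaluate power sums over three finite point sets, the vertices and the edge midpoints of the polytope and
the vertices of its dual. Their coordinates are, up to a common scale, integers of the golden field,
and the sets consist of 3, 6 and 7 orbits (for the 600-cell) and 1, 1 and 2 orbits (for the
24-cell) of the group of signed even coordinate permutations. The power sums are constant on
these orbits, so exact arithmetic at 16 and 4 representatives finishes the proof (\<open>hybrid_design_if_orbit_energies\<close>).

For the simplex no computation with coordinates is needed. The sum of the vectors \<open>v \<in> V\<close> is zero, which reduces the
quadratic and cubic edge integrals to multiples of the sums of \<open>(v \<bullet> z)\<^sup>2\<close> and \<open>(v \<bullet> z) ^ 3\<close> over \<open>V\<close>. For the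
quadratic ones the edges and the dual vertices have the same mean, whatever the balancing factor; for the cubic
ones the means have opposite signs, and the balancing factor is chosen such that they cancel.\<close>

section \<open>Functionals on the sphere and their energy\<close>

text \<open>Functionals take functions on the whole space as arguments, like the members of \<^const>\<open>Pol_le\<close>; the last
clause says that they only depend on the values on the sphere. Linearity is restricted to continuous
functions, since Bochner and gauge integrals are not additive on arbitrary ones.\<close>

definition sphere_functional :: "((real ^ 'n \<Rightarrow> real) \<Rightarrow> real) \<Rightarrow> bool" where
  "sphere_functional \<Lambda> \<longleftrightarrow>
     (\<forall>p q. continuous_on UNIV p \<longrightarrow> continuous_on UNIV q \<longrightarrow> \<Lambda> (\<lambda>x. p x + q x) = \<Lambda> p + \<Lambda> q) \<and>
     (\<forall>c p. continuous_on UNIV p \<longrightarrow> \<Lambda> (\<lambda>x. c * p x) = c * \<Lambda> p) \<and>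
     (\<forall>p q. (\<forall>x\<in>sphere 0 1. p x = q x) \<longrightarrow> \<Lambda> p = \<Lambda> q)"

lemma sphere_functionalD:
  assumes "sphere_functional \<Lambda>"
  shows "continuous_on UNIV p \<Longrightarrow> continuous_on UNIV q \<Longrightarrow> \<Lambda> (\<lambda>x. p x + q x) = \<Lambda> p + \<Lambda> q"
    and "continuous_on UNIV p \<Longrightarrow> \<Lambda> (\<lambda>x. c * p x) = c * \<Lambda> p"
    and "(\<And>x. x \<in> sphere 0 1 \<Longrightarrow> p x = q x) \<Longrightarrow> \<Lambda> p = \<Lambda> q"
  using assms unfolding sphere_functional_def by blast+

lemma sphere_functional_zero:
  assumes "sphere_functional \<Lambda>"
  shows "\<Lambda> (\<lambda>_. 0) = 0"
  using sphere_functionalD(2)[OF assms, of "\<lambda>_. 0" 0] by simp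

lemma sphere_functional_sum:
  assumes "sphere_functional \<Lambda>" "\<And>i. i \<in> I \<Longrightarrow> continuous_on UNIV (p i)"
  shows "\<Lambda> (\<lambda>x. \<Sum>i\<in>I. c i * p i x) = (\<Sum>i\<in>I. c i * \<Lambda> (p i))"
proof (cases "finite I")
  case True
  then show ?thesis
    using assms(2)
  proof (induction I rule: finite_induct)
    case empty
    then show ?case using sphere_functional_zero[OF assms(1)] by simp
  next
    case (insert i I)
    then have c: "continuous_on UNIV (p j)" if "j \<in> insert i I" for j
      using that by blast
    have "\<Lambda> (\<lambda>x. c i * p i x + (\<Sum>j\<in>I. c j * p j x))
        = \<Lambda> (\<lambda>x. c i * p i x) + \<Lambda> (\<lambda>x. \<Sum>j\<in>I. c j * p j x)"
      by (intro sphere_functionalD(1)[OF assms(1)] continuous_on_mult_left continuous_on_sum c) auto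
    then show ?case
      using insert c by (simp add: sphere_functionalD(2)[OF assms(1)])
  qed
qed (simp add: sphere_functional_zero[OF assms(1)])

text \<open>Monomials indexed by words instead of exponents: a monomial of degree \<open>k\<close> is listed once for every order of its
factors. With this multiplicity the expansion of \<open>(x \<bullet> z) ^ k\<close> has no multinomial coefficients.\<close>

definition word_monomial :: "'n list \<Rightarrow> real ^ 'n \<Rightarrow> real" where
  "word_monomial w x = (\<Prod>i\<leftarrow>w. x $ i)"

lemma continuous_on_word_monomial [continuous_intros]: "continuous_on S (word_monomial w)"
  unfolding word_monomial_def
  by (induction w) (auto intro!: continuous_intros)

lemma word_monomial_simps [simp]:
  "word_monomial [] x = 1" "word_monomial (i # w) x = x $ i * word_monomial w x"
  by (simp_all add: word_monomial_def)

definition words :: "nat \<Rightarrow> 'n list set" where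
  "words k = {w. length w = k}"

lemma finite_words [simp]: "finite (words k :: 'n::finite list set)"
  using finite_lists_length_eq[of "UNIV :: 'n set" k] by (simp add: words_def)

lemma words_Suc: "words (Suc k) = (\<lambda>(i, w). i # w) ` (UNIV \<times> words k)"
  by (auto simp: words_def length_Suc_conv image_iff)

lemma inner_power_eq_sum_words:
  fixes x z :: "real ^ 'n"
  shows "(x \<bullet> z) ^ k = (\<Sum>w\<in>words k. word_monomial w z * word_monomial w x)"
proof (induction k)
  case 0
  have "words 0 = {[] :: 'n list}" by (auto simp: words_def)
  then show ?case by simp
next
  case (Suc k)
  have inj: "inj_on (\<lambda>(i, w). i # w) (UNIV \<times> words k :: ('n \<times> 'n list) set)"
    by (auto simp: inj_on_def)
  have "(\<Sum>w\<in>words (Suc k). word_monomial w z * word_monomial w x)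
      = (\<Sum>(i, w)\<in>UNIV \<times> words k. (x $ i * z $ i) * (word_monomial w z * word_monomial w x))"
    unfolding words_Suc sum.reindex[OF inj] by (simp add: o_def split_def mult_ac)
  also have "\<dots> = (x \<bullet> z) * (\<Sum>w\<in>words k. word_monomial w z * word_monomial w x)"
    by (simp add: sum.cartesian_product[symmetric] inner_vec_def sum_product)
  finally show ?case by (simp add: Suc)
qed

text \<open>The energy of \<open>\<Lambda>\<close>, with both variables expanded in words, is the sum of the squares of the numbers
\<open>\<Lambda> (word_monomial w)\<close>.\<close>

lemma words_vanish_if_energy_zero:
  fixes \<Lambda> :: "(real ^ 'n \<Rightarrow> real) \<Rightarrow> real"
  assumes \<Lambda>: "sphere_functional \<Lambda>"
    and energy: "\<Lambda> (\<lambda>z. \<Lambda> (\<lambda>x. (x \<bullet> z) ^ k)) = 0"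
    and w: "length w = k"
  shows "\<Lambda> (word_monomial w) = 0"
proof -
  have "\<Lambda> (\<lambda>x. (x \<bullet> z) ^ k) = (\<Sum>w\<in>words k. \<Lambda> (word_monomial w) * word_monomial w z)" for z
    unfolding inner_power_eq_sum_words
    by (subst sphere_functional_sum[OF \<Lambda>]) (auto intro!: continuous_intros sum.cong)
  then have "\<Lambda> (\<lambda>z. \<Lambda> (\<lambda>x. (x \<bullet> z) ^ k)) = (\<Sum>w\<in>words k. (\<Lambda> (word_monomial w))\<^sup>2)"
    by (simp add: sphere_functional_sum[OF \<Lambda>] continuous_on_word_monomial power2_eq_square)
  with energy have "\<forall>w\<in>words k. (\<Lambda> (word_monomial w))\<^sup>2 = 0"
    by (subst (asm) eq_commute) (simp add: sum_nonneg_eq_0_iff)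
  with w show ?thesis by (simp add: words_def)
qed

text \<open>On the sphere a monomial equals its product with \<open>x \<bullet> x\<close>, which is a sum of monomials of degree two higher.\<close>

lemma shorter_words_vanish:
  fixes \<Lambda> :: "(real ^ 'n \<Rightarrow> real) \<Rightarrow> real"
  assumes \<Lambda>: "sphere_functional \<Lambda>"
    and top: "\<And>w. length w = k \<Longrightarrow> \<Lambda> (word_monomial w) = 0"
    and len: "length w + 2 * j = k"
  shows "\<Lambda> (word_monomial w) = 0"
  using len
proof (induction j arbitrary: w)
  case 0
  then show ?case using top by simp
next
  case (Suc j)
  have "\<Lambda> (word_monomial w) = \<Lambda> (\<lambda>x. \<Sum>i\<in>UNIV. 1 * word_monomial (i # i # w) x)"
  proof (rule sphere_functionalD(3)[OF \<Lambda>])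
    fix x :: "real ^ 'n" assume "x \<in> sphere 0 1"
    then have "x \<bullet> x = 1" by (simp add: dot_square_norm)
    then have "(\<Sum>i\<in>UNIV. x $ i * x $ i) = 1" by (simp add: inner_vec_def)
    then show "word_monomial w x = (\<Sum>i\<in>UNIV. 1 * word_monomial (i # i # w) x)"
      by (simp add: mult.assoc[symmetric] sum_distrib_right[symmetric])
  qed
  also have "\<dots> = 0"
    using Suc.prems
    by (subst sphere_functional_sum[OF \<Lambda>]) (auto intro!: continuous_intros Suc.IH sum.neutral)
  finally show ?case .
qed

lemma monomial_eq_word_monomial:
  fixes \<alpha> :: "'n::finite \<Rightarrow> nat"
  obtains w where "length w = (\<Sum>i\<in>UNIV. \<alpha> i)" "\<And>x. (\<Prod>i\<in>UNIV. (x $ i) ^ \<alpha> i) = word_monomial w x"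
proof -
  have app: "word_monomial (u @ v) x = word_monomial u x * word_monomial v x" for u v and x :: "real ^ 'n"
    by (simp add: word_monomial_def)
  have rep: "word_monomial (replicate m i) x = (x $ i) ^ m" for m i and x :: "real ^ 'n"
    by (induction m) simp_all
  have "\<exists>w. length w = (\<Sum>i\<in>I. \<alpha> i) \<and> (\<forall>x. (\<Prod>i\<in>I. (x $ i) ^ \<alpha> i) = word_monomial w x)" for I :: "'n set"
    using finite[of I]
  proof (induction I rule: finite_induct)
    case empty
    show ?case by (intro exI[of _ "[]"]) simp
  next
    case (insert i I)
    then obtain w where "length w = (\<Sum>i\<in>I. \<alpha> i)" "\<forall>x. (\<Prod>i\<in>I. (x $ i) ^ \<alpha> i) = word_monomial w x"
      by blast
    with insert.hyps show ?case
      by (intro exI[of _ "replicate (\<alpha> i) i @ w"]) (simp add: app rep)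
  qed
  then show thesis using that by blast
qed

text \<open>Two consecutive exponents suffice, one for each parity of the degree.\<close>

lemma vanishes_on_Pol_le:
  fixes \<Lambda> :: "(real ^ 'n \<Rightarrow> real) \<Rightarrow> real"
  assumes \<Lambda>: "sphere_functional \<Lambda>"
    and energy: "\<Lambda> (\<lambda>z. \<Lambda> (\<lambda>x. (x \<bullet> z) ^ k)) = 0" "\<Lambda> (\<lambda>z. \<Lambda> (\<lambda>x. (x \<bullet> z) ^ Suc k)) = 0"
    and p: "p \<in> Pol_le (Suc k)"
  shows "\<Lambda> p = 0"
proof -
  obtain c where c: "p = (\<lambda>x. \<Sum>\<alpha> | (\<Sum>i\<in>UNIV. \<alpha> i) \<le> Suc k. c \<alpha> * (\<Prod>i\<in>UNIV. (x $ i) ^ \<alpha> i))"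
    using p by (auto simp: Pol_le_def)
  have mono: "\<Lambda> (\<lambda>x. \<Prod>i\<in>UNIV. (x $ i) ^ \<alpha> i) = 0" if "(\<Sum>i\<in>UNIV. \<alpha> i) \<le> Suc k" for \<alpha> :: "'n \<Rightarrow> nat"
  proof -
    obtain w where w: "length w = (\<Sum>i\<in>UNIV. \<alpha> i)" "\<And>x. (\<Prod>i\<in>UNIV. (x $ i) ^ \<alpha> i) = word_monomial w x"
      using monomial_eq_word_monomial[of \<alpha>] by blast
    then have "length w \<le> Suc k" using that by simp
    then have "\<exists>j. length w + 2 * j = k \<or> length w + 2 * j = Suc k" by presburger
    then obtain j where "length w + 2 * j = k \<or> length w + 2 * j = Suc k" ..
    then have "\<Lambda> (word_monomial w) = 0"
      using shorter_words_vanish[OF \<Lambda> words_vanish_if_energy_zero[OF \<Lambda> energy(1)], of k w j]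
        shorter_words_vanish[OF \<Lambda> words_vanish_if_energy_zero[OF \<Lambda> energy(2)], of "Suc k" w j]
      by blast
    then show ?thesis by (simp add: w(2))
  qed
  show ?thesis
    unfolding c by (subst sphere_functional_sum[OF \<Lambda>]) (auto intro!: continuous_intros sum.neutral mono)
qed

lemma vanishes_on_Pol_le_even:
  fixes \<Lambda> :: "(real ^ 'n \<Rightarrow> real) \<Rightarrow> real"
  assumes \<Lambda>: "sphere_functional \<Lambda>"
    and sym: "\<And>p. continuous_on UNIV p \<Longrightarrow> \<Lambda> (\<lambda>x. p (- x)) = \<Lambda> p"
    and energy: "\<Lambda> (\<lambda>z. \<Lambda> (\<lambda>x. (x \<bullet> z) ^ k)) = 0" and k: "even k"
    and p: "p \<in> Pol_le (Suc k)"
  shows "\<Lambda> p = 0"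
proof (rule vanishes_on_Pol_le[OF \<Lambda> energy _ p])
  have "\<Lambda> (\<lambda>x. (x \<bullet> z) ^ Suc k) = 0" for z
  proof -
    have "\<Lambda> (\<lambda>x. (x \<bullet> z) ^ Suc k) = \<Lambda> (\<lambda>x. - 1 * (x \<bullet> z) ^ Suc k)"
      using sym[of "\<lambda>x. (x \<bullet> z) ^ Suc k"] k by (simp add: continuous_on_mult continuous_on_power continuous_on_inner)
    also have "\<dots> = - 1 * \<Lambda> (\<lambda>x. (x \<bullet> z) ^ Suc k)"
      by (rule sphere_functionalD(2)[OF \<Lambda>]) (intro continuous_intros)
    finally show ?thesis by simp
  qed
  then show "\<Lambda> (\<lambda>z. \<Lambda> (\<lambda>x. (x \<bullet> z) ^ Suc k)) = 0"
    by (simp only: sphere_functional_zero[OF \<Lambda>])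
qed

section \<open>Moments of the invariant measure\<close>

context
  fixes \<sigma> :: "(real ^ 'n) measure"
  assumes \<sigma>: "invariant_sphere_measure \<sigma>"
begin

lemma space_sphere: "space \<sigma> = sphere 0 1"
  using \<sigma> sets_eq_imp_space_eq[of \<sigma> "restrict_space borel (sphere 0 1)"]
  by (simp add: invariant_sphere_measure_def space_restrict_space)

lemma prob_space_sphere: "prob_space \<sigma>"
  using \<sigma> by (simp add: invariant_sphere_measure_def)

lemma measurable_sphere:
  assumes "continuous_on UNIV p"
  shows "p \<in> borel_measurable \<sigma>"
proof -
  have s: "sets \<sigma> = sets (restrict_space borel (sphere 0 1))"
    using \<sigma> by (simp add: invariant_sphere_measure_def)
  show ?thesis
    unfolding measurable_cong_sets[OF s refl]
    by (rule measurable_restrict_space1[OF borel_measurable_continuous_onI[OF assms]])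
qed

lemma integrable_sphere:
  fixes p :: "real ^ 'n \<Rightarrow> real"
  assumes "continuous_on UNIV p"
  shows "integrable \<sigma> p"
proof -
  interpret prob_space \<sigma> by (rule prob_space_sphere)
  have "compact (p ` sphere 0 1)"
    by (intro compact_continuous_image continuous_on_subset[OF assms]) auto
  then obtain B where "\<forall>y\<in>p ` sphere 0 1. norm y \<le> B"
    using compact_imp_bounded bounded_iff by metis
  then have "AE x in \<sigma>. norm (p x) \<le> B"
    by (intro AE_I2) (simp add: space_sphere)
  then show ?thesis
    by (rule integrable_const_bound[OF _ measurable_sphere[OF assms]])
qed

lemma integral_orthogonal:
  fixes p :: "real ^ 'n \<Rightarrow> real"
  assumes f: "orthogonal_transformation f" and p: "continuous_on UNIV p"
  shows "(\<integral>x. p (f x) \<partial>\<sigma>) = (\<integral>x. p x \<partial>\<sigma>)"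
proof -
  have d: "distr \<sigma> \<sigma> f = \<sigma>" using \<sigma> f unfolding invariant_sphere_measure_def by blast
  have s: "sets \<sigma> = sets (restrict_space borel (sphere 0 1))"
    using \<sigma> by (simp add: invariant_sphere_measure_def)
  have "f \<in> borel_measurable borel"
    using orthogonal_transformation_linear[OF f] linear_conv_bounded_linear
    by (intro borel_measurable_continuous_onI linear_continuous_on) blast
  then have "f \<in> measurable (restrict_space borel (sphere 0 1)) (restrict_space borel (sphere 0 1))"
    using orthogonal_transformation_norm[OF f] by (intro measurable_restrict_space3) auto
  then have "f \<in> measurable \<sigma> \<sigma>" unfolding measurable_cong_sets[OF s s] .
  from integral_distr[OF this measurable_sphere[OF p]] show ?thesis unfolding d by (rule sym)
qed

lemma sphere_functional_integral: "sphere_functional (\<lambda>p. \<integral>x. p x \<partial>\<sigma>)"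
  unfolding sphere_functional_def
proof (intro conjI allI impI)
  fix p q :: "real ^ 'n \<Rightarrow> real"
  assume "continuous_on UNIV p" "continuous_on UNIV q"
  then show "(\<integral>x. p x + q x \<partial>\<sigma>) = (\<integral>x. p x \<partial>\<sigma>) + (\<integral>x. q x \<partial>\<sigma>)"
    by (intro Bochner_Integration.integral_add integrable_sphere)
next
  fix p q :: "real ^ 'n \<Rightarrow> real"
  assume "\<forall>x\<in>sphere 0 1. p x = q x"
  then show "(\<integral>x. p x \<partial>\<sigma>) = (\<integral>x. q x \<partial>\<sigma>)"
    by (intro Bochner_Integration.integral_cong) (simp_all only: space_sphere)
qed simp

lemma integral_uminus:
  "continuous_on UNIV p \<Longrightarrow> (\<integral>x. p (- x) \<partial>\<sigma>) = (\<integral>x. p x \<partial>\<sigma>)" for p :: "real ^ 'n \<Rightarrow> real"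
  by (rule integral_orthogonal[of uminus]) (simp_all add: orthogonal_transformation_def linear_uminus)


text \<open>A rotation takes \<open>z\<close> to a multiple of a coordinate vector.\<close>

lemma integral_inner_power_norm:
  "(\<integral>x. (x \<bullet> z) ^ k \<partial>\<sigma>) = (\<integral>x. (x $ i) ^ k \<partial>\<sigma>) * norm z ^ k"
proof -
  have n: "norm z = norm (norm z *\<^sub>R axis i 1 :: real ^ 'n)" by (simp add: norm_axis_1)
  obtain f where f: "orthogonal_transformation f" "f z = (norm z *\<^sub>R axis i 1 :: real ^ 'n)"
    by (rule orthogonal_transformation_exists[OF n])
  have "f x \<bullet> f z = x \<bullet> z" for x
    using f(1) unfolding orthogonal_transformation_def by blast
  then have "(\<integral>x. (x \<bullet> z) ^ k \<partial>\<sigma>) = (\<integral>x. (f x \<bullet> f z) ^ k \<partial>\<sigma>)"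
    by simp
  also have "\<dots> = (\<integral>x. (x \<bullet> f z) ^ k \<partial>\<sigma>)"
    by (rule integral_orthogonal[OF f(1), of "\<lambda>x. (x \<bullet> f z) ^ k"]) (intro continuous_intros)
  also have "\<dots> = (\<integral>x. (x $ i) ^ k \<partial>\<sigma>) * norm z ^ k"
    by (simp add: f(2) power_mult_distrib inner_axis mult.commute)
  finally show ?thesis .
qed

text \<open>The integral of \<open>(x \<bullet> (e\<^sub>i + t e\<^sub>j)) ^ (2 h)\<close> is the moment of \<open>x\<^sub>i\<close> of order \<open>2 h\<close> times \<open>(1 + t\<^sup>2) ^ h\<close>. Both
sides are polynomials in \<open>t\<close>; compare the coefficients of \<open>t\<^sup>2\<close>.\<close>

lemma integral_mixed_coordinates:
  assumes ij: "i \<noteq> j" and h: "h > 0"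
  shows "(2 * real h - 1) * (\<integral>x. (x $ i) ^ (2 * h - 2) * (x $ j)\<^sup>2 \<partial>\<sigma>) = (\<integral>x. (x $ i) ^ (2 * h) \<partial>\<sigma>)"
proof -
  define I where "I l = (\<integral>x. (x $ j) ^ l * (x $ i) ^ (2 * h - l) \<partial>\<sigma>)" for l
  define m where "m = (\<integral>x. (x $ i) ^ (2 * h) \<partial>\<sigma>)"
  define P where "P = (\<Sum>l\<le>2 * h. monom (real (2 * h choose l) * I l) l)"
  have "poly P t = poly (smult m ([:1, 0, 1:] ^ h)) t" for t
  proof -
    define z :: "real ^ 'n" where "z = axis i 1 + t *\<^sub>R axis j 1"
    have "z \<bullet> z = 1 + t\<^sup>2"
      using ij by (simp add: z_def inner_simps inner_axis_axis power2_eq_square)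
    then have nz: "norm z ^ (2 * h) = (1 + t\<^sup>2) ^ h"
      by (simp add: power_mult power2_norm_eq_inner)
    have "(x \<bullet> z) ^ (2 * h) = (\<Sum>l\<le>2 * h. (real (2 * h choose l) * t ^ l) * ((x $ j) ^ l * (x $ i) ^ (2 * h - l)))" for x
    proof -
      have "x \<bullet> z = t * (x $ j) + x $ i" by (simp add: z_def inner_simps inner_axis)
      then show ?thesis
        by (simp add: binomial_ring power_mult_distrib mult_ac)
    qed
    then have "(\<integral>x. (x \<bullet> z) ^ (2 * h) \<partial>\<sigma>) = (\<Sum>l\<le>2 * h. real (2 * h choose l) * t ^ l * I l)"
      by (simp add: I_def, subst sphere_functional_sum[OF sphere_functional_integral])
        (auto intro!: continuous_intros)
    then have "poly P t = m * (1 + t\<^sup>2) ^ h"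
      unfolding integral_inner_power_norm[of z "2 * h" i] nz m_def[symmetric]
      by (simp add: P_def poly_sum poly_monom mult_ac)
    then show ?thesis by (simp add: power2_eq_square algebra_simps)
  qed
  then have P: "P = smult m ([:1, 0, 1:] ^ h)"
    by (simp add: poly_eq_poly_eq_iff[symmetric] fun_eq_iff)
  have base: "coeff ([:1, 0, 1:] ^ h :: real poly) 0 = 1 \<and> coeff ([:1, 0, 1:] ^ h :: real poly) 1 = 0
      \<and> coeff ([:1, 0, 1:] ^ h :: real poly) 2 = real h"
    by (induction h) (auto simp: numeral_2_eq_2 algebra_simps)
  have "coeff P 2 = real (2 * h choose 2) * I 2"
    using h by (simp add: P_def coeff_sum if_distrib[of "\<lambda>x. _ * x"] cong: if_cong)
  then have "real (2 * h choose 2) * I 2 = m * h" using base by (simp add: P)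
  moreover have "real (2 * h choose 2) = real h * (2 * real h - 1)"
  proof -
    have "2 * h choose 2 = h * (2 * h - 1)" by (simp add: choose_two)
    then show ?thesis using h by (simp add: of_nat_diff)
  qed
  ultimately have "(2 * real h - 1) * I 2 = m" using h by (simp add: mult_ac)
  then show ?thesis by (simp add: I_def m_def mult_ac)
qed

end

text \<open>The moments of a coordinate on the unit sphere of \<open>n\<close>-dimensional space. For \<open>n = 4\<close> the even ones are the Catalan
numbers divided by powers of 4.\<close>

fun sphere_moment :: "nat \<Rightarrow> nat \<Rightarrow> real" where
  "sphere_moment n 0 = 1"
| "sphere_moment n (Suc 0) = 0"
| "sphere_moment n (Suc (Suc k)) = real (k + 1) / real (k + n) * sphere_moment n k"

text \<open>Summing \<open>x\<^sub>i ^ k x\<^sub>j\<^sup>2\<close> over \<open>j\<close> gives \<open>x\<^sub>i ^ k\<close> on the sphere, and every term with \<open>j \<noteq> i\<close> has the same integral by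
\<open>integral_mixed_coordinates\<close>. This is the recursion of \<^const>\<open>sphere_moment\<close>.\<close>

lemma integral_inner_power:
  fixes \<sigma> :: "(real ^ 'n) measure"
  assumes \<sigma>: "invariant_sphere_measure \<sigma>"
  shows "(\<integral>x. (x \<bullet> z) ^ k \<partial>\<sigma>) = sphere_moment CARD('n) k * norm z ^ k"
proof -
  fix i :: 'n
  interpret prob_space \<sigma> by (rule prob_space_sphere[OF \<sigma>])
  define m where "m k = (\<integral>x. (x $ i) ^ k \<partial>\<sigma>)" for k
  have m0: "m 0 = 1" by (simp add: m_def prob_space)
  have odd: "m k = 0" if "odd k" for k
  proof -
    have "(\<integral>x. ((- x) $ i) ^ k \<partial>\<sigma>) = m k"
      unfolding m_def by (rule integral_uminus[OF \<sigma>, of "\<lambda>x. (x $ i) ^ k"]) (intro continuous_intros)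
    then show ?thesis using that by (simp add: m_def)
  qed
  have rec: "m (k + 2) * (k + CARD('n)) = (k + 1) * m k" if "even k" for k
  proof -
    obtain h' where "k = 2 * h'" using \<open>even k\<close> by (rule evenE)
    define h where "h = Suc h'"
    have h: "k + 2 = 2 * h" "h > 0" by (simp_all add: h_def \<open>k = 2 * h'\<close>)
    have k: "k = 2 * h - 2" using h by simp
    have cont: "continuous_on UNIV (\<lambda>x :: real ^ 'n. (x $ i) ^ k * (x $ j)\<^sup>2)" for j
      by (intro continuous_intros)
    have "m k = (\<integral>x. (\<Sum>j\<in>UNIV. 1 * ((x $ i) ^ k * (x $ j)\<^sup>2)) \<partial>\<sigma>)"
      unfolding m_def
    proof (rule Bochner_Integration.integral_cong[OF refl])
      fix x assume "x \<in> space \<sigma>"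
      then have "x \<bullet> x = 1" by (simp add: space_sphere[OF \<sigma>] dot_square_norm)
      then have "(\<Sum>j\<in>UNIV. (x $ j)\<^sup>2) = 1" by (simp add: inner_vec_def power2_eq_square)
      then show "(x $ i) ^ k = (\<Sum>j\<in>UNIV. 1 * ((x $ i) ^ k * (x $ j)\<^sup>2))"
        by (simp add: sum_distrib_left[symmetric])
    qed
    also have "\<dots> = (\<Sum>j\<in>UNIV. \<integral>x. (x $ i) ^ k * (x $ j)\<^sup>2 \<partial>\<sigma>)"
      by (subst sphere_functional_sum[OF sphere_functional_integral[OF \<sigma>] cont]) simp
    also have "\<dots> = m (k + 2) + (\<Sum>j\<in>UNIV - {i}. \<integral>x. (x $ i) ^ k * (x $ j)\<^sup>2 \<partial>\<sigma>)"
      by (subst sum.remove[of _ i]) (simp_all add: m_def power_add power2_eq_square mult_ac)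
    also have "(\<Sum>j\<in>UNIV - {i}. \<integral>x. (x $ i) ^ k * (x $ j)\<^sup>2 \<partial>\<sigma>) = (\<Sum>j\<in>UNIV - {i}. m (k + 2) / (k + 1))"
    proof (rule sum.cong[OF refl])
      fix j assume "j \<in> UNIV - {i}"
      then have "i \<noteq> j" by auto
      have "(2 * real h - 1) * (\<integral>x. (x $ i) ^ k * (x $ j)\<^sup>2 \<partial>\<sigma>) = m (k + 2)"
        using integral_mixed_coordinates[OF \<sigma> \<open>i \<noteq> j\<close> h(2)]
        unfolding h(1) m_def k[symmetric] .
      moreover have "2 * real h - 1 = real k + 1" using h by (simp add: k of_nat_diff)
      ultimately have "(real k + 1) * (\<integral>x. (x $ i) ^ k * (x $ j)\<^sup>2 \<partial>\<sigma>) = m (k + 2)"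
        by (simp only:)
      then show "(\<integral>x. (x $ i) ^ k * (x $ j)\<^sup>2 \<partial>\<sigma>) = m (k + 2) / (k + 1)"
        by (simp add: eq_divide_eq mult.commute add.commute)
    qed
    also have "\<dots> = (CARD('n) - 1) * (m (k + 2) / (k + 1))"
      by (simp add: card_Diff_singleton)
    finally have "m k * (k + 1) = m (k + 2) * (k + 1) + (CARD('n) - 1) * m (k + 2)"
      by (simp add: field_simps)
    then show ?thesis by (simp add: algebra_simps of_nat_diff)
  qed
  have "m k = sphere_moment CARD('n) k" for k
  proof (induction k rule: nat_less_induct)
    case (1 k)
    show ?case
    proof (cases "odd k \<or> k = 0")
      case True
      have "sphere_moment n l = 0" if "odd l" for n l
        using that by (induction n l rule: sphere_moment.induct) auto
      with True odd m0 show ?thesis by auto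
    next
      case False
      then obtain l where l: "k = l + 2" "even l" by (auto elim!: evenE intro: that[of "k - 2"])
      have "real (l + CARD('n)) \<noteq> 0" by (simp only: of_nat_eq_0_iff) simp
      then have "m k = real (l + 1) / real (l + CARD('n)) * m l"
        using rec[OF l(2)] by (simp add: l(1) eq_divide_eq del: of_nat_add)
      then show ?thesis using 1 l by simp
    qed
  qed
  then show ?thesis using integral_inner_power_norm[OF \<sigma>, of z k i] by (simp add: m_def)
qed

lemma sphere_moment_4:
  "sphere_moment 4 2 = 1 / 4" "sphere_moment 4 3 = 0" "sphere_moment 4 6 = 5 / 64" "sphere_moment 4 18 = 4862 / 4 ^ 9"
  by (simp_all add: eval_nat_numeral)

section \<open>Integrals along Euler cycles\<close>

text \<open>An Euler cycle traverses every edge in exactly one of its two directions, so it contains exactly one of \<open>(x, y)\<close> and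
\<open>(y, x)\<close> for each edge.\<close>

lemma sum_list_arcs_euler_cycle:
  fixes A :: "'a \<times> 'a \<Rightarrow> real"
  assumes euler: "euler_cycle {{x, y} | x y. (x, y) \<in> R} vs"
    and sym: "\<And>x y. (x, y) \<in> R \<Longrightarrow> (y, x) \<in> R" and irrefl: "\<And>x. (x, x) \<notin> R"
    and A: "\<And>x y. (x, y) \<in> R \<Longrightarrow> A (y, x) = A (x, y)"
  shows "(\<Sum>e\<leftarrow>arcs vs. A e) = (\<Sum>e\<in>R. A e) / 2" and "set (arcs vs) \<subseteq> R"
proof -
  define edge where "edge = (\<lambda>(x :: 'a, y). {x, y})"
  define S where "S = set (arcs vs)"
  have dist: "distinct (map edge (arcs vs))" and img: "edge ` S = {{x, y} | x y. (x, y) \<in> R}"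
    using euler by (simp_all add: euler_cycle_def edge_def S_def)
  have inj: "inj_on edge S" using dist by (simp add: distinct_map S_def)
  show SR: "set (arcs vs) \<subseteq> R"
  proof
    fix e assume "e \<in> set (arcs vs)"
    then have "edge e \<in> edge ` S" by (simp add: S_def)
    then obtain x y where "edge e = {x, y}" "(x, y) \<in> R" unfolding img by blast
    then show "e \<in> R" using sym by (cases e) (auto simp: edge_def doubleton_eq_iff)
  qed
  have R: "R = S \<union> prod.swap ` S"
  proof
    show "R \<subseteq> S \<union> prod.swap ` S"
    proof
      fix e assume "e \<in> R"
      moreover obtain x y where e: "e = (x, y)" by (cases e)
      ultimately have "{x, y} \<in> edge ` S" unfolding img by blast
      then obtain u v where "(u, v) \<in> S" "{x, y} = {u, v}" by (auto simp: edge_def)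
      then show "e \<in> S \<union> prod.swap ` S" by (force simp: e doubleton_eq_iff)
    qed
    show "S \<union> prod.swap ` S \<subseteq> R" using SR sym by (auto simp: S_def)
  qed
  have disj: "S \<inter> prod.swap ` S = {}"
  proof (rule equals0I)
    fix e assume "e \<in> S \<inter> prod.swap ` S"
    then obtain x y where e: "e = (x, y)" "(x, y) \<in> S" "(y, x) \<in> S" by (cases e) auto
    have "edge (x, y) = edge (y, x)" by (auto simp: edge_def)
    then have "(x, y) = (y, x)" by (rule inj_onD[OF inj _ e(2,3)])
    then have "y = x" by blast
    moreover have "(x, y) \<in> R" using e(2) SR unfolding S_def by (rule rev_subsetD)
    ultimately show False using irrefl[of x] by simp
  qed
  have "sum A R = sum A S + sum A (prod.swap ` S)"
    unfolding R by (rule sum.union_disjoint[OF _ _ disj]) (simp_all add: S_def)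
  also have "sum A (prod.swap ` S) = sum A S"
  proof -
    have "A (prod.swap e) = A e" if "e \<in> S" for e
      using that SR A by (cases e) (auto simp: S_def)
    then show ?thesis by (simp add: sum.reindex o_def)
  qed
  also have "sum A S = (\<Sum>e\<leftarrow>arcs vs. A e)"
    using dist by (simp add: S_def sum.distinct_set_conv_list distinct_map)
  finally show "(\<Sum>e\<leftarrow>arcs vs. A e) = (\<Sum>e\<in>R. A e) / 2" by simp
qed

definition arc_integral :: "('a::real_inner \<Rightarrow> real) \<Rightarrow> 'a \<times> 'a \<Rightarrow> real" where
  "arc_integral p = (\<lambda>(x, y). integral {0..arccos (x \<bullet> y)} (\<lambda>s. p (geodesic_arc x y s)))"

lemma cycle_integral_eq_sum_arcs: "cycle_integral vs p = (\<Sum>e\<leftarrow>arcs vs. arc_integral p e)"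
  by (simp add: cycle_integral_def arc_integral_def)

lemma arc_integral_swap: "arc_integral p (y, x) = arc_integral p (x, y)"
proof -
  define L where "L = arccos (x \<bullet> y)"
  have "arc_integral p (x, y) = integral {- L..0} (\<lambda>s. p (geodesic_arc x y (- s)))"
    using Henstock_Kurzweil_Integration.integral_reflect_real[of L 0 "\<lambda>s. p (geodesic_arc x y s)"] by (simp add: arc_integral_def L_def)
  also have "\<dots> = integral {0..L} (\<lambda>s. p (geodesic_arc x y (L - s)))"
    using integral_shift_real_ivl[of "- L" "- L" 0 "\<lambda>s. p (geodesic_arc x y (- s))"]
    by simp
  also have "\<dots> = integral {0..L} (\<lambda>s. p (geodesic_arc y x s))"
    by (simp add: geodesic_arc_def L_def inner_commute[of y x] add.commute)
  also have "\<dots> = arc_integral p (y, x)"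
    by (simp add: arc_integral_def L_def inner_commute[of y x])
  finally show ?thesis by (rule sym)
qed

lemma continuous_on_geodesic_arc: "continuous_on S (geodesic_arc x y)"
  unfolding geodesic_arc_def by (intro continuous_intros)

lemma integrable_on_geodesic_arc:
  fixes p :: "'a::real_inner \<Rightarrow> real"
  assumes "continuous_on UNIV p"
  shows "(\<lambda>s. p (geodesic_arc x y s)) integrable_on {a..b}"
  by (intro integrable_continuous_real continuous_on_compose2[OF assms continuous_on_geodesic_arc]) simp

lemma arc_integral_one:
  "- 1 \<le> x \<bullet> y \<Longrightarrow> x \<bullet> y \<le> 1 \<Longrightarrow> arc_integral (\<lambda>_. 1) (x, y) = arccos (x \<bullet> y)"
  by (simp add: arc_integral_def arccos_lbound)

lemma sphere_functional_cycle_integral: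
  fixes vs :: "(real ^ 'n) list"
  assumes vs: "geodesic_cycle vs"
  shows "sphere_functional (cycle_integral vs)"
proof -
  have *: "norm x = 1 \<and> norm y = 1 \<and> y \<noteq> x \<and> y \<noteq> - x" if "(x, y) \<in> set (arcs vs)" for x y
  proof -
    have "x \<in> set vs" "y \<in> set (tl vs)"
      using that by (auto simp: arcs_def dest: set_zip_leftD set_zip_rightD)
    moreover from this have "y \<in> set vs" by (cases vs) auto
    ultimately show ?thesis using vs that by (auto simp: geodesic_cycle_def)
  qed
  show ?thesis
    unfolding sphere_functional_def
  proof (intro conjI allI impI)
    fix p q :: "real ^ 'n \<Rightarrow> real"
    assume "continuous_on UNIV p" "continuous_on UNIV q"
    then have "arc_integral (\<lambda>x. p x + q x) e = arc_integral p e + arc_integral q e" for e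
      by (cases e) (simp add: arc_integral_def Henstock_Kurzweil_Integration.integral_add integrable_on_geodesic_arc)
    then show "cycle_integral vs (\<lambda>x. p x + q x) = cycle_integral vs p + cycle_integral vs q"
      by (simp add: cycle_integral_eq_sum_arcs sum_list_addf)
  next
    fix c and p :: "real ^ 'n \<Rightarrow> real"
    have "arc_integral (\<lambda>x. c * p x) e = c * arc_integral p e" for e
      by (cases e) (simp add: arc_integral_def)
    then show "cycle_integral vs (\<lambda>x. c * p x) = c * cycle_integral vs p"
      by (simp add: cycle_integral_eq_sum_arcs sum_list_const_mult)
  next
    fix p q :: "real ^ 'n \<Rightarrow> real"
    assume "\<forall>x\<in>sphere 0 1. p x = q x"
    then have "arc_integral p (x, y) = arc_integral q (x, y)" if "(x, y) \<in> set (arcs vs)" for x y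
      unfolding arc_integral_def prod.case using norm_geodesic_arc[of x y] *[OF that]
      by (intro Henstock_Kurzweil_Integration.integral_cong) simp
    then show "cycle_integral vs p = cycle_integral vs q"
      unfolding cycle_integral_eq_sum_arcs by (intro arg_cong[of _ _ sum_list] map_cong) auto
  qed
qed

text \<open>Every corner of a closed walk is the end point of one of its arcs.\<close>

lemma geodesic_cycle_if_euler_cycle:
  assumes euler: "euler_cycle {{x, y} | x y. (x, y) \<in> R} vs" and R: "R \<noteq> {}"
    and sub: "set (arcs vs) \<subseteq> R"
    and arc: "\<And>x y. (x, y) \<in> R \<Longrightarrow> norm x = 1 \<and> norm y = 1 \<and> y \<noteq> x \<and> y \<noteq> - x"
  shows "geodesic_cycle (vs :: 'a::real_inner list)"
proof -
  have hl: "hd vs = last vs" using euler by (simp add: euler_cycle_def)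
  have "set (map (\<lambda>(x, y). {x, y}) (arcs vs)) = {{x, y} | x y. (x, y) \<in> R}"
    using euler by (simp add: euler_cycle_def)
  moreover have "{{x, y} | x y. (x, y) \<in> R} \<noteq> {}" using R by auto
  ultimately have "arcs vs \<noteq> []" by auto
  then obtain v w us where vs: "vs = v # w # us"
    by (cases vs rule: list.exhaust[case_product list.exhaust]; cases "tl vs") (auto simp: arcs_def)
  have "set (tl vs) = snd ` set (arcs vs)"
  proof -
    have "map snd (arcs vs) = tl vs" unfolding arcs_def by (subst map_snd_zip_take) simp
    then show ?thesis by (metis set_map)
  qed
  then have tl: "set (tl vs) \<subseteq> sphere 0 1" using sub arc by force
  moreover have "hd vs \<in> set (tl vs)" unfolding hl by (simp add: vs)
  moreover have "set vs = insert (hd vs) (set (tl vs))" by (simp add: vs)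
  ultimately have "set vs \<subseteq> sphere 0 1" by (simp add: insert_absorb)
  moreover have "length vs \<ge> 2" by (simp add: vs)
  ultimately show ?thesis
    unfolding geodesic_cycle_def using hl sub arc by fastforce
qed

section \<open>Averages over great circles\<close>

lemma cis_eq_1_small:
  assumes "cis (2 * pi * real_of_int t / real N) = 1" "\<bar>t\<bar> < int N"
  shows "t = 0"
proof -
  have "cos (2 * pi * real_of_int t / real N) = 1"
    using assms(1) by (metis cis.simps(1) one_complex.simps(1))
  then obtain n :: int where "2 * pi * real_of_int t / real N = n * 2 * pi"
    by (auto simp: cos_one_2pi_int)
  moreover have "N > 0" using assms(2) by auto
  ultimately have "real_of_int t = real_of_int (n * int N)"
    by (simp add: field_simps)
  then have "t = n * int N" by (simp only: of_int_eq_iff)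
  moreover have "n = 0"
  proof (rule ccontr)
    assume "n \<noteq> 0"
    then have "1 * int N \<le> \<bar>n\<bar> * int N" by (intro mult_right_mono) auto
    then show False using assms(2) \<open>t = n * int N\<close> by (simp add: abs_mult)
  qed
  ultimately show ?thesis by simp
qed

text \<open>The \<open>k\<close>-th power of a function \<open>a cos + b sin\<close> is a combination of waves of frequencies between \<open>- k\<close> and \<open>k\<close>. Summation over
\<open>N > k\<close> equidistant points annihilates all of them except for the constant one.\<close>

lemma equidistant_power_sum_const:
  fixes a b s :: real
  assumes N: "k < N"
  shows "(\<Sum>j<N. (a * cos (s + 2 * pi * real j / real N) + b * sin (s + 2 * pi * real j / real N)) ^ k)
       = (\<Sum>j<N. (a * cos (2 * pi * real j / real N) + b * sin (2 * pi * real j / real N)) ^ k)"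
proof -
  define c where "c = Complex (a / 2) (- b / 2)"
  define q where "q l = cis (2 * pi * real_of_int (2 * int l - int k) / real N)" for l
  have Nz: "real N \<noteq> 0" using N by simp
  \<comment> \<open>\<open>q l\<close> is the factor by which the wave of index \<open>l\<close> changes from one point to the next.\<close>
  have wave: "complex_of_real (a * cos u + b * sin u) = c * cis u + cnj c * cis (- u)" for u
    by (simp add: c_def complex_eq_iff)
  have geo: "(\<Sum>j<N. q l ^ j) = (if 2 * l = k then of_nat N else 0)" if "l \<le> k" for l
  proof (cases "2 * l = k")
    case True
    then have "2 * int l - int k = 0" by simp
    then have "q l = 1" unfolding q_def by (simp only:) simp
    then show ?thesis using True by simp
  next
    case False
    then have "q l \<noteq> 1"
      using cis_eq_1_small[of "2 * int l - int k" N] that N unfolding q_def by linarith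
    moreover have "q l ^ N = 1"
    proof -
      have "real N * (2 * pi * real_of_int (2 * int l - int k) / real N) = 2 * pi * real_of_int (2 * int l - int k)"
        using Nz by simp
      then have "q l ^ N = cis (2 * pi * real_of_int (2 * int l - int k))"
        unfolding q_def Complex.DeMoivre by (simp only:)
      then show ?thesis by (simp only: cis_multiple_2pi[OF Ints_of_int])
    qed
    ultimately show ?thesis using False by (simp add: geometric_sum)
  qed
  have "complex_of_real (\<Sum>j<N. (a * cos (s + 2 * pi * real j / real N) + b * sin (s + 2 * pi * real j / real N)) ^ k)
      = (\<Sum>l\<le>k. of_nat (k choose l) * c ^ l * cnj c ^ (k - l) * (if 2 * l = k then of_nat N else 0))" for s
  proof -
    have term_eq: "complex_of_real (a * cos (s + 2 * pi * real j / real N) + b * sin (s + 2 * pi * real j / real N)) ^ k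
        = (\<Sum>l\<le>k. of_nat (k choose l) * c ^ l * cnj c ^ (k - l) * cis ((2 * real l - real k) * s) * q l ^ j)" for j
    proof -
      have "cis (s + 2 * pi * real j / real N) ^ l * cis (- (s + 2 * pi * real j / real N)) ^ (k - l)
          = cis ((2 * real l - real k) * s) * q l ^ j" if "l \<le> k" for l
        using that by (simp add: q_def Complex.DeMoivre cis_mult of_nat_diff algebra_simps add_divide_distrib diff_divide_distrib)
      then show ?thesis
        unfolding wave binomial_ring
        by (intro sum.cong refl) (simp add: power_mult_distrib mult_ac)
    qed
    have "complex_of_real (\<Sum>j<N. (a * cos (s + 2 * pi * real j / real N) + b * sin (s + 2 * pi * real j / real N)) ^ k)
      = (\<Sum>j<N. \<Sum>l\<le>k. of_nat (k choose l) * c ^ l * cnj c ^ (k - l) * cis ((2 * real l - real k) * s) * q l ^ j)"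
      by (simp only: of_real_sum of_real_power term_eq)
    also have "\<dots> = (\<Sum>l\<le>k. of_nat (k choose l) * c ^ l * cnj c ^ (k - l) * cis ((2 * real l - real k) * s) * (\<Sum>j<N. q l ^ j))"
      by (subst sum.swap) (simp add: sum_distrib_left)
    also have "\<dots> = (\<Sum>l\<le>k. of_nat (k choose l) * c ^ l * cnj c ^ (k - l) * (if 2 * l = k then of_nat N else 0))"
    proof (intro sum.cong refl)
      fix l assume "l \<in> {..k}"
      then have g: "(\<Sum>j<N. q l ^ j) = (if 2 * l = k then of_nat N else 0)" by (simp add: geo)
      show "of_nat (k choose l) * c ^ l * cnj c ^ (k - l) * cis ((2 * real l - real k) * s) * (\<Sum>j<N. q l ^ j)
          = of_nat (k choose l) * c ^ l * cnj c ^ (k - l) * (if 2 * l = k then of_nat N else 0)"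
        unfolding g by auto
    qed
    finally show ?thesis .
  qed
  from trans[OF this[of s] this[of 0, symmetric]] show ?thesis
    unfolding of_real_eq_iff add_0 .
qed


lemma inner_geodesic_arc:
  assumes "sin (arccos (x \<bullet> y)) \<noteq> 0"
  shows "geodesic_arc x y s \<bullet> z =
    (x \<bullet> z) * cos s + ((y \<bullet> z) - cos (arccos (x \<bullet> y)) * (x \<bullet> z)) / sin (arccos (x \<bullet> y)) * sin s"
proof -
  have "geodesic_arc x y s \<bullet> z =
      (sin (arccos (x \<bullet> y) - s) * (x \<bullet> z) + sin s * (y \<bullet> z)) / sin (arccos (x \<bullet> y))"
    by (simp only: geodesic_arc_def inner_scaleR_left inner_add_left divide_inverse mult.commute)
  then show ?thesis using assms by (simp add: sin_diff field_simps)
qed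

lemma sum_pairs: "(\<Sum>j<2 * n. f j) = (\<Sum>i<n. f (2 * i) + f (2 * i + 1))" for f :: "nat \<Rightarrow> real"
  by (induction n) simp_all

text \<open>Continuing the arc from \<open>x\<close> to \<open>y\<close> by the same angle \<open>\<theta>\<close> leads to the point \<open>2 cos \<theta> y - x\<close>. If these points belong to \<open>V\<close>, then
\<open>(x, y) \<mapsto> (y, 2 cos \<theta> y - x)\<close> permutes the adjacent pairs, and the sum \<open>H s\<close> of a function over all points at distance
\<open>s\<close> along the prolonged arcs has period \<open>\<theta> = \<pi> / m\<close>. By \<open>equidistant_power_sum_const\<close> for the \<open>4 m\<close> points at
multiples of \<open>\<theta> / 2\<close>, the sum \<open>H s + H (s + \<theta> / 2)\<close> is constant for powers below \<open>4 m\<close>. So the integral of \<open>H\<close> over a period is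
determined by \<open>H 0\<close> and \<open>H (\<theta> / 2)\<close>, which belong to the vertices and to the edge midpoints.\<close>

lemma sum_arc_integrals_rotation_closed:
  fixes V :: "'a::real_inner set" and m :: nat
  defines "\<theta> \<equiv> pi / m"
  defines "R \<equiv> {(x, y). x \<in> V \<and> y \<in> V \<and> x \<bullet> y = cos \<theta>}"
  assumes V: "finite V" "\<And>x. x \<in> V \<Longrightarrow> norm x = 1" and m: "m \<ge> 2" and k: "k < 4 * m"
    and closed: "\<And>x y. (x, y) \<in> R \<Longrightarrow> (2 * cos \<theta>) *\<^sub>R y - x \<in> V"
  shows "(\<Sum>e\<in>R. arc_integral (\<lambda>x. (x \<bullet> z) ^ k) e)
    = \<theta> / 2 * (\<Sum>(x, y)\<in>R. (x \<bullet> z) ^ k + (sgn (x + y) \<bullet> z) ^ k)"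
proof -
  have th: "0 < \<theta>" "\<theta> < pi" using m by (simp_all add: \<theta>_def field_simps)
  have s0: "sin \<theta> > 0" using th by (rule sin_gt_zero)
  have finR: "finite R"
    by (rule finite_subset[of _ "V \<times> V"]) (auto simp: R_def V)
  have arccos_R: "arccos (x \<bullet> y) = \<theta>" if "(x, y) \<in> R" for x y
    using that th by (simp add: R_def arccos_cos)
  define f where "f s = (\<lambda>(x, y). (geodesic_arc x y s \<bullet> z) ^ k)" for s
  define H where "H s = (\<Sum>e\<in>R. f s e)" for s
  define T where "T = (\<lambda>(x :: 'a, y). (y, (2 * cos \<theta>) *\<^sub>R y - x))"
  have TR: "T e \<in> R" if "e \<in> R" for e
  proof -
    obtain x y where e: "e = (x, y)" by (cases e)
    have "norm y = 1" using that V by (simp add: e R_def)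
    then have "y \<bullet> y = 1" by (simp add: dot_square_norm)
    then have "y \<bullet> ((2 * cos \<theta>) *\<^sub>R y - x) = cos \<theta>"
      using that by (simp add: e R_def inner_diff_right inner_commute)
    then show ?thesis using that closed[of x y] by (simp add: T_def e R_def)
  qed
  have inj: "inj_on T R" by (auto simp: inj_on_def T_def)
  then have "bij_betw T R R"
    using TR finR by (simp add: bij_betw_def endo_inj_surj image_subsetI)
  moreover have fT: "f s (T e) = f (s + \<theta>) e" if "e \<in> R" for s e
  proof -
    obtain x y where e: "e = (x, y)" by (cases e)
    have a: "arccos (x \<bullet> y) = \<theta>" using that arccos_R by (simp add: e)
    have b: "arccos (y \<bullet> ((2 * cos \<theta>) *\<^sub>R y - x)) = \<theta>" using TR[OF that] arccos_R by (simp add: e T_def)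
    have "geodesic_arc y ((2 * cos \<theta>) *\<^sub>R y - x) s = geodesic_arc x y (s + \<theta>)"
    proof -
      have "sin (\<theta> - s) *\<^sub>R y + sin s *\<^sub>R ((2 * cos \<theta>) *\<^sub>R y - x)
          = (sin (\<theta> - s) + sin s * (2 * cos \<theta>)) *\<^sub>R y + (- sin s) *\<^sub>R x"
        by (simp add: scaleR_diff_right scaleR_add_left)
      also have "sin (\<theta> - s) + sin s * (2 * cos \<theta>) = sin (s + \<theta>)"
        by (simp add: sin_diff sin_add)
      also have "- sin s = sin (\<theta> - (s + \<theta>))" by simp
      finally show ?thesis unfolding geodesic_arc_def a b by (simp only: add.commute)
    qed
    then show ?thesis by (simp add: f_def T_def e)
  qed
  ultimately have H_per: "H (s + \<theta>) = H s" for s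
    unfolding H_def using sum.reindex_bij_betw[of T R R "f s"] by (simp cong: sum.cong)
  have H_pern: "H (s + real i * \<theta>) = H s" for s i
  proof (induction i)
    case (Suc i)
    have "H (s + real (Suc i) * \<theta>) = H ((s + real i * \<theta>) + \<theta>)"
      by (simp only: of_nat_Suc distrib_right mult_1 add_ac)
    then show ?case using Suc by (simp only: H_per)
  qed simp
  have H_half: "H s + H (s + \<theta> / 2) = H 0 + H (\<theta> / 2)" for s
  proof -
    have f_const: "(\<Sum>j<4 * m. f (s + real j * (\<theta> / 2)) e) = (\<Sum>j<4 * m. f (real j * (\<theta> / 2)) e)"
      if "e \<in> R" for e
    proof -
      obtain x y where e: "e = (x, y)" by (cases e)
      have a: "arccos (x \<bullet> y) = \<theta>" using that arccos_R by (simp add: e)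
      have step: "2 * pi * real j / real (4 * m) = real j * (\<theta> / 2)" for j by (simp add: \<theta>_def mult.commute)
      show ?thesis
        using equidistant_power_sum_const[OF k, of "x \<bullet> z" s "((y \<bullet> z) - cos \<theta> * (x \<bullet> z)) / sin \<theta>"] s0
        unfolding step by (simp add: e f_def inner_geodesic_arc a)
    qed
    have sum_H: "(\<Sum>j<4 * m. H (s + real j * (\<theta> / 2))) = real (2 * m) * (H s + H (s + \<theta> / 2))" for s
    proof -
      have "(\<Sum>j<4 * m. H (s + real j * (\<theta> / 2))) = (\<Sum>i<2 * m. H (s + real i * \<theta>) + H (s + \<theta> / 2 + real i * \<theta>))"
        using sum_pairs[of "\<lambda>j. H (s + real j * (\<theta> / 2))" "2 * m"] by (simp add: algebra_simps)
      then show ?thesis by (simp add: H_pern)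
    qed
    have "(\<Sum>j<4 * m. H (s + real j * (\<theta> / 2))) = (\<Sum>j<4 * m. H (0 + real j * (\<theta> / 2)))"
      unfolding H_def by (subst (1 2) sum.swap, rule sum.cong[OF refl]) (simp only: f_const add_0)
    then show ?thesis unfolding sum_H using m by simp
  qed
  have contf: "continuous_on S (\<lambda>s. f s e)" for S e
    by (cases e) (auto simp: f_def intro!: continuous_intros continuous_on_geodesic_arc)
  then have contH: "continuous_on S H" for S
    unfolding H_def by (intro continuous_on_sum) auto
  have "(\<Sum>e\<in>R. arc_integral (\<lambda>x. (x \<bullet> z) ^ k) e) = (\<Sum>e\<in>R. integral {0..\<theta>} (\<lambda>s. f s e))"
    by (intro sum.cong refl) (auto simp: arc_integral_def f_def arccos_R)
  also have "\<dots> = integral {0..\<theta>} H"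
    unfolding H_def by (rule Henstock_Kurzweil_Integration.integral_sum[symmetric])
      (auto intro!: finR integrable_continuous_real contf)
  also have "\<dots> = integral {0..\<theta> / 2} H + integral {\<theta> / 2..\<theta>} H"
    using th by (intro Henstock_Kurzweil_Integration.integral_combine[symmetric] integrable_continuous_real contH) auto
  also have "integral {\<theta> / 2..\<theta>} H = integral {0..\<theta> / 2} (\<lambda>s. H (s + \<theta> / 2))"
    using integral_shift_real_ivl[of "\<theta> / 2" "\<theta> / 2" \<theta> H] by simp
  also have "integral {0..\<theta> / 2} H + \<dots> = integral {0..\<theta> / 2} (\<lambda>s. H s + H (s + \<theta> / 2))"
    by (intro Henstock_Kurzweil_Integration.integral_add[symmetric] integrable_continuous_real contH
        continuous_on_compose2[OF contH[of UNIV]] continuous_intros) auto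
  also have "\<dots> = \<theta> / 2 * (H 0 + H (\<theta> / 2))"
    using th by (simp add: H_half)
  also have "H 0 + H (\<theta> / 2) = (\<Sum>(x, y)\<in>R. (x \<bullet> z) ^ k + (sgn (x + y) \<bullet> z) ^ k)"
    unfolding H_def sum.distrib[symmetric]
  proof (intro sum.cong refl)
    fix e assume "e \<in> R"
    moreover obtain x y where e: "e = (x, y)" by (cases e)
    ultimately have xy: "norm x = 1" "norm y = 1" "x \<bullet> y = cos \<theta>" and a: "arccos (x \<bullet> y) = \<theta>"
      using V arccos_R by (auto simp: R_def)
    have "cos \<theta> < 1" "- 1 < cos \<theta>" using th cos_monotone_0_pi[of 0 \<theta>] cos_monotone_0_pi[of \<theta> pi] by auto
    then have ne: "y \<noteq> x" "y \<noteq> - x" using xy by (auto simp: dot_square_norm)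
    have "geodesic_arc x y 0 = x" using geodesic_arc_endpoints(1)[OF xy(1,2) ne] .
    moreover have "geodesic_arc x y (\<theta> / 2) = sgn (x + y)"
    proof -
      define c where "c = sin (\<theta> / 2) / sin \<theta>"
      have "sin (\<theta> / 2) > 0" by (rule sin_gt_zero) (use th in linarith)+
      then have "c > 0" using s0 by (simp add: c_def)
      have g: "geodesic_arc x y (\<theta> / 2) = c *\<^sub>R (x + y)"
      proof -
        have "\<theta> - \<theta> / 2 = \<theta> / 2" by simp
        then have "geodesic_arc x y (\<theta> / 2) = inverse (sin \<theta>) *\<^sub>R (sin (\<theta> / 2) *\<^sub>R (x + y))"
          unfolding geodesic_arc_def a by (simp only: scaleR_add_right)
        then show ?thesis unfolding scaleR_scaleR by (simp only: c_def divide_inverse mult.commute)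
      qed
      have "sgn (geodesic_arc x y (\<theta> / 2)) = geodesic_arc x y (\<theta> / 2)"
        using norm_geodesic_arc[OF xy(1,2) ne] by (simp add: sgn_div_norm)
      then show ?thesis using \<open>c > 0\<close> by (simp add: g sgn_scaleR)
    qed
    ultimately show "f 0 e + f (\<theta> / 2) e = (case e of (x, y) \<Rightarrow> (x \<bullet> z) ^ k + (sgn (x + y) \<bullet> z) ^ k)"
      by (simp add: e f_def)
  qed
  finally show ?thesis .
qed

section \<open>Vectors with coordinates in the ring of golden integers\<close>

text \<open>\<open>GInt a b\<close> stands for \<open>a + b \<phi>\<close>. Sums, products and equality of such numbers are computed by
integer arithmetic in this type.\<close>

datatype gint = GInt int int

instantiation gint :: comm_ring_1
begin
definition "0 = GInt 0 0"
definition "1 = GInt 1 0"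
fun plus_gint where "GInt a b + GInt c d = GInt (a + c) (b + d)"
fun uminus_gint where "- GInt a b = GInt (- a) (- b)"
fun minus_gint where "GInt a b - GInt c d = GInt (a - c) (b - d)"
fun times_gint where "GInt a b * GInt c d = GInt (a * c + b * d) (a * d + b * c + b * d)"
instance
proof
  fix a b c :: gint
  show "a * b * c = a * (b * c)" by (cases a; cases b; cases c) (simp add: algebra_simps)
  show "a * b = b * a" by (cases a; cases b) (simp add: algebra_simps)
  show "1 * a = a" by (cases a) (simp add: one_gint_def)
  show "(a + b) * c = a * c + b * c" by (cases a; cases b; cases c) (simp add: algebra_simps)
  show "a + b + c = a + (b + c)" by (cases a; cases b; cases c) simp
  show "a + b = b + a" by (cases a; cases b) simp
  show "0 + a = a" by (cases a) (simp add: zero_gint_def)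
  show "- a + a = 0" by (cases a) (simp add: zero_gint_def)
  show "a - b = a + - b" by (cases a; cases b) simp
  show "(0::gint) \<noteq> 1" by (simp add: zero_gint_def one_gint_def)
qed
end

fun of_gint :: "gint \<Rightarrow> real" where
  "of_gint (GInt a b) = of_int a + of_int b * golden_ratio"

lemma golden_ratio_square: "golden_ratio * golden_ratio = golden_ratio + 1"
  by (simp add: golden_ratio_def field_simps)

lemma of_gint_hom [simp]:
  "of_gint 0 = 0" "of_gint 1 = 1" "of_gint (x + y) = of_gint x + of_gint y"
  "of_gint (- x) = - of_gint x" "of_gint (x - y) = of_gint x - of_gint y"
  "of_gint (x * y) = of_gint x * of_gint y" "of_gint (x ^ n) = of_gint x ^ n"
proof -
  show mult: "of_gint (x * y) = of_gint x * of_gint y" for x y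
  proof (cases x; cases y)
    fix a b c d assume "x = GInt a b" "y = GInt c d"
    moreover have "(real_of_int a + b * golden_ratio) * (c + d * golden_ratio)
        = a * c + (a * d + b * c) * golden_ratio + b * d * (golden_ratio * golden_ratio)"
      by (simp add: algebra_simps)
    ultimately show ?thesis unfolding golden_ratio_square by (simp add: algebra_simps)
  qed
  show one: "of_gint 1 = 1" by (simp add: one_gint_def)
  show "of_gint (x ^ n) = of_gint x ^ n" by (induction n) (simp_all add: mult one)
qed (cases x; cases y; simp add: zero_gint_def algebra_simps)+

text \<open>This is the irrationality of \<open>sqrt 5\<close>: the multiplicity of 5 is even in \<open>(2 a + b)\<^sup>2\<close> and odd in \<open>5 b\<^sup>2\<close>.\<close>

lemma of_gint_eq_0_iff: "of_gint x = 0 \<longleftrightarrow> x = 0"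
proof
  assume x0: "of_gint x = 0"
  obtain a b where x: "x = GInt a b" by (cases x)
  have "real_of_int (2 * a + b) = - (b * sqrt 5)"
    using x0 by (simp add: x golden_ratio_def field_simps)
  then have "(real_of_int (2 * a + b))\<^sup>2 = (b * sqrt 5)\<^sup>2" by simp
  then have "real_of_int ((2 * a + b)\<^sup>2) = real_of_int (5 * b\<^sup>2)"
    by (simp add: power_mult_distrib)
  then have sq: "(2 * a + b)\<^sup>2 = 5 * b\<^sup>2" by (simp only: of_int_eq_iff)
  have "b = 0"
  proof (rule ccontr)
    assume b: "b \<noteq> 0"
    then have c: "2 * a + b \<noteq> 0" using sq by auto
    have p: "prime (5 :: int)" by simp
    have "multiplicity 5 ((2 * a + b)\<^sup>2) = 2 * multiplicity 5 (2 * a + b)"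
      using p c by (simp add: prime_elem_multiplicity_power_distrib)
    moreover have "multiplicity 5 (5 * b\<^sup>2) = 1 + 2 * multiplicity 5 b"
      using p b by (simp add: prime_elem_multiplicity_mult_distrib prime_elem_multiplicity_power_distrib)
    ultimately show False unfolding sq by presburger
  qed
  then show "x = 0" using x0 by (simp add: x zero_gint_def)
qed simp

lemma of_gint_inject [simp]: "of_gint x = of_gint y \<longleftrightarrow> x = y"
  using of_gint_eq_0_iff[of "x - y"] by simp

datatype gvec = GVec gint gint gint gint

fun of_gvec :: "gvec \<Rightarrow> real ^ 4" where
  "of_gvec (GVec a b c d) = vector [of_gint a, of_gint b, of_gint c, of_gint d]"

fun gdot :: "gvec \<Rightarrow> gvec \<Rightarrow> gint" where
  "gdot (GVec a b c d) (GVec a' b' c' d') = a * a' + b * b' + c * c' + d * d'"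

fun gadd :: "gvec \<Rightarrow> gvec \<Rightarrow> gvec" where
  "gadd (GVec a b c d) (GVec a' b' c' d') = GVec (a + a') (b + b') (c + c') (d + d')"

fun gscale :: "gint \<Rightarrow> gvec \<Rightarrow> gvec" where
  "gscale s (GVec a b c d) = GVec (s * a) (s * b) (s * c) (s * d)"

definition gdiff :: "gvec \<Rightarrow> gvec \<Rightarrow> gvec" where
  "gdiff v w = gadd v (gscale (- 1) w)"

lemma vec_eq_iff_4: "x = y \<longleftrightarrow> x $ 1 = y $ 1 \<and> x $ 2 = y $ 2 \<and> x $ 3 = y $ 3 \<and> x $ 4 = y $ 4" for x y :: "'a ^ 4"
  by (simp add: vec_eq_iff forall_4)

lemma of_gvec_hom [simp]:
  "of_gvec (gadd v w) = of_gvec v + of_gvec w" "of_gvec (gscale s v) = of_gint s *\<^sub>R of_gvec v"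
  "of_gvec (gdiff v w) = of_gvec v - of_gvec w" "of_gvec v \<bullet> of_gvec w = of_gint (gdot v w)"
  by (cases v; cases w; simp add: gdiff_def vec_eq_iff_4 vector_4 inner_vec_def sum_4)+

lemma of_gvec_inject [simp]: "of_gvec v = of_gvec w \<longleftrightarrow> v = w"
  by (cases v; cases w) (simp add: vec_eq_iff_4 vector_4)

section \<open>Signed even coordinate permutations\<close>

text \<open>The 600-cell, the 24-cell and their duals are invariant under this group of order 192. Odd permutations are excluded because they do
not preserve the 600-cell.\<close>

definition signed_even_perms :: "(real ^ 4 \<Rightarrow> real ^ 4) set" where
  "signed_even_perms = {(\<lambda>x. \<chi> i. \<epsilon> i * x $ \<pi> i) | \<epsilon> \<pi>.
     (\<forall>i. \<epsilon> i \<in> {1, -1}) \<and> \<pi> permutes UNIV \<and> evenperm \<pi>}"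

definition signed_orbit :: "real ^ 4 \<Rightarrow> (real ^ 4) set" where
  "signed_orbit x = (\<lambda>T. T x) ` signed_even_perms"

lemma signed_even_perms_linear:
  assumes "T \<in> signed_even_perms"
  shows "T (x + y) = T x + T y" "T (x - y) = T x - T y" "T (c *\<^sub>R x) = c *\<^sub>R T x"
  using assms by (auto simp: signed_even_perms_def vec_eq_iff algebra_simps)

lemma signed_even_perms_inner:
  assumes "T \<in> signed_even_perms"
  shows "T x \<bullet> T y = x \<bullet> y"
proof -
  obtain \<epsilon> \<pi> where T: "T = (\<lambda>x. \<chi> i. \<epsilon> i * x $ \<pi> i)" and \<epsilon>: "\<And>i. \<epsilon> i \<in> {1, -1}" and \<pi>: "\<pi> permutes UNIV"
    using assms by (auto simp: signed_even_perms_def)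
  have \<epsilon>2: "\<epsilon> i * \<epsilon> i = 1" for i using \<epsilon>[of i] by auto
  have "\<epsilon> i * x $ \<pi> i * (\<epsilon> i * y $ \<pi> i) = x $ \<pi> i * y $ \<pi> i" for i
  proof -
    have "\<epsilon> i * x $ \<pi> i * (\<epsilon> i * y $ \<pi> i) = (\<epsilon> i * \<epsilon> i) * (x $ \<pi> i * y $ \<pi> i)" by (simp only: mult_ac)
    then show ?thesis by (simp add: \<epsilon>2)
  qed
  moreover have "T x \<bullet> T y = (\<Sum>i\<in>UNIV. \<epsilon> i * x $ \<pi> i * (\<epsilon> i * y $ \<pi> i))"
    by (simp add: T inner_vec_def)
  ultimately have "T x \<bullet> T y = (\<Sum>i\<in>UNIV. x $ \<pi> i * y $ \<pi> i)"
    by (simp only:)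
  also have "\<dots> = (\<Sum>i\<in>UNIV. x $ i * y $ i)"
    using sum.permute[OF \<pi>, of "\<lambda>i. x $ i * y $ i"] by (simp add: o_def)
  finally show ?thesis by (simp add: inner_vec_def)
qed

lemma signed_even_perms_norm: "T \<in> signed_even_perms \<Longrightarrow> norm (T x) = norm x"
  by (simp add: norm_eq_sqrt_inner signed_even_perms_inner)

lemma signed_even_perms_sgn: "T \<in> signed_even_perms \<Longrightarrow> T (sgn x) = sgn (T x)"
  by (simp add: sgn_div_norm signed_even_perms_linear signed_even_perms_norm)

lemma signed_even_perms_inj: "T \<in> signed_even_perms \<Longrightarrow> inj T"
  by (rule injI) (metis signed_even_perms_linear(2) signed_even_perms_norm norm_eq_zero right_minus_eq)

lemma signed_even_perms_comp:
  assumes "T \<in> signed_even_perms" "T' \<in> signed_even_perms"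
  shows "T \<circ> T' \<in> signed_even_perms"
proof -
  obtain \<epsilon> \<pi> where T: "T = (\<lambda>x. \<chi> i. \<epsilon> i * x $ \<pi> i)" "\<And>i. \<epsilon> i \<in> {1, -1}" "\<pi> permutes UNIV" "evenperm \<pi>"
    using assms(1) by (auto simp: signed_even_perms_def)
  obtain \<epsilon>' \<pi>' where T': "T' = (\<lambda>x. \<chi> i. \<epsilon>' i * x $ \<pi>' i)" "\<And>i. \<epsilon>' i \<in> {1, -1}" "\<pi>' permutes UNIV" "evenperm \<pi>'"
    using assms(2) by (auto simp: signed_even_perms_def)
  have "T \<circ> T' = (\<lambda>x. \<chi> i. (\<epsilon> i * \<epsilon>' (\<pi> i)) * x $ (\<pi>' \<circ> \<pi>) i)"
    by (simp add: T(1) T'(1) fun_eq_iff vec_eq_iff)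
  moreover have "\<forall>i. \<epsilon> i * \<epsilon>' (\<pi> i) \<in> {1, -1}"
  proof
    fix i show "\<epsilon> i * \<epsilon>' (\<pi> i) \<in> {1, -1}" using T(2)[of i] T'(2)[of "\<pi> i"] by auto
  qed
  moreover have "\<pi>' \<circ> \<pi> permutes UNIV" using T(3) T'(3) by (rule permutes_compose)
  moreover have "evenperm (\<pi>' \<circ> \<pi>)"
  proof -
    have "permutation \<pi>" "permutation \<pi>'" using T(3) T'(3) by (auto simp: permutation_permutes)
    then show ?thesis using T(4) T'(4) by (simp add: evenperm_comp)
  qed
  ultimately show ?thesis unfolding signed_even_perms_def by (intro CollectI exI conjI)
qed

lemma signed_even_perms_id: "id \<in> signed_even_perms"
  unfolding signed_even_perms_def
  by (rule CollectI, rule exI[of _ "\<lambda>_. 1"], rule exI[of _ id])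
    (auto simp: fun_eq_iff vec_eq_iff permutes_id evenperm_id)

lemma signed_even_perms_uminus: "uminus \<in> signed_even_perms"
  unfolding signed_even_perms_def
  by (rule CollectI, rule exI[of _ "\<lambda>_. - 1"], rule exI[of _ id])
    (auto simp: fun_eq_iff vec_eq_iff permutes_id evenperm_id)

text \<open>The words \<open>[\<pi> 1, \<pi> 2, \<pi> 3, \<pi> 4]\<close> of the even permutations \<open>\<pi>\<close>.\<close>

definition even_words :: "4 list list" where
  "even_words =
    [[1, 2, 3, 4], [1, 3, 4, 2], [1, 4, 2, 3], [2, 1, 4, 3], [2, 4, 3, 1], [2, 3, 1, 4],
     [3, 1, 2, 4], [3, 2, 4, 1], [3, 4, 1, 2], [4, 1, 3, 2], [4, 3, 2, 1], [4, 2, 1, 3]]"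

text \<open>Every even permutation of four points is a product of two transpositions.\<close>

lemma even_words_even_permutation:
  assumes "w \<in> set even_words"
  obtains \<pi> where "\<pi> permutes UNIV" "evenperm \<pi>" "[\<pi> 1, \<pi> 2, \<pi> 3, \<pi> 4] = w"
proof -
  let ?w = "\<lambda>a b c d :: 4. map (Transposition.transpose a b \<circ> Transposition.transpose c d) [1, 2, 3, 4]"
  \<comment> \<open>\<open>?L\<close> lists such factorizations in the order of \<^const>\<open>even_words\<close>.\<close>
  let ?L = "[(1, 2, 1, 2), (2, 3, 3, 4), (2, 3, 2, 4), (1, 2, 3, 4), (1, 2, 2, 4), (1, 2, 2, 3), (1, 2, 1, 3), (1, 3, 3, 4), (1, 3, 2, 4), (1, 2, 1, 4), (1, 4, 2, 3), (1, 3, 1, 4)] :: (4 \<times> 4 \<times> 4 \<times> 4) list"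
  have words: "even_words = map (\<lambda>(a, b, c, d). ?w a b c d) ?L"
    by (simp add: even_words_def Transposition.transpose_def)
  have "w \<in> (\<lambda>(a, b, c, d). ?w a b c d) ` set ?L"
    using assms unfolding words set_map .
  then obtain q where q: "w = (\<lambda>(a, b, c, d). ?w a b c d) q" "q \<in> set ?L"
    by (rule imageE)
  obtain a b c d where abcd: "q = (a, b, c, d)" by (cases q)
  have "\<forall>(a, b, c, d)\<in>set ?L. a \<noteq> b \<and> c \<noteq> d" by simp
  from bspec[OF this q(2)] have "a \<noteq> b" "c \<noteq> d" unfolding abcd prod.case by blast+
  note abcd = this q(1)[unfolded abcd prod.case]
  show thesis
  proof (rule that)
    show "Transposition.transpose a b \<circ> Transposition.transpose c d permutes UNIV"
      by (intro permutes_compose permutes_swap_id) simp_all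
    show "evenperm (Transposition.transpose a b \<circ> Transposition.transpose c d)"
      using abcd(1,2) by (simp add: evenperm_comp permutation_swap_id evenperm_swap)
  qed (simp add: abcd(3))
qed

lemma even_permutations_4:
  fixes \<pi> :: "4 \<Rightarrow> 4"
  assumes \<pi>: "\<pi> permutes UNIV"
  shows "evenperm \<pi> \<longleftrightarrow> [\<pi> 1, \<pi> 2, \<pi> 3, \<pi> 4] \<in> set even_words"
proof -
  have even: "evenperm \<rho>" if w: "[\<rho> 1, \<rho> 2, \<rho> 3, \<rho> 4] \<in> set even_words" for \<rho> :: "4 \<Rightarrow> 4"
  proof -
    obtain \<rho>' where "evenperm \<rho>'" "[\<rho>' 1, \<rho>' 2, \<rho>' 3, \<rho>' 4] = [\<rho> 1, \<rho> 2, \<rho> 3, \<rho> 4]"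
      by (rule even_words_even_permutation[OF w])
    moreover from this(2) have "\<rho>' = \<rho>" by (simp add: fun_eq_iff forall_4)
    ultimately show ?thesis by simp
  qed
  show ?thesis
  proof
    assume ev: "evenperm \<pi>"
    show "[\<pi> 1, \<pi> 2, \<pi> 3, \<pi> 4] \<in> set even_words"
    proof (rule ccontr)
      assume not: "[\<pi> 1, \<pi> 2, \<pi> 3, \<pi> 4] \<notin> set even_words"
      have "inj \<pi>" using \<pi> by (rule permutes_inj)
      then have "\<pi> 1 \<noteq> \<pi> 2" "\<pi> 1 \<noteq> \<pi> 3" "\<pi> 1 \<noteq> \<pi> 4" "\<pi> 2 \<noteq> \<pi> 3" "\<pi> 2 \<noteq> \<pi> 4" "\<pi> 3 \<noteq> \<pi> 4"
        by (simp_all add: inj_eq)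
      \<comment> \<open>Exchanging the first two letters turns the word of any other permutation into one of the list.\<close>
      then have "[\<pi> 2, \<pi> 1, \<pi> 3, \<pi> 4] \<in> set even_words"
        using not exhaust_4[of "\<pi> 1"] exhaust_4[of "\<pi> 2"] exhaust_4[of "\<pi> 3"] exhaust_4[of "\<pi> 4"]
        unfolding even_words_def by (elim disjE) simp_all
      then have "evenperm (\<pi> \<circ> Transposition.transpose 1 2)"
        by (intro even) (simp add: Transposition.transpose_def)
      moreover have "permutation \<pi>" using \<pi> by (auto simp: permutation_permutes)
      ultimately show False
        using ev by (simp add: evenperm_comp permutation_swap_id evenperm_swap)
    qed
  qed (rule even)
qed

text \<open>The arrangement of the coordinates follows \<^const>\<open>even_words\<close>.\<close>

fun even_rearrangements :: "gvec \<Rightarrow> gvec list" where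
  "even_rearrangements (GVec a b c d) =
     [GVec a b c d, GVec a c d b, GVec a d b c, GVec b a d c, GVec b d c a, GVec b c a d,
      GVec c a b d, GVec c b d a, GVec c d a b, GVec d a c b, GVec d c b a, GVec d b a c]"

definition sign_choices :: "gint \<Rightarrow> gint list" where
  "sign_choices x = (if x = 0 then [x] else [x, - x])"

fun sign_changes :: "gvec \<Rightarrow> gvec list" where
  "sign_changes (GVec a b c d) =
     [GVec a' b' c' d'. a' \<leftarrow> sign_choices a, b' \<leftarrow> sign_choices b, c' \<leftarrow> sign_choices c, d' \<leftarrow> sign_choices d]"

text \<open>Coordinates that are zero get one sign only and repeated rearrangements are dropped, so that each point of the orbit
appears once when the coordinates are nonnegative (see \<open>distinct_gorbits\<close> for a test).\<close>

definition gorbit :: "gvec \<Rightarrow> gvec list" where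
  "gorbit v = concat (map sign_changes (remdups (even_rearrangements v)))"

definition gorbits :: "gvec list \<Rightarrow> gvec list" where
  "gorbits vs = concat (map gorbit vs)"

lemma sign_choices: "of_gint ` set (sign_choices x) = (\<lambda>e. e * of_gint x) ` {1, -1}"
  by (auto simp: sign_choices_def)

lemma of_gvec_sign_changes:
  "of_gvec ` set (sign_changes v) = {\<chi> i. \<epsilon> i * of_gvec v $ i | \<epsilon>. \<forall>i. \<epsilon> i \<in> {1, -1}}"
proof -
  obtain a b c d where v: "v = GVec a b c d" by (cases v)
  show ?thesis
  proof (intro equalityI subsetI)
    fix x assume "x \<in> of_gvec ` set (sign_changes v)"
    then obtain a' b' c' d' where x: "x = of_gvec (GVec a' b' c' d')"
      and mem: "a' \<in> set (sign_choices a)" "b' \<in> set (sign_choices b)" "c' \<in> set (sign_choices c)" "d' \<in> set (sign_choices d)"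
      by (auto simp: v)
    have sgn: "\<exists>e\<in>{1, -1}. of_gint y' = e * of_gint y" if "y' \<in> set (sign_choices y)" for y y'
      using that sign_choices[of y] by blast
    obtain e1 e2 e3 e4 where e: "e1 \<in> {1, -1}" "e2 \<in> {1, -1}" "e3 \<in> {1, -1}" "e4 \<in> {1, -1}"
      "of_gint a' = e1 * of_gint a" "of_gint b' = e2 * of_gint b" "of_gint c' = e3 * of_gint c" "of_gint d' = e4 * of_gint d"
      using mem[THEN sgn] by blast
    define \<epsilon> :: "4 \<Rightarrow> real" where "\<epsilon> i = vector [e1, e2, e3, e4] $ i" for i
    have "\<forall>i. \<epsilon> i \<in> {1, -1}" using e(1-4) by (simp add: forall_4 \<epsilon>_def vector_4)
    moreover have "x = (\<chi> i. \<epsilon> i * of_gvec v $ i)"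
      using e(5-8) by (simp add: x v vec_eq_iff_4 vector_4 \<epsilon>_def)
    ultimately show "x \<in> {\<chi> i. \<epsilon> i * of_gvec v $ i | \<epsilon>. \<forall>i. \<epsilon> i \<in> {1, -1}}" by blast
  next
    fix x assume "x \<in> {\<chi> i. \<epsilon> i * of_gvec v $ i | \<epsilon>. \<forall>i. \<epsilon> i \<in> {1, -1}}"
    then obtain \<epsilon> where x: "x = (\<chi> i. \<epsilon> i * of_gvec v $ i)" and \<epsilon>: "\<And>i. \<epsilon> i \<in> {1, -1}" by blast
    have sgn: "\<exists>y'\<in>set (sign_choices y). of_gint y' = \<epsilon> i * of_gint y" for i y
      using sign_choices[of y] \<epsilon>[of i] by (metis image_iff)
    obtain a' b' c' d' where mem: "a' \<in> set (sign_choices a)" "b' \<in> set (sign_choices b)" "c' \<in> set (sign_choices c)" "d' \<in> set (sign_choices d)"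
      "of_gint a' = \<epsilon> 1 * of_gint a" "of_gint b' = \<epsilon> 2 * of_gint b" "of_gint c' = \<epsilon> 3 * of_gint c" "of_gint d' = \<epsilon> 4 * of_gint d"
      using sgn[of a 1] sgn[of b 2] sgn[of c 3] sgn[of d 4] by blast
    have "x = of_gvec (GVec a' b' c' d')"
      using mem(5-8) by (simp add: x v vec_eq_iff_4 vector_4)
    moreover have "GVec a' b' c' d' \<in> set (sign_changes v)"
      using mem(1-4) by (simp add: v) blast
    ultimately show "x \<in> of_gvec ` set (sign_changes v)" by blast
  qed
qed

lemma of_gvec_even_rearrangements:
  "of_gvec ` set (even_rearrangements v) = {\<chi> i. of_gvec v $ \<pi> i | \<pi>. \<pi> permutes UNIV \<and> evenperm \<pi>}"
proof -
  obtain a b c d where v: "v = GVec a b c d" by (cases v)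
  define f where "f w = (vector (map (\<lambda>j. of_gvec v $ j) w) :: real ^ 4)" for w :: "4 list"
  have f: "f [\<pi> 1, \<pi> 2, \<pi> 3, \<pi> 4] = (\<chi> i. of_gvec v $ \<pi> i)" for \<pi> :: "4 \<Rightarrow> 4"
    by (simp add: f_def vec_eq_iff_4 vector_4)
  have "of_gvec ` set (even_rearrangements v) = f ` set even_words"
    by (simp add: v even_words_def f_def vector_4)
  also have "\<dots> = {\<chi> i. of_gvec v $ \<pi> i | \<pi>. \<pi> permutes UNIV \<and> evenperm \<pi>}"
  proof (intro equalityI subsetI)
    fix x assume "x \<in> f ` set even_words"
    then obtain w where "w \<in> set even_words" "x = f w" by blast
    moreover from this(1) obtain \<pi> where "\<pi> permutes UNIV" "evenperm \<pi>" "[\<pi> 1, \<pi> 2, \<pi> 3, \<pi> 4] = w"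
      by (rule even_words_even_permutation)
    ultimately show "x \<in> {\<chi> i. of_gvec v $ \<pi> i | \<pi>. \<pi> permutes UNIV \<and> evenperm \<pi>}"
      using f[of \<pi>] by blast
  next
    fix x assume "x \<in> {\<chi> i. of_gvec v $ \<pi> i | \<pi>. \<pi> permutes UNIV \<and> evenperm \<pi>}"
    then obtain \<pi> where \<pi>: "x = (\<chi> i. of_gvec v $ \<pi> i)" "\<pi> permutes UNIV" "evenperm \<pi>" by blast
    have "[\<pi> 1, \<pi> 2, \<pi> 3, \<pi> 4] \<in> set even_words"
      using \<pi>(3) unfolding even_permutations_4[OF \<pi>(2)] .
    then show "x \<in> f ` set even_words" unfolding \<pi>(1) f[symmetric] by (rule imageI)
  qed
  finally show ?thesis .
qed

lemma of_gvec_gorbit: "of_gvec ` set (gorbit v) = signed_orbit (of_gvec v)"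
proof -
  have "of_gvec ` set (gorbit v) = (\<Union>w\<in>set (even_rearrangements v). of_gvec ` set (sign_changes w))"
    by (simp add: gorbit_def image_UN)
  also have "\<dots> = {\<chi> i. \<epsilon> i * y $ i | \<epsilon> y. (\<forall>i. \<epsilon> i \<in> {1, -1}) \<and> y \<in> of_gvec ` set (even_rearrangements v)}"
    unfolding of_gvec_sign_changes by blast
  also have "\<dots> = {\<chi> i. \<epsilon> i * (\<chi> j. of_gvec v $ \<pi> j) $ i | \<epsilon> \<pi>.
      (\<forall>i. \<epsilon> i \<in> {1, -1}) \<and> \<pi> permutes UNIV \<and> evenperm \<pi>}"
    unfolding of_gvec_even_rearrangements by blast
  also have "\<dots> = {\<chi> i. \<epsilon> i * of_gvec v $ \<pi> i | \<epsilon> \<pi>.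
      (\<forall>i. \<epsilon> i \<in> {1, -1}) \<and> \<pi> permutes UNIV \<and> evenperm \<pi>}"
    by (simp only: vec_lambda_beta)
  also have "\<dots> = signed_orbit (of_gvec v)"
  proof (intro equalityI subsetI)
    fix x
    assume "x \<in> {\<chi> i. \<epsilon> i * of_gvec v $ \<pi> i | \<epsilon> \<pi>. (\<forall>i. \<epsilon> i \<in> {1, -1}) \<and> \<pi> permutes UNIV \<and> evenperm \<pi>}"
    then obtain \<epsilon> \<pi> where x: "x = (\<chi> i. \<epsilon> i * of_gvec v $ \<pi> i)"
      and "\<forall>i. \<epsilon> i \<in> {1, -1}" "\<pi> permutes UNIV" "evenperm \<pi>" by blast
    then have "(\<lambda>x. \<chi> i. \<epsilon> i * x $ \<pi> i) \<in> signed_even_perms" unfolding signed_even_perms_def by blast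
    from imageI[OF this, of "\<lambda>T. T (of_gvec v)"] show "x \<in> signed_orbit (of_gvec v)"
      by (simp only: x signed_orbit_def)
  next
    fix x assume "x \<in> signed_orbit (of_gvec v)"
    then obtain T where "T \<in> signed_even_perms" "x = T (of_gvec v)" unfolding signed_orbit_def by blast
    then show "x \<in> {\<chi> i. \<epsilon> i * of_gvec v $ \<pi> i | \<epsilon> \<pi>. (\<forall>i. \<epsilon> i \<in> {1, -1}) \<and> \<pi> permutes UNIV \<and> evenperm \<pi>}"
      unfolding signed_even_perms_def by blast
  qed
  finally show ?thesis .
qed

definition orbit_points :: "gvec list \<Rightarrow> (real ^ 4) set" where
  "orbit_points vs = of_gvec ` set (gorbits vs)"

lemma orbit_points_eq: "orbit_points vs = (\<Union>v\<in>set vs. signed_orbit (of_gvec v))"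
  by (auto simp: orbit_points_def gorbits_def of_gvec_gorbit[symmetric])

lemma finite_orbit_points [simp]: "finite (orbit_points vs)"
  by (simp add: orbit_points_def)

lemma orbit_points_cases:
  assumes "x \<in> orbit_points vs"
  obtains T v where "T \<in> signed_even_perms" "v \<in> set vs" "x = T (of_gvec v)"
  using assms by (auto simp: orbit_points_eq signed_orbit_def)

lemma orbit_pointsI: "T \<in> signed_even_perms \<Longrightarrow> v \<in> set vs \<Longrightarrow> T (of_gvec v) \<in> orbit_points vs"
  by (auto simp: orbit_points_eq signed_orbit_def)

lemma signed_even_perms_orbit_points:
  assumes "T \<in> signed_even_perms"
  shows "T ` orbit_points vs = orbit_points vs"
proof -
  have "T x \<in> orbit_points vs" if "x \<in> orbit_points vs" for x
    using that
  proof (rule orbit_points_cases)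
    fix T' v assume "T' \<in> signed_even_perms" "v \<in> set vs" "x = T' (of_gvec v)"
    then show ?thesis using orbit_pointsI[OF signed_even_perms_comp[OF assms], of T' v vs] by simp
  qed
  then show ?thesis
    using endo_inj_surj[of "orbit_points vs" T] signed_even_perms_inj[OF assms]
    by (auto intro: inj_on_subset)
qed

lemma sum_orbit_points:
  assumes "distinct (gorbits vs)"
  shows "(\<Sum>x\<in>orbit_points vs. f x) = (\<Sum>v\<leftarrow>gorbits vs. f (of_gvec v))"
    and "card (orbit_points vs) = length (gorbits vs)"
proof -
  have inj: "inj_on of_gvec A" for A by (simp add: inj_on_def)
  show "(\<Sum>x\<in>orbit_points vs. f x) = (\<Sum>v\<leftarrow>gorbits vs. f (of_gvec v))"
    unfolding orbit_points_def sum.reindex[OF inj] using assms by (simp add: sum.distinct_set_conv_list)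
  show "card (orbit_points vs) = length (gorbits vs)"
    unfolding orbit_points_def card_image[OF inj] using assms by (rule distinct_card)
qed

section \<open>The error of a hybrid quadrature rule\<close>

lemma sphere_functional_points:
  fixes X :: "(real ^ 'n) set"
  assumes "X \<subseteq> sphere 0 1"
  shows "sphere_functional (\<lambda>p. \<Sum>x\<in>X. p x)"
  unfolding sphere_functional_def
proof (intro conjI allI impI)
  fix p q :: "real ^ 'n \<Rightarrow> real"
  assume "\<forall>x\<in>sphere 0 1. p x = q x"
  then show "(\<Sum>x\<in>X. p x) = (\<Sum>x\<in>X. q x)"
    using assms by (intro sum.cong) auto
qed (simp_all add: sum.distrib sum_distrib_left)

lemma sphere_functional_lincomb:
  fixes \<Lambda> \<Lambda>' :: "(real ^ 'n \<Rightarrow> real) \<Rightarrow> real"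
  assumes "sphere_functional \<Lambda>" "sphere_functional \<Lambda>'"
  shows "sphere_functional (\<lambda>p. a * \<Lambda> p + b * \<Lambda>' p)"
  unfolding sphere_functional_def
proof (intro conjI allI impI)
  fix p q :: "real ^ 'n \<Rightarrow> real"
  assume "\<forall>x\<in>sphere 0 1. p x = q x"
  then have "\<Lambda> p = \<Lambda> q" "\<Lambda>' p = \<Lambda>' q"
    using assms[THEN sphere_functionalD(3), of p q] by auto
  then show "a * \<Lambda> p + b * \<Lambda>' p = a * \<Lambda> q + b * \<Lambda>' q" by simp
qed (simp_all add: assms[THEN sphere_functionalD(1)] assms[THEN sphere_functionalD(2)] algebra_simps)

text \<open>The error of the hybrid quadrature rule, the functional \<open>\<Lambda>\<close> of the introduction.\<close>

definition design_defect ::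
  "(real ^ 'n) measure \<Rightarrow> real \<Rightarrow> (real ^ 'n) list \<Rightarrow> (real ^ 'n) set \<Rightarrow> (real ^ 'n \<Rightarrow> real) \<Rightarrow> real" where
  "design_defect \<sigma> \<beta> \<gamma> X p =
     \<beta> / real (card X) * (\<Sum>x\<in>X. p x) + (1 - \<beta>) / cycle_length \<gamma> * cycle_integral \<gamma> p - (\<integral>x. p x \<partial>\<sigma>)"

lemma sphere_functional_design_defect:
  assumes \<sigma>: "invariant_sphere_measure \<sigma>" and \<gamma>: "geodesic_cycle \<gamma>" and X: "X \<subseteq> sphere 0 1"
  shows "sphere_functional (design_defect \<sigma> \<beta> \<gamma> X)"
proof -
  have "sphere_functional (\<lambda>p. 1 * (\<beta> / real (card X) * (\<Sum>x\<in>X. p x) + (1 - \<beta>) / cycle_length \<gamma> * cycle_integral \<gamma> p)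
      + (- 1) * (\<integral>x. p x \<partial>\<sigma>))"
    by (intro sphere_functional_lincomb sphere_functional_points X
        sphere_functional_cycle_integral[OF \<gamma>] sphere_functional_integral[OF \<sigma>])
  then show ?thesis by (simp add: design_defect_def[abs_def])
qed

text \<open>If \<open>\<Lambda>\<close> applied to \<open>(x \<bullet> z) ^ k\<close> is a combination of powers \<open>(y \<bullet> z) ^ k\<close> with \<open>y \<in> D\<close> and of a constant, then applying \<open>\<Lambda>\<close> in the
variable \<open>z\<close> as well reduces the energy to the values of \<open>\<Lambda>\<close> at the powers with \<open>z \<in> D\<close>.\<close>

lemma energy_zero_if_zero_on_support:
  fixes \<Lambda> :: "(real ^ 'n \<Rightarrow> real) \<Rightarrow> real"
  assumes \<Lambda>: "sphere_functional \<Lambda>" and one: "\<Lambda> (\<lambda>_. 1) = 0"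
    and F: "\<And>z. norm z = 1 \<Longrightarrow> \<Lambda> (\<lambda>x. (x \<bullet> z) ^ k) = (\<Sum>y\<in>D. w y * (y \<bullet> z) ^ k) - c"
    and D: "\<And>y. y \<in> D \<Longrightarrow> \<Lambda> (\<lambda>x. (x \<bullet> y) ^ k) = 0"
  shows "\<Lambda> (\<lambda>z. \<Lambda> (\<lambda>x. (x \<bullet> z) ^ k)) = 0"
proof -
  have "\<Lambda> (\<lambda>z. \<Lambda> (\<lambda>x. (x \<bullet> z) ^ k)) = \<Lambda> (\<lambda>z. (\<Sum>y\<in>D. w y * (z \<bullet> y) ^ k) + (- c) * 1)"
  proof (rule sphere_functionalD(3)[OF \<Lambda>])
    fix z :: "real ^ 'n" assume "z \<in> sphere 0 1"
    then show "\<Lambda> (\<lambda>x. (x \<bullet> z) ^ k) = (\<Sum>y\<in>D. w y * (z \<bullet> y) ^ k) + (- c) * 1"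
      using F[of z] by (simp add: inner_commute)
  qed
  also have "\<dots> = \<Lambda> (\<lambda>z. \<Sum>y\<in>D. w y * (z \<bullet> y) ^ k) + \<Lambda> (\<lambda>z. (- c) * 1)"
    by (intro sphere_functionalD(1)[OF \<Lambda>] continuous_intros)
  also have "\<Lambda> (\<lambda>z. \<Sum>y\<in>D. w y * (z \<bullet> y) ^ k) = (\<Sum>y\<in>D. w y * \<Lambda> (\<lambda>x. (x \<bullet> y) ^ k))"
    by (intro sphere_functional_sum[OF \<Lambda>] continuous_intros)
  also have "\<dots> = 0" by (simp add: D)
  also have "\<Lambda> (\<lambda>z. (- c) * 1) = - c * \<Lambda> (\<lambda>_. 1)"
    by (intro sphere_functionalD(2)[OF \<Lambda>] continuous_intros)
  finally show ?thesis by (simp add: one)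
qed

lemma design_defect_one:
  assumes "invariant_sphere_measure \<sigma>" "finite X" "X \<noteq> {}" "cycle_length \<gamma> \<noteq> 0"
  shows "design_defect \<sigma> \<beta> \<gamma> X (\<lambda>_. 1) = 0"
proof -
  interpret prob_space \<sigma> by (rule prob_space_sphere[OF assms(1)])
  show ?thesis
    using assms by (simp add: design_defect_def cycle_length_def prob_space)
qed

section \<open>Power sums over orbits\<close>

definition orbit_power_sum :: "nat \<Rightarrow> gvec list \<Rightarrow> gvec \<Rightarrow> gint" where
  "orbit_power_sum k vs z = (\<Sum>v\<leftarrow>gorbits vs. gdot v z ^ k)"

lemma of_gint_numeral [simp]: "of_gint (numeral w) = numeral w"
  by (induction w) (simp_all only: numeral.simps of_gint_hom)

lemma of_gint_sum_list: "of_gint (\<Sum>x\<leftarrow>xs. f x) = (\<Sum>x\<leftarrow>xs. of_gint (f x))"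
  by (induction xs) simp_all

lemma orbit_points_inner_self:
  assumes "\<And>v. v \<in> set vs \<Longrightarrow> gdot v v = n" "x \<in> orbit_points vs"
  shows "x \<bullet> x = of_gint n"
proof -
  obtain T v where "T \<in> signed_even_perms" "v \<in> set vs" "x = T (of_gvec v)"
    using assms(2) by (rule orbit_points_cases)
  then show ?thesis by (simp add: signed_even_perms_inner assms(1))
qed

lemma sgn_eq_scaleR:
  assumes "x \<bullet> x = s" shows "sgn x = inverse (sqrt s) *\<^sub>R (x :: 'a::real_inner)"
  using assms by (simp add: sgn_div_norm norm_eq_sqrt_inner)

lemma inj_on_sgn_orbit_points:
  assumes "\<And>v. v \<in> set vs \<Longrightarrow> gdot v v = n" "of_gint n > 0"
  shows "inj_on sgn (orbit_points vs)"
proof (rule inj_onI)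
  fix x y assume "x \<in> orbit_points vs" "y \<in> orbit_points vs" "sgn x = sgn y"
  then show "x = y"
    using orbit_points_inner_self[of vs n x] orbit_points_inner_self[of vs n y] assms
    by (simp add: sgn_eq_scaleR)
qed

lemma sgn_orbit_points_sphere:
  assumes "\<And>v. v \<in> set vs \<Longrightarrow> gdot v v = n" "of_gint n > 0" "x \<in> sgn ` orbit_points vs"
  shows "norm x = 1"
proof -
  obtain y where "x = sgn y" "y \<in> orbit_points vs" using assms(3) by blast
  moreover from this(2) have "y \<bullet> y \<noteq> 0" using orbit_points_inner_self[of vs n y] assms(1,2) by auto
  ultimately show ?thesis by (simp add: norm_sgn)
qed

lemma signed_even_perms_sgn_orbit_points:
  assumes "T \<in> signed_even_perms"
  shows "T ` sgn ` orbit_points vs = sgn ` orbit_points vs"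
proof -
  have "T ` sgn ` orbit_points vs = sgn ` T ` orbit_points vs"
    by (auto simp: image_image signed_even_perms_sgn[OF assms])
  then show ?thesis by (simp only: signed_even_perms_orbit_points[OF assms])
qed

lemma power_sum_invariant:
  assumes "T \<in> signed_even_perms"
  shows "(\<Sum>x\<in>sgn ` orbit_points vs. (x \<bullet> T z) ^ k) = (\<Sum>x\<in>sgn ` orbit_points vs. (x \<bullet> z) ^ k)"
proof -
  have inj: "inj_on T A" for A using signed_even_perms_inj[OF assms] by (rule inj_on_subset) simp
  have "(\<Sum>x\<in>T ` sgn ` orbit_points vs. (x \<bullet> T z) ^ k) = (\<Sum>x\<in>sgn ` orbit_points vs. (T x \<bullet> T z) ^ k)"
    by (simp only: sum.reindex[OF inj] o_def)
  then show ?thesis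
    by (simp only: signed_even_perms_sgn_orbit_points[OF assms] signed_even_perms_inner[OF assms])
qed

lemma power_sum_eq_orbit_power_sum:
  assumes dist: "distinct (gorbits vs)"
    and n: "\<And>v. v \<in> set vs \<Longrightarrow> gdot v v = n" "of_gint n > 0" and r: "of_gint (gdot r r) > 0"
  shows "(\<Sum>x\<in>sgn ` orbit_points vs. (x \<bullet> sgn (of_gvec r)) ^ (2 * h))
    = of_gint (orbit_power_sum (2 * h) vs r) / (of_gint n * of_gint (gdot r r)) ^ h"
proof -
  have sq: "sqrt s ^ (2 * h) = s ^ h" if "s > 0" for s using that by (simp add: power_mult)
  have "(\<Sum>x\<in>sgn ` orbit_points vs. (x \<bullet> sgn (of_gvec r)) ^ (2 * h))
      = (\<Sum>x\<in>orbit_points vs. (sgn x \<bullet> sgn (of_gvec r)) ^ (2 * h))"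
    by (simp only: sum.reindex[OF inj_on_sgn_orbit_points[OF n]] o_def)
  also have "\<dots> = (\<Sum>x\<in>orbit_points vs. (x \<bullet> of_gvec r) ^ (2 * h) / (of_gint n * of_gint (gdot r r)) ^ h)"
  proof (intro sum.cong refl)
    fix x assume "x \<in> orbit_points vs"
    with n(1) have "x \<bullet> x = of_gint n" by (rule orbit_points_inner_self)
    moreover have "of_gvec r \<bullet> of_gvec r = of_gint (gdot r r)" by simp
    ultimately have "sgn x \<bullet> sgn (of_gvec r) = (x \<bullet> of_gvec r) / (sqrt (of_gint n) * sqrt (of_gint (gdot r r)))"
      by (simp add: sgn_eq_scaleR divide_inverse)
    then show "(sgn x \<bullet> sgn (of_gvec r)) ^ (2 * h) = (x \<bullet> of_gvec r) ^ (2 * h) / (of_gint n * of_gint (gdot r r)) ^ h"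
      using n(2) r by (simp add: power_divide power_mult_distrib sq)
  qed
  also have "\<dots> = (\<Sum>v\<leftarrow>gorbits vs. of_gint (gdot v r ^ (2 * h))) / (of_gint n * of_gint (gdot r r)) ^ h"
    by (simp add: sum_divide_distrib[symmetric] sum_orbit_points(1)[OF dist])
  finally show ?thesis by (simp only: orbit_power_sum_def of_gint_sum_list)
qed

section \<open>Polytopes whose edges form great circles\<close>

text \<open>Orbit representatives for the vertices (\<open>RV\<close>) and the edge midpoints (\<open>RE\<close>) of a polytope, both up to normalization. The
edges subtend the angle \<open>\<pi> / m\<close>; \<open>a\<close> is the inner product of two adjacent vertices before normalization, \<open>c\<close> is
\<open>2 cos (\<pi> / m)\<close>, and \<open>d\<close> is the vertex degree. The assumption \<open>closed\<close> says that edges continue to edges along great circles,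
and \<open>fibre\<close> that every midpoint belongs to one edge, counted in both directions. The conditions on adjacent vertices and on
midpoints are required of representatives only, which makes them short computations.\<close>

locale edge_orbits =
  fixes RV RE :: "gvec list" and nv ne a c :: gint and m d :: nat
  assumes m: "m \<ge> 2"
    and norm_V: "\<And>v. v \<in> set RV \<Longrightarrow> gdot v v = nv" and nv: "of_gint nv > 0"
    and norm_E: "\<And>e. e \<in> set RE \<Longrightarrow> gdot e e = ne" and ne: "of_gint ne > 0"
    and c: "of_gint c = 2 * cos (pi / m)" and a: "2 * a = c * nv"
    and dist_V: "distinct (gorbits RV)" and dist_E: "distinct (gorbits RE)"
    and closed: "\<And>r w. r \<in> set RV \<Longrightarrow> w \<in> set (gorbits RV) \<Longrightarrow> gdot r w = a \<Longrightarrow>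
        gdiff (gscale c w) r \<in> set (gorbits RV)"
    and degree: "\<And>r. r \<in> set RV \<Longrightarrow> length (filter (\<lambda>w. gdot r w = a) (gorbits RV)) = d"
    and midpoint: "\<And>r w. r \<in> set RV \<Longrightarrow> w \<in> set (gorbits RV) \<Longrightarrow> gdot r w = a \<Longrightarrow>
        gadd r w \<in> set (gorbits RE)"
    and fibre: "\<And>e. e \<in> set RE \<Longrightarrow>
        length (filter (\<lambda>v. gdiff e v \<in> set (gorbits RV)) (filter (\<lambda>v. gdot v (gdiff e v) = a) (gorbits RV))) = 2"
begin

definition V :: "(real ^ 4) set" where "V = sgn ` orbit_points RV"
definition E :: "(real ^ 4) set" where "E = sgn ` orbit_points RE"
definition adjacent :: "((real ^ 4) \<times> (real ^ 4)) set" where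
  "adjacent = {(x, y). x \<in> V \<and> y \<in> V \<and> x \<bullet> y = cos (pi / m)}"
definition scaled_adjacent :: "((real ^ 4) \<times> (real ^ 4)) set" where
  "scaled_adjacent = {(x, y). x \<in> orbit_points RV \<and> y \<in> orbit_points RV \<and> x \<bullet> y = of_gint a}"

lemma finite_V: "finite V" and finite_E: "finite E"
  by (simp_all add: V_def E_def)

lemma norm_V_1: "x \<in> V \<Longrightarrow> norm x = 1"
  unfolding V_def using norm_V nv by (rule sgn_orbit_points_sphere)

lemma norm_E_1: "x \<in> E \<Longrightarrow> norm x = 1"
  unfolding E_def using norm_E ne by (rule sgn_orbit_points_sphere)

lemma sgn_V: "x \<in> orbit_points RV \<Longrightarrow> sgn x = inverse (sqrt (of_gint nv)) *\<^sub>R x"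
  using orbit_points_inner_self[of RV nv x] norm_V by (simp add: sgn_eq_scaleR)

lemma a_real: "of_gint a = cos (pi / m) * of_gint nv"
proof -
  have "of_gint (2 * a) = of_gint (c * nv)" by (simp only: a)
  then show ?thesis using c by simp
qed

lemma inner_sgn_V_iff:
  assumes "x \<in> orbit_points RV" "y \<in> orbit_points RV"
  shows "sgn x \<bullet> sgn y = cos (pi / m) \<longleftrightarrow> x \<bullet> y = of_gint a"
proof -
  have "x \<bullet> y = of_gint nv * (sgn x \<bullet> sgn y)"
    using nv by (simp add: sgn_V assms field_simps)
  then show ?thesis using nv by (simp add: a_real mult.commute[of "cos _"])
qed

lemma adjacent_eq: "adjacent = (\<lambda>(x, y). (sgn x, sgn y)) ` scaled_adjacent"
  by (auto simp: adjacent_def scaled_adjacent_def V_def inner_sgn_V_iff)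

lemma inj_on_adjacent: "inj_on (\<lambda>(x, y). (sgn x, sgn y)) scaled_adjacent"
  using inj_on_sgn_orbit_points[OF norm_V nv]
  by (auto simp: inj_on_def scaled_adjacent_def)

lemma finite_scaled_adjacent: "finite scaled_adjacent"
  by (rule finite_subset[of _ "orbit_points RV \<times> orbit_points RV"]) (auto simp: scaled_adjacent_def)

lemma sum_adjacent: "(\<Sum>(x, y)\<in>adjacent. f x y) = (\<Sum>(x, y)\<in>scaled_adjacent. f (sgn x) (sgn y))"
  unfolding adjacent_eq sum.reindex[OF inj_on_adjacent] by (simp add: o_def split_def)

text \<open>Every pair of adjacent vertices can be moved by the group such that the first vertex becomes a representative.\<close>

lemma scaled_adjacent_cases:
  assumes "(x, y) \<in> scaled_adjacent"
  obtains T r w where "T \<in> signed_even_perms" "r \<in> set RV" "w \<in> set (gorbits RV)" "gdot r w = a"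
    "x = T (of_gvec r)" "y = T (of_gvec w)"
proof -
  have x: "x \<in> orbit_points RV" and y: "y \<in> orbit_points RV" and xy: "x \<bullet> y = of_gint a"
    using assms by (auto simp: scaled_adjacent_def)
  obtain T r where T: "T \<in> signed_even_perms" "r \<in> set RV" "x = T (of_gvec r)"
    using x by (rule orbit_points_cases)
  have "y \<in> T ` orbit_points RV" using y by (simp only: signed_even_perms_orbit_points[OF T(1)])
  then obtain w where w: "w \<in> set (gorbits RV)" "y = T (of_gvec w)"
    by (auto simp: orbit_points_def)
  have "gdot r w = a" using xy by (simp add: T w signed_even_perms_inner)
  with T w that show thesis by blast
qed

lemma rotation_closed:
  assumes "(x, y) \<in> adjacent"
  shows "(2 * cos (pi / m)) *\<^sub>R y - x \<in> V"
proof -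
  obtain x' y' where xy: "x = sgn x'" "y = sgn y'" "(x', y') \<in> scaled_adjacent"
    using assms by (auto simp: adjacent_eq)
  obtain T r w where T: "T \<in> signed_even_perms" "r \<in> set RV" "w \<in> set (gorbits RV)" "gdot r w = a"
    "x' = T (of_gvec r)" "y' = T (of_gvec w)"
    using xy(3) by (rule scaled_adjacent_cases)
  have "of_gvec (gdiff (gscale c w) r) \<in> orbit_points RV"
    using closed[OF T(2,3,4)] unfolding orbit_points_def by (rule imageI)
  then have "T (of_gvec (gdiff (gscale c w) r)) \<in> orbit_points RV"
    using signed_even_perms_orbit_points[OF T(1)] by blast
  then have mem: "of_gint c *\<^sub>R y' - x' \<in> orbit_points RV"
    by (simp add: signed_even_perms_linear[OF T(1)] T)
  have "(2 * cos (pi / m)) *\<^sub>R y - x = sgn (of_gint c *\<^sub>R y' - x')"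
    using xy(3) unfolding xy(1,2) sgn_V[OF mem]
    by (simp add: scaled_adjacent_def sgn_V c scaleR_diff_right)
  then show ?thesis using mem by (simp add: V_def)
qed

lemma card_neighbours:
  assumes "x \<in> orbit_points RV"
  shows "card {y \<in> orbit_points RV. x \<bullet> y = of_gint a} = d"
proof -
  obtain T r where T: "T \<in> signed_even_perms" "r \<in> set RV" "x = T (of_gvec r)"
    using assms by (rule orbit_points_cases)
  define L where "L = filter (\<lambda>w. gdot r w = a) (gorbits RV)"
  have "T (of_gvec r) \<bullet> T (of_gvec w) = of_gint a \<longleftrightarrow> gdot r w = a" for w
    unfolding signed_even_perms_inner[OF T(1)] by simp
  then have "{y \<in> T ` of_gvec ` set (gorbits RV). x \<bullet> y = of_gint a} = (\<lambda>w. T (of_gvec w)) ` set L"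
    unfolding L_def T(3) set_filter by blast
  then have "{y \<in> orbit_points RV. x \<bullet> y = of_gint a} = (\<lambda>w. T (of_gvec w)) ` set L"
    by (simp only: orbit_points_def[symmetric] signed_even_perms_orbit_points[OF T(1)])
  moreover have "inj_on (\<lambda>w. T (of_gvec w)) (set L)"
    by (rule inj_onI) (simp only: inj_eq[OF signed_even_perms_inj[OF T(1)]] of_gvec_inject)
  ultimately have "card {y \<in> orbit_points RV. x \<bullet> y = of_gint a} = card (set L)"
    by (simp only: card_image)
  also have "\<dots> = length L"
    unfolding L_def using dist_V by (intro distinct_card distinct_filter)
  also have "\<dots> = d" unfolding L_def by (rule degree[OF T(2)])
  finally show ?thesis .
qed

lemma sum_V: "(\<Sum>x\<in>V. f x) = (\<Sum>x\<in>orbit_points RV. f (sgn x))" for f :: "real ^ 4 \<Rightarrow> real"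
  unfolding V_def by (rule sum.reindex[OF inj_on_sgn_orbit_points[OF norm_V nv], unfolded o_def])

lemma sum_E: "(\<Sum>x\<in>E. f x) = (\<Sum>x\<in>orbit_points RE. f (sgn x))" for f :: "real ^ 4 \<Rightarrow> real"
  unfolding E_def by (rule sum.reindex[OF inj_on_sgn_orbit_points[OF norm_E ne], unfolded o_def])

lemma sum_first:
  fixes f :: "real ^ 4 \<Rightarrow> real"
  shows "(\<Sum>(x, y)\<in>adjacent. f x) = d * (\<Sum>x\<in>V. f x)"
proof -
  have "(\<Sum>(x, y)\<in>scaled_adjacent. f (sgn x)) = (\<Sum>x\<in>orbit_points RV. \<Sum>y | y \<in> orbit_points RV \<and> x \<bullet> y = of_gint a. f (sgn x))"
    by (subst sum.Sigma) (auto simp: scaled_adjacent_def intro!: sum.cong)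
  also have "\<dots> = (\<Sum>x\<in>orbit_points RV. d * f (sgn x))"
    using card_neighbours by (intro sum.cong) simp_all
  also have "\<dots> = d * (\<Sum>x\<in>V. f x)"
    by (simp only: sum_V sum_distrib_left)
  finally show ?thesis by (simp add: sum_adjacent)
qed

lemma sum_adjacent_midpoint: "(x, y) \<in> scaled_adjacent \<Longrightarrow> x + y \<in> orbit_points RE"
proof (erule scaled_adjacent_cases)
  fix T r w assume T: "T \<in> signed_even_perms" "r \<in> set RV" "w \<in> set (gorbits RV)" "gdot r w = a"
    "x = T (of_gvec r)" "y = T (of_gvec w)"
  have "of_gvec (gadd r w) \<in> orbit_points RE"
    using midpoint[OF T(2,3,4)] unfolding orbit_points_def by (rule imageI)
  then have "T (of_gvec (gadd r w)) \<in> orbit_points RE"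
    using signed_even_perms_orbit_points[OF T(1)] by blast
  then show ?thesis by (simp add: signed_even_perms_linear[OF T(1)] T)
qed

text \<open>The group moves \<open>e\<close> to a representative, where the ordered edges with midpoint \<open>e\<close> are determined by their first
vertex \<open>v\<close>, the second one being \<open>e - v\<close>.\<close>

lemma card_fibre:
  assumes "e \<in> orbit_points RE"
  shows "card {p \<in> scaled_adjacent. fst p + snd p = e} = 2"
proof -
  obtain T r where T: "T \<in> signed_even_perms" "r \<in> set RE" "e = T (of_gvec r)"
    using assms by (rule orbit_points_cases)
  define L where "L = filter (\<lambda>v. gdiff r v \<in> set (gorbits RV)) (filter (\<lambda>v. gdot v (gdiff r v) = a) (gorbits RV))"
  define g where "g v = (T (of_gvec v), T (of_gvec (gdiff r v)))" for v
  have "{p \<in> scaled_adjacent. fst p + snd p = e} = g ` set L"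
  proof (intro equalityI subsetI)
    fix p assume "p \<in> {p \<in> scaled_adjacent. fst p + snd p = e}"
    then obtain x y where p: "p = (x, y)" "(x, y) \<in> scaled_adjacent" "x + y = e" by (cases p) auto
    then have "x \<in> T ` orbit_points RV" "y \<in> T ` orbit_points RV"
      by (auto simp: scaled_adjacent_def signed_even_perms_orbit_points[OF T(1)])
    then obtain v v' where v: "v \<in> set (gorbits RV)" "x = T (of_gvec v)" and v': "v' \<in> set (gorbits RV)" "y = T (of_gvec v')"
      by (auto simp: orbit_points_def)
    have "T (of_gvec (gadd v v')) = T (of_gvec r)"
      using p(3) by (simp add: v v' T(3) signed_even_perms_linear[OF T(1)])
    then have "of_gvec v + of_gvec v' = of_gvec r"
      using signed_even_perms_inj[OF T(1)] by (simp add: inj_eq)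
    then have "of_gvec v' = of_gvec (gdiff r v)" by (simp add: algebra_simps)
    then have "v' = gdiff r v" by (simp only: of_gvec_inject)
    moreover have "gdot v v' = a"
      using p(2) by (simp add: scaled_adjacent_def v v' signed_even_perms_inner[OF T(1)])
    ultimately show "p \<in> g ` set L" using v v' by (auto simp: p(1) g_def L_def)
  next
    fix p assume "p \<in> g ` set L"
    then obtain v where v: "p = g v" "v \<in> set (gorbits RV)" "gdiff r v \<in> set (gorbits RV)" "gdot v (gdiff r v) = a"
      by (auto simp: L_def)
    have mem: "T (of_gvec u) \<in> orbit_points RV" if "u \<in> set (gorbits RV)" for u
    proof -
      have "T (of_gvec u) \<in> T ` orbit_points RV" using that unfolding orbit_points_def by (intro imageI)
      then show ?thesis by (simp only: signed_even_perms_orbit_points[OF T(1)])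
    qed
    have "T (of_gvec v) \<in> orbit_points RV" "T (of_gvec (gdiff r v)) \<in> orbit_points RV"
      by (intro mem v)+
    moreover have "T (of_gvec v) + T (of_gvec (gdiff r v)) = e"
      by (simp add: T(3) signed_even_perms_linear[OF T(1)])
    moreover have "T (of_gvec v) \<bullet> T (of_gvec (gdiff r v)) = of_gint a"
      unfolding signed_even_perms_inner[OF T(1)] of_gvec_hom(4) v(4) ..
    ultimately show "p \<in> {p \<in> scaled_adjacent. fst p + snd p = e}"
      by (simp add: v(1) g_def scaled_adjacent_def)
  qed
  moreover have "inj_on g (set L)"
    by (rule inj_onI) (simp only: g_def prod.inject inj_eq[OF signed_even_perms_inj[OF T(1)]] of_gvec_inject)
  ultimately have "card {p \<in> scaled_adjacent. fst p + snd p = e} = card (set L)"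
    by (simp only: card_image)
  also have "\<dots> = length L" unfolding L_def using dist_V by (intro distinct_card distinct_filter)
  finally show ?thesis using fibre[OF T(2)] by (simp add: L_def)
qed

lemma sum_midpoints:
  fixes f :: "real ^ 4 \<Rightarrow> real"
  shows "(\<Sum>(x, y)\<in>adjacent. f (sgn (x + y))) = 2 * (\<Sum>e\<in>E. f e)"
proof -
  have "(\<Sum>(x, y)\<in>adjacent. f (sgn (x + y))) = (\<Sum>p\<in>scaled_adjacent. f (sgn (fst p + snd p)))"
    unfolding sum_adjacent
  proof (intro sum.cong refl)
    fix p assume "p \<in> scaled_adjacent"
    moreover obtain x y where p: "p = (x, y)" by (cases p)
    ultimately have "sgn x + sgn y = inverse (sqrt (of_gint nv)) *\<^sub>R (x + y)"
      by (simp add: scaled_adjacent_def sgn_V scaleR_add_right)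
    then have "sgn (sgn x + sgn y) = sgn (x + y)" using nv by (simp add: sgn_scaleR)
    then show "(case p of (x, y) \<Rightarrow> f (sgn (sgn x + sgn y))) = f (sgn (fst p + snd p))"
      by (simp add: p)
  qed
  also have "\<dots> = (\<Sum>e\<in>orbit_points RE. \<Sum>p | p \<in> scaled_adjacent \<and> fst p + snd p = e. f (sgn (fst p + snd p)))"
    using sum_adjacent_midpoint
    by (intro sum.group[symmetric] finite_scaled_adjacent finite_orbit_points) auto
  also have "\<dots> = (\<Sum>e\<in>orbit_points RE. 2 * f (sgn e))"
  proof (intro sum.cong refl)
    fix e assume "e \<in> orbit_points RE"
    then have "card {p \<in> scaled_adjacent. fst p + snd p = e} = 2" by (rule card_fibre)
    then show "(\<Sum>p | p \<in> scaled_adjacent \<and> fst p + snd p = e. f (sgn (fst p + snd p))) = 2 * f (sgn e)"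
      by simp
  qed
  also have "\<dots> = 2 * (\<Sum>e\<in>E. f e)"
    by (simp only: sum_E sum_distrib_left)
  finally show ?thesis .
qed

lemma angle_bounds: "0 < pi / real m" "pi / real m < pi" "\<bar>cos (pi / real m)\<bar> < 1"
proof -
  show th: "0 < pi / real m" "pi / real m < pi" using m by (simp_all add: field_simps)
  then show "\<bar>cos (pi / real m)\<bar> < 1"
    using cos_monotone_0_pi[of 0 "pi / real m"] cos_monotone_0_pi[of "pi / real m" pi] by simp
qed

lemma adjacent_arc:
  assumes "(x, y) \<in> adjacent"
  shows "norm x = 1 \<and> norm y = 1 \<and> y \<noteq> x \<and> y \<noteq> - x"
proof -
  have "norm x = 1" "norm y = 1" "x \<bullet> y = cos (pi / real m)"
    using assms norm_V_1 by (auto simp: adjacent_def)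
  then show ?thesis using angle_bounds(3) by (auto simp: dot_square_norm)
qed

lemma adjacent_sym: "(x, y) \<in> adjacent \<Longrightarrow> (y, x) \<in> adjacent"
  by (auto simp: adjacent_def inner_commute)

lemma V_uminus: "x \<in> V \<Longrightarrow> - x \<in> V"
  using signed_even_perms_sgn_orbit_points[OF signed_even_perms_uminus, of RV] unfolding V_def by blast

lemma sum_arc_integrals:
  assumes "k < 4 * m"
  shows "(\<Sum>e\<in>adjacent. arc_integral (\<lambda>x. (x \<bullet> z) ^ k) e)
    = pi / m / 2 * (d * (\<Sum>x\<in>V. (x \<bullet> z) ^ k) + 2 * (\<Sum>x\<in>E. (x \<bullet> z) ^ k))"
proof -
  have "(\<Sum>e\<in>adjacent. arc_integral (\<lambda>x. (x \<bullet> z) ^ k) e)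
      = pi / m / 2 * (\<Sum>(x, y)\<in>adjacent. (x \<bullet> z) ^ k + (sgn (x + y) \<bullet> z) ^ k)"
    unfolding adjacent_def
    by (rule sum_arc_integrals_rotation_closed[OF finite_V norm_V_1 m assms])
      (use rotation_closed in \<open>auto simp: adjacent_def\<close>)
  also have "(\<Sum>(x, y)\<in>adjacent. (x \<bullet> z) ^ k + (sgn (x + y) \<bullet> z) ^ k)
      = (\<Sum>(x, y)\<in>adjacent. (x \<bullet> z) ^ k) + (\<Sum>(x, y)\<in>adjacent. (sgn (x + y) \<bullet> z) ^ k)"
    by (simp only: split_def sum.distrib)
  finally show ?thesis by (simp only: sum_first sum_midpoints[of "\<lambda>x. (x \<bullet> z) ^ k"])
qed

lemma card_edges: "real d * real (card V) = 2 * real (card E)"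
  using sum_first[of "\<lambda>_. 1"] sum_midpoints[of "\<lambda>_. 1"] by simp

text \<open>The assumption \<open>energy\<close> says that the hybrid rule is exact for \<open>(x \<bullet> z) ^ (2 h)\<close> if \<open>z\<close> is a normalized representative. By
invariance it is then exact if \<open>z\<close> is any vertex, midpoint or dual vertex, and these are the points over which the rule
sums the powers of degree \<open>2 h\<close>.\<close>

theorem hybrid_design_if_orbit_energies:
  assumes \<sigma>: "invariant_sphere_measure \<sigma>"
    and euler: "euler_cycle {{x, y} | x y. (x, y) \<in> adjacent} \<gamma>"
    and norm_X: "\<And>v. v \<in> set RX \<Longrightarrow> gdot v v = nx" and nx: "of_gint nx > 0"
    and dist_X: "distinct (gorbits RX)" and X0: "gorbits RX \<noteq> []" and E0: "gorbits RE \<noteq> []"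
    and \<beta>: "0 \<le> \<beta>" "\<beta> \<le> 1" and h: "2 * h < 4 * m"
    and energy: "\<And>r. r \<in> set RX \<union> set RV \<union> set RE \<Longrightarrow>
      \<beta> / length (gorbits RX) * (of_gint (orbit_power_sum (2 * h) RX r) / (of_gint nx * of_gint (gdot r r)) ^ h)
      + (1 - \<beta>) / 2 *
        (of_gint (orbit_power_sum (2 * h) RV r) / (of_gint nv * of_gint (gdot r r)) ^ h / length (gorbits RV)
         + of_gint (orbit_power_sum (2 * h) RE r) / (of_gint ne * of_gint (gdot r r)) ^ h / length (gorbits RE))
      = sphere_moment 4 (2 * h)"
  shows "hybrid_design \<sigma> (Suc (2 * h)) \<beta> \<gamma> (sgn ` orbit_points RX)"
proof -
  define X where "X = sgn ` orbit_points RX"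
  define \<Lambda> where "\<Lambda> = design_defect \<sigma> \<beta> \<gamma> X"
  have card_VE: "card V = length (gorbits RV)" "card E = length (gorbits RE)"
    unfolding V_def E_def
    by (simp_all only: card_image[OF inj_on_sgn_orbit_points[OF norm_V nv]] sum_orbit_points(2)[OF dist_V]
        card_image[OF inj_on_sgn_orbit_points[OF norm_E ne]] sum_orbit_points(2)[OF dist_E])
  have card_X: "card X = length (gorbits RX)"
    by (simp only: X_def card_image[OF inj_on_sgn_orbit_points[OF norm_X nx]] sum_orbit_points(2)[OF dist_X])
  have finX: "finite X" by (simp add: X_def)
  have X_ne: "X \<noteq> {}" using X0 card_X by auto
  have norm_X_1: "norm x = 1" if "x \<in> X" for x
    using norm_X nx that unfolding X_def by (rule sgn_orbit_points_sphere)
  then have X_sphere: "X \<subseteq> sphere 0 1" by auto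
  have E_pos: "card E > 0" using E0 by (simp add: card_VE)
  then have dV_pos: "real d * real (card V) > 0" using card_edges by simp
  have adj_ne: "adjacent \<noteq> {}"
    using sum_midpoints[of "\<lambda>_. 1"] E_pos by auto
  have sym: "(y, x) \<in> adjacent" if "(x, y) \<in> adjacent" for x y using that by (rule adjacent_sym)
  have irrefl: "(x, x) \<notin> adjacent" for x using adjacent_arc by blast
  have arcs_sub: "set (arcs \<gamma>) \<subseteq> adjacent"
    by (rule sum_list_arcs_euler_cycle(2)[OF euler sym irrefl, of "\<lambda>_. 0"]) simp_all
  have cyc: "geodesic_cycle \<gamma>"
    by (rule geodesic_cycle_if_euler_cycle[OF euler adj_ne arcs_sub adjacent_arc])
  have cycle: "cycle_integral \<gamma> p = (\<Sum>e\<in>adjacent. arc_integral p e) / 2" for p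
    unfolding cycle_integral_eq_sum_arcs
    by (rule sum_list_arcs_euler_cycle(1)[OF euler sym irrefl]) (simp_all add: arc_integral_swap)
  have len: "cycle_length \<gamma> = pi / m * card E"
  proof -
    have "cycle_length \<gamma> = (\<Sum>e\<in>adjacent. arc_integral (\<lambda>x. (x \<bullet> 0) ^ 0) e) / 2"
      by (simp add: cycle_length_def cycle)
    also have "\<dots> = pi / m / 2 * (real d * real (card V) + 2 * real (card E)) / 2"
      using m by (subst sum_arc_integrals) simp_all
    also have "\<dots> = pi / m * card E" unfolding card_edges by simp
    finally show ?thesis .
  qed
  have len_pos: "cycle_length \<gamma> > 0"
    unfolding len using angle_bounds(1) E_pos by (simp only: zero_less_mult_iff of_nat_0_less_iff simp_thms)
  have average: "cycle_integral \<gamma> (\<lambda>x. (x \<bullet> z) ^ (2 * h)) / cycle_length \<gamma>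
      = ((\<Sum>x\<in>V. (x \<bullet> z) ^ (2 * h)) / card V + (\<Sum>x\<in>E. (x \<bullet> z) ^ (2 * h)) / card E) / 2" for z
  proof -
    define SV SE where "SV = (\<Sum>x\<in>V. (x \<bullet> z) ^ (2 * h))" and "SE = (\<Sum>x\<in>E. (x \<bullet> z) ^ (2 * h))"
    have ratio: "t / 2 * (u * s + 2 * s') / 2 / (t * e) = (s / v + s' / e) / 2"
      if "t \<noteq> 0" "u * v = 2 * e" "u * v > 0" for t u v e s s' :: real
    proof -
      have e: "e = u * v / 2" and uv: "u \<noteq> 0" "v \<noteq> 0" using that by auto
      show ?thesis unfolding e using that(1) uv by (simp add: field_simps)
    qed
    have "cycle_integral \<gamma> (\<lambda>x. (x \<bullet> z) ^ (2 * h)) / cycle_length \<gamma>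
        = pi / m / 2 * (d * SV + 2 * SE) / 2 / (pi / m * card E)"
      by (simp only: cycle len sum_arc_integrals[OF h] SV_def SE_def)
    also have "\<dots> = (SV / card V + SE / card E) / 2"
      by (rule ratio[OF _ card_edges dV_pos]) (use angle_bounds(1) in linarith)
    finally show ?thesis by (simp only: SV_def SE_def)
  qed
  define F where "F z = \<beta> / card X * (\<Sum>x\<in>X. (x \<bullet> z) ^ (2 * h))
    + (1 - \<beta>) / 2 * ((\<Sum>x\<in>V. (x \<bullet> z) ^ (2 * h)) / card V + (\<Sum>x\<in>E. (x \<bullet> z) ^ (2 * h)) / card E)" for z
  have \<Lambda>: "sphere_functional \<Lambda>"
    unfolding \<Lambda>_def by (rule sphere_functional_design_defect[OF \<sigma> cyc X_sphere])
  have \<Lambda>_power: "\<Lambda> (\<lambda>x. (x \<bullet> z) ^ (2 * h)) = F z - sphere_moment 4 (2 * h)" if "norm z = 1" for z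
  proof -
    have "(1 - \<beta>) / cycle_length \<gamma> * cycle_integral \<gamma> (\<lambda>x. (x \<bullet> z) ^ (2 * h))
        = (1 - \<beta>) * (cycle_integral \<gamma> (\<lambda>x. (x \<bullet> z) ^ (2 * h)) / cycle_length \<gamma>)"
      by (simp only: times_divide_eq_left times_divide_eq_right)
    then show ?thesis
      unfolding \<Lambda>_def design_defect_def F_def integral_inner_power[OF \<sigma>] average
      by (simp add: that)
  qed
  have F_invariant: "F (T z) = F z" if "T \<in> signed_even_perms" for T z
    unfolding F_def X_def V_def E_def power_sum_invariant[OF that] ..
  have F_rep: "F (sgn (of_gvec r)) = sphere_moment 4 (2 * h)" if r: "r \<in> set RX \<union> set RV \<union> set RE" for r
  proof -
    have "of_gint (gdot r r) > 0" using r norm_X norm_V norm_E nx nv ne by auto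
    then show ?thesis
      using energy[OF r] unfolding F_def X_def V_def E_def
      by (simp only: card_X[unfolded X_def] card_VE[unfolded V_def E_def]
          power_sum_eq_orbit_power_sum[OF dist_X norm_X nx] power_sum_eq_orbit_power_sum[OF dist_V norm_V nv]
          power_sum_eq_orbit_power_sum[OF dist_E norm_E ne])
  qed
  have F_support: "F y = sphere_moment 4 (2 * h)" if "y \<in> X \<union> V \<union> E" for y
  proof -
    obtain x R where "y = sgn x" "x \<in> orbit_points R" and R: "set R \<subseteq> set RX \<union> set RV \<union> set RE"
      using \<open>y \<in> X \<union> V \<union> E\<close> unfolding X_def V_def E_def by blast
    obtain T r where T: "T \<in> signed_even_perms" "r \<in> set R" "x = T (of_gvec r)"
      using \<open>x \<in> orbit_points R\<close> by (rule orbit_points_cases)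
    have "y = T (sgn (of_gvec r))" using T by (simp add: \<open>y = sgn x\<close> signed_even_perms_sgn)
    then show ?thesis using F_rep[of r] R T F_invariant by auto
  qed
  \<comment> \<open>Weights add up at points that lie in more than one of the three sets.\<close>
  define w where "w y = (if y \<in> X then \<beta> / card X else 0)
    + (if y \<in> V then (1 - \<beta>) / 2 / card V else 0) + (if y \<in> E then (1 - \<beta>) / 2 / card E else 0)" for y
  have fin: "finite (X \<union> V \<union> E)" using finX finite_V finite_E by simp
  have F_w: "F z = (\<Sum>y\<in>X \<union> V \<union> E. w y * (y \<bullet> z) ^ (2 * h))" for z
  proof -
    have restrict: "(\<Sum>y\<in>X \<union> V \<union> E. (if y \<in> A then u else 0) * f y) = u * sum f A"
      if "A \<subseteq> X \<union> V \<union> E" for A and u and f :: "real ^ 4 \<Rightarrow> real"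
    proof -
      have "(\<Sum>y\<in>X \<union> V \<union> E. (if y \<in> A then u else 0) * f y) = (\<Sum>y\<in>X \<union> V \<union> E. if y \<in> A then u * f y else 0)"
        by (intro sum.cong refl) simp
      also have "\<dots> = (\<Sum>y\<in>(X \<union> V \<union> E) \<inter> A. u * f y)"
        by (rule sum.inter_restrict[OF fin, symmetric])
      also have "(X \<union> V \<union> E) \<inter> A = A" using that by blast
      finally show ?thesis by (simp only: sum_distrib_left)
    qed
    have sub: "X \<subseteq> X \<union> V \<union> E" "V \<subseteq> X \<union> V \<union> E" "E \<subseteq> X \<union> V \<union> E" by blast+
    show ?thesis
      unfolding w_def F_def distrib_right sum.distrib sub[THEN restrict]
      by (simp only: distrib_left times_divide_eq_left times_divide_eq_right add.assoc)
  qed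
  have "\<Lambda> (\<lambda>z. \<Lambda> (\<lambda>x. (x \<bullet> z) ^ (2 * h))) = 0"
  proof (rule energy_zero_if_zero_on_support[OF \<Lambda>])
    show "\<Lambda> (\<lambda>_. 1) = 0"
      unfolding \<Lambda>_def using len_pos by (intro design_defect_one[OF \<sigma> finX X_ne]) simp
    show "\<Lambda> (\<lambda>x. (x \<bullet> z) ^ (2 * h)) = (\<Sum>y\<in>X \<union> V \<union> E. w y * (y \<bullet> z) ^ (2 * h)) - sphere_moment 4 (2 * h)"
      if "norm z = 1" for z
      using \<Lambda>_power[OF that] by (simp only: F_w)
    fix y assume y: "y \<in> X \<union> V \<union> E"
    then have "norm y = 1" using norm_X_1 norm_V_1 norm_E_1 by blast
    then show "\<Lambda> (\<lambda>x. (x \<bullet> y) ^ (2 * h)) = 0"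
      using \<Lambda>_power F_support[OF y] by simp
  qed
  moreover have "\<Lambda> (\<lambda>x. p (- x)) = \<Lambda> p" if p: "continuous_on UNIV p" for p
  proof -
    have "(\<Sum>x\<in>X. p (- x)) = (\<Sum>x\<in>uminus ` X. p x)"
      by (simp add: sum.reindex)
    also have "uminus ` X = X"
      unfolding X_def by (rule signed_even_perms_sgn_orbit_points[OF signed_even_perms_uminus])
    finally have X: "(\<Sum>x\<in>X. p (- x)) = (\<Sum>x\<in>X. p x)" .
    define neg where "neg = (\<lambda>(x :: real ^ 4, y :: real ^ 4). (- x, - y))"
    have "neg e \<in> adjacent" if "e \<in> adjacent" for e
      using that V_uminus by (auto simp: neg_def adjacent_def)
    moreover have "neg (neg e) = e" for e by (cases e) (simp add: neg_def)
    ultimately have "bij_betw neg adjacent adjacent"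
      by (intro bij_betwI[of _ _ _ neg]) auto
    moreover have "arc_integral (\<lambda>x. p (- x)) e = arc_integral p (neg e)" for e
    proof -
      have "- geodesic_arc x y s = geodesic_arc (- x) (- y) s" for x y :: "real ^ 4" and s
        by (simp add: geodesic_arc_def scaleR_diff_right[symmetric] algebra_simps)
      then show ?thesis by (cases e) (simp add: arc_integral_def neg_def)
    qed
    ultimately have "cycle_integral \<gamma> (\<lambda>x. p (- x)) = cycle_integral \<gamma> p"
      unfolding cycle by (simp add: sum.reindex_bij_betw)
    then show ?thesis
      by (simp add: \<Lambda>_def design_defect_def X integral_uminus[OF \<sigma> p])
  qed
  ultimately have "\<Lambda> p = 0" if "p \<in> Pol_le (Suc (2 * h))" for p
    using vanishes_on_Pol_le_even[OF \<Lambda>, of "2 * h" p] that by simp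
  then show ?thesis
    using cyc finX X_ne X_sphere \<beta> unfolding hybrid_design_def X_def[symmetric] \<Lambda>_def design_defect_def by simp
qed

end

section \<open>Exact computations for the 600-cell and the 120-cell\<close>

text \<open>The vertices, with all coordinates doubled.\<close>

definition reps_600cell :: "gvec list" where
  "reps_600cell = [GVec (GInt 2 0) (GInt 0 0) (GInt 0 0) (GInt 0 0),
     GVec (GInt 1 0) (GInt 1 0) (GInt 1 0) (GInt 1 0),
     GVec (GInt 0 1) (GInt 1 0) (GInt (-1) 1) (GInt 0 0)]"

text \<open>Sums of two adjacent vertices, again doubled.\<close>

definition reps_600cell_midpoints :: "gvec list" where
  "reps_600cell_midpoints = [GVec (GInt 2 1) (GInt 1 0) (GInt (-1) 1) (GInt 0 0),
     GVec (GInt 0 2) (GInt 2 0) (GInt 0 0) (GInt 0 0),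
     GVec (GInt 0 2) (GInt 0 1) (GInt (-1) 1) (GInt 1 0),
     GVec (GInt 1 1) (GInt 1 1) (GInt (-1) 1) (GInt (-1) 1),
     GVec (GInt 1 1) (GInt (-1) 2) (GInt 0 0) (GInt 0 1),
     GVec (GInt 1 1) (GInt 2 0) (GInt 0 1) (GInt 1 0)]"

text \<open>The classical coordinates of the 120-cell, of norm \<open>sqrt 8\<close>. The sum of the four vertices of a facet of the (doubled)
600-cell is \<open>\<phi>\<^sup>2\<close> times such a point.\<close>

definition reps_120cell :: "gvec list" where
  "reps_120cell = [GVec (GInt 2 0) (GInt 2 0) (GInt 0 0) (GInt 0 0),
     GVec (GInt (-1) 2) (GInt 1 0) (GInt 1 0) (GInt 1 0),
     GVec (GInt 0 1) (GInt 0 1) (GInt 0 1) (GInt 2 (-1)),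
     GVec (GInt 1 1) (GInt (-1) 1) (GInt (-1) 1) (GInt (-1) 1),
     GVec (GInt 1 1) (GInt 1 0) (GInt 0 0) (GInt 2 (-1)),
     GVec (GInt (-1) 2) (GInt 0 1) (GInt 0 0) (GInt (-1) 1),
     GVec (GInt 2 0) (GInt 0 1) (GInt (-1) 1) (GInt 1 0)]"

text \<open>For each representative of the 120-cell a facet of the 600-cell to which it belongs.\<close>

definition facets_600cell :: "gvec list list" where
  "facets_600cell = [[GVec (GInt 0 1) (GInt 1 0) (GInt (-1) 1) (GInt 0 0), GVec (GInt 1 0) (GInt 0 1) (GInt 0 0) (GInt 1 (-1)), GVec (GInt 1 0) (GInt 0 1) (GInt 0 0) (GInt (-1) 1), GVec (GInt 0 1) (GInt 1 0) (GInt 1 (-1)) (GInt 0 0)],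
     [GVec (GInt 0 1) (GInt 1 0) (GInt (-1) 1) (GInt 0 0), GVec (GInt 1 0) (GInt 1 0) (GInt 1 0) (GInt 1 0), GVec (GInt 0 1) (GInt (-1) 1) (GInt 0 0) (GInt 1 0), GVec (GInt 0 1) (GInt 0 0) (GInt 1 0) (GInt (-1) 1)],
     [GVec (GInt (-1) 1) (GInt 0 1) (GInt 1 0) (GInt 0 0), GVec (GInt 0 1) (GInt 1 0) (GInt (-1) 1) (GInt 0 0), GVec (GInt 1 0) (GInt 1 0) (GInt 1 0) (GInt 1 0), GVec (GInt 1 0) (GInt (-1) 1) (GInt 0 1) (GInt 0 0)],
     [GVec (GInt 0 1) (GInt 1 0) (GInt (-1) 1) (GInt 0 0), GVec (GInt 0 1) (GInt (-1) 1) (GInt 0 0) (GInt 1 0), GVec (GInt 0 1) (GInt 0 0) (GInt 1 0) (GInt (-1) 1), GVec (GInt 2 0) (GInt 0 0) (GInt 0 0) (GInt 0 0)],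
     [GVec (GInt 0 1) (GInt 1 0) (GInt (-1) 1) (GInt 0 0), GVec (GInt 0 1) (GInt (-1) 1) (GInt 0 0) (GInt 1 0), GVec (GInt 2 0) (GInt 0 0) (GInt 0 0) (GInt 0 0), GVec (GInt 0 1) (GInt 1 0) (GInt 1 (-1)) (GInt 0 0)],
     [GVec (GInt 0 1) (GInt 1 0) (GInt (-1) 1) (GInt 0 0), GVec (GInt 0 1) (GInt (-1) 1) (GInt 0 0) (GInt 1 0), GVec (GInt 1 0) (GInt 0 1) (GInt 0 0) (GInt (-1) 1), GVec (GInt 0 1) (GInt 1 0) (GInt 1 (-1)) (GInt 0 0)],
     [GVec (GInt 0 1) (GInt 1 0) (GInt (-1) 1) (GInt 0 0), GVec (GInt 1 0) (GInt 1 0) (GInt 1 0) (GInt 1 0), GVec (GInt 0 1) (GInt (-1) 1) (GInt 0 0) (GInt 1 0), GVec (GInt 1 0) (GInt 0 1) (GInt 0 0) (GInt (-1) 1)]]"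


text \<open>The power sums have many repeated terms. Counting equal inner products first means that only a few high powers have to be
computed.\<close>

fun tally_insert :: "'a \<Rightarrow> ('a \<times> int) list \<Rightarrow> ('a \<times> int) list" where
  "tally_insert t [] = [(t, 1)]"
| "tally_insert t ((u, n) # us) = (if t = u then (u, n + 1) # us else (u, n) # tally_insert t us)"

definition tally :: "'a list \<Rightarrow> ('a \<times> int) list" where
  "tally xs = fold tally_insert xs []"

lemma GInt_eq_of_int: "GInt n 0 = of_int n"
proof -
  have nat: "GInt (int k) 0 = of_nat k" for k
  proof (induction k)
    case (Suc k)
    have "GInt (int (Suc k)) 0 = 1 + GInt (int k) 0" by (simp add: one_gint_def)
    then show ?case by (simp only: Suc of_nat_Suc)
  qed (simp add: zero_gint_def)
  show ?thesis
  proof (cases n rule: int_cases2)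
    case (nonpos k)
    have "GInt n 0 = - GInt (int k) 0" by (simp add: nonpos)
    then show ?thesis by (simp add: nat nonpos)
  qed (simp add: nat)
qed

lemma sum_list_tally: "(\<Sum>x\<leftarrow>xs. f x) = (\<Sum>(t, n)\<leftarrow>tally xs. GInt n 0 * f t)"
proof -
  have ins: "(\<Sum>(t, n)\<leftarrow>tally_insert x us. GInt n 0 * f t) = f x + (\<Sum>(t, n)\<leftarrow>us. GInt n 0 * f t)" for x us
    by (induction x us rule: tally_insert.induct) (auto simp: GInt_eq_of_int algebra_simps)
  have "(\<Sum>(t, n)\<leftarrow>fold tally_insert xs us. GInt n 0 * f t) = (\<Sum>x\<leftarrow>xs. f x) + (\<Sum>(t, n)\<leftarrow>us. GInt n 0 * f t)" for us
    by (induction xs arbitrary: us) (simp_all add: ins)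
  then show ?thesis by (simp add: tally_def)
qed

definition tallied_power_sum :: "(gint \<Rightarrow> gint) \<Rightarrow> gvec list \<Rightarrow> gvec \<Rightarrow> gint" where
  "tallied_power_sum f vs z = (\<Sum>(t, n)\<leftarrow>tally (map (\<lambda>v. let s = gdot v z in s * s) vs). GInt n 0 * f t)"

lemma tallied_power_sum:
  assumes "\<And>t. f t = t ^ h"
  shows "tallied_power_sum f (gorbits vs) z = orbit_power_sum (2 * h) vs z"
  unfolding tallied_power_sum_def sum_list_tally[symmetric] orbit_power_sum_def
  by (simp add: o_def assms power_mult power2_eq_square Let_def)

definition ninth_power :: "gint \<Rightarrow> gint" where
  "ninth_power t = (let t2 = t * t; t4 = t2 * t2 in t4 * t4 * t)"

lemma ninth_power: "ninth_power t = t ^ 9"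
  by (simp add: ninth_power_def Let_def eval_nat_numeral mult_ac)

text \<open>The equation \<open>energy\<close> of \<open>hybrid_design_if_orbit_energies\<close> for the balancing factor \<open>176 / 301\<close>, multiplied by
\<open>602 \<cdot> 3600 \<cdot> (8 (r \<bullet> r)) ^ 9 \<cdot> (2 + \<phi>) ^ 9\<close>. The last factor occurs because \<open>4 (2 + \<phi>)\<close> is the squared norm of
the midpoints. The constant in front of \<open>(r \<bullet> r) ^ 9\<close> is \<open>4862 \<cdot> 602 \<cdot> 3600 \<cdot> 2 ^ 9\<close>, where \<open>4862\<close> is the ninth
Catalan number.\<close>

definition energy_check_600cell :: "gvec list \<Rightarrow> bool" where
  "energy_check_600cell rs =
    (let X = gorbits reps_120cell; V = gorbits reps_600cell; E = gorbits reps_600cell_midpoints in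
     \<forall>r\<in>set rs.
       (GInt 2112 0 * tallied_power_sum ninth_power X r + GInt 1920000 0 * tallied_power_sum ninth_power V r
          - GInt 5394906316800 0 * ninth_power (gdot r r)) * ninth_power (GInt 2 1)
        + GInt 320000 0 * tallied_power_sum ninth_power E r = 0)"

lemma energy_120cell: "energy_check_600cell reps_120cell"
  by code_simp
lemma energy_600cell: "energy_check_600cell reps_600cell"
  by code_simp
lemma energy_600cell_midpoints: "energy_check_600cell reps_600cell_midpoints"
  by code_simp


fun gsquares :: "gvec \<Rightarrow> gvec" where
  "gsquares (GVec a b c d) = GVec (a * a) (b * b) (c * c) (d * d)"

text \<open>Two vectors agree up to the signs of their coordinates if and only if the squares of their coordinates agree. So
membership in an orbit can be tested with the squares of the unsigned rearrangements, which are far fewer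
than the points of the orbit.\<close>

definition square_table :: "gvec list \<Rightarrow> gvec list" where
  "square_table vs = map gsquares (concat (map (\<lambda>v. remdups (even_rearrangements v)) vs))"

lemma gint_square_eq_iff: "x * x = y * y \<longleftrightarrow> x = y \<or> x = - y" for x y :: gint
proof -
  have "x * x = y * y \<longleftrightarrow> (of_gint x)\<^sup>2 = (of_gint y)\<^sup>2"
    by (simp only: power2_eq_square of_gint_hom(6)[symmetric] of_gint_inject)
  then show ?thesis by (simp add: power2_eq_iff flip: of_gint_hom(4) of_gint_inject)
qed

lemma mem_sign_choices_iff: "y \<in> set (sign_choices x) \<longleftrightarrow> y * y = x * x"
  by (auto simp: gint_square_eq_iff sign_choices_def)

lemma mem_sign_changes_iff: "w \<in> set (sign_changes v) \<longleftrightarrow> gsquares w = gsquares v"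
proof -
  obtain a b c d a' b' c' d' where "v = GVec a b c d" "w = GVec a' b' c' d'" by (cases v; cases w)
  moreover have "GVec a' b' c' d' \<in> set (sign_changes (GVec a b c d)) \<longleftrightarrow>
      a' \<in> set (sign_choices a) \<and> b' \<in> set (sign_choices b) \<and> c' \<in> set (sign_choices c) \<and> d' \<in> set (sign_choices d)"
    by (simp add: image_iff)
  ultimately show ?thesis by (simp only: mem_sign_choices_iff gsquares.simps gvec.inject)
qed

lemma gorbits_eq:
  "gorbits vs = concat (map sign_changes (concat (map (\<lambda>v. remdups (even_rearrangements v)) vs)))"
  by (induction vs) (simp_all add: gorbits_def gorbit_def)

lemma mem_gorbits_iff: "w \<in> set (gorbits vs) \<longleftrightarrow> gsquares w \<in> set (square_table vs)"
  unfolding gorbits_eq square_table_def by (auto simp: mem_sign_changes_iff)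

text \<open>Blocks with different keys are disjoint.\<close>

lemma distinct_concat_map_if_distinct_keys:
  assumes "distinct (map g xs)" "\<And>x. distinct (f x)" "\<And>x y. y \<in> set (f x) \<Longrightarrow> g y = g x"
  shows "distinct (concat (map f xs))"
  using assms(1)
proof (induction xs)
  case (Cons x xs)
  have "set (f x) \<inter> set (concat (map f xs)) = {}"
  proof (rule equals0I)
    fix y assume "y \<in> set (f x) \<inter> set (concat (map f xs))"
    then obtain x' where "y \<in> set (f x)" "x' \<in> set xs" "y \<in> set (f x')" by auto
    moreover from this have "g x = g x'" using assms(3)[of y x] assms(3)[of y x'] by simp
    ultimately have "g x \<in> set (map g xs)" by simp
    then show False using Cons.prems by simp
  qed
  then show ?case using Cons assms(2) by simp
qed simp

lemma distinct_sign_changes: "distinct (sign_changes v)"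
proof -
  have "- x \<noteq> x" if "x \<noteq> 0" for x :: gint
  proof
    assume "- x = x"
    then have "of_gint (- x) = of_gint x" by (simp only:)
    then have "of_gint x = 0" by (simp only: of_gint_hom(4) equal_neg_zero neg_equal_zero)
    then show False using that by (simp only: of_gint_eq_0_iff)
  qed
  then have choices: "distinct (sign_choices x)" for x
    by (auto simp: sign_choices_def dest: sym)
  obtain a b c d where v: "v = GVec a b c d" by (cases v)
  have "sign_changes v = map (\<lambda>(p, q, r, s). GVec p q r s)
      (List.product (sign_choices a) (List.product (sign_choices b) (List.product (sign_choices c) (sign_choices d))))"
    by (simp add: v product_concat_map map_concat o_def)
  moreover have "inj_on (\<lambda>(p, q, r, s). GVec p q r s) A" for A by (auto simp: inj_on_def)
  ultimately show ?thesis by (simp add: distinct_map distinct_product choices)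
qed

lemma distinct_gorbits:
  assumes "distinct (square_table vs)"
  shows "distinct (gorbits vs)"
  unfolding gorbits_eq
  using assms unfolding square_table_def
  by (rule distinct_concat_map_if_distinct_keys) (simp_all add: distinct_sign_changes mem_sign_changes_iff)

lemma distinct_600cell: "distinct (gorbits reps_600cell)"
  by (rule distinct_gorbits) code_simp

lemma distinct_600cell_midpoints: "distinct (gorbits reps_600cell_midpoints)"
  by (rule distinct_gorbits) code_simp

lemma distinct_120cell: "distinct (gorbits reps_120cell)"
  by (rule distinct_gorbits) code_simp

lemma length_600cell:
  "length (gorbits reps_600cell) = 120" "length (gorbits reps_600cell_midpoints) = 720"
  "length (gorbits reps_120cell) = 600"
  by code_simp+

lemma norm_600cell:
  "\<forall>v\<in>set reps_600cell. gdot v v = GInt 4 0"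
  "\<forall>v\<in>set reps_600cell_midpoints. gdot v v = GInt 8 4"
  "\<forall>v\<in>set reps_120cell. gdot v v = GInt 8 0"
  by code_simp+

lemma closed_600cell:
  "let S = square_table reps_600cell in
   \<forall>r\<in>set reps_600cell. \<forall>w\<in>set (filter (\<lambda>w. gdot r w = GInt 0 2) (gorbits reps_600cell)).
     gsquares (gdiff (gscale (GInt 0 1) w) r) \<in> set S"
  by code_simp

lemma degree_600cell:
  "\<forall>r\<in>set reps_600cell. length (filter (\<lambda>w. gdot r w = GInt 0 2) (gorbits reps_600cell)) = 12"
  by code_simp

lemma midpoint_600cell:
  "let S = square_table reps_600cell_midpoints in
   \<forall>r\<in>set reps_600cell. \<forall>w\<in>set (filter (\<lambda>w. gdot r w = GInt 0 2) (gorbits reps_600cell)).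
     gsquares (gadd r w) \<in> set S"
  by code_simp

lemma fibre_600cell:
  "let L = gorbits reps_600cell; S = square_table reps_600cell in
   \<forall>e\<in>set reps_600cell_midpoints.
     length (filter (\<lambda>v. gsquares (gdiff e v) \<in> set S) (filter (\<lambda>v. gdot v (gdiff e v) = GInt 0 2) L)) = 2"
  by code_simp

text \<open>All facets with a representative as one of their vertices. The factor \<open>GInt 2 (- 1)\<close> is \<open>1 / \<phi>\<^sup>2\<close>.\<close>

lemma facet_sums_600cell:
  "let L = gorbits reps_600cell; S = square_table reps_120cell in
   \<forall>w\<in>set reps_600cell. let N = filter (\<lambda>v. gdot w v = GInt 0 2) L in
     \<forall>x\<in>set N. let N' = filter (\<lambda>v. gdot x v = GInt 0 2) N in
       \<forall>y\<in>set N'. \<forall>z\<in>set (filter (\<lambda>v. gdot y v = GInt 0 2) N').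
         gsquares (gscale (GInt 2 (-1)) (gadd (gadd (gadd w x) y) z)) \<in> set S"
  by code_simp

lemma facets_600cell_sums:
  "let S = square_table reps_600cell in
   list_all2 (\<lambda>r q. case q of [w, x, y, z] \<Rightarrow>
       (\<forall>v\<in>set q. gsquares v \<in> set S) \<and> (\<forall>(u, v)\<in>set [(w, x), (w, y), (w, z), (x, y), (x, z), (y, z)]. gdot u v = GInt 0 2) \<and>
       gscale (GInt 2 (-1)) (gadd (gadd (gadd w x) y) z) = r
     | _ \<Rightarrow> False) reps_120cell facets_600cell"
  by code_simp

text \<open>The definition of the 600-cell applies the signs to its third kind of vertices before the permutation, and
\<^const>\<open>gorbit\<close> applies them after it.\<close>

lemma gorbit_600cell:
  "let signed = [GVec (GInt 0 a) (GInt b 0) (GInt (- c) c) (GInt 0 0). a \<leftarrow> [1, -1], b \<leftarrow> [1, -1], c \<leftarrow> [1, -1]];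
       R = concat (map even_rearrangements signed);
       S = gorbit (GVec (GInt 0 1) (GInt 1 0) (GInt (- 1) 1) (GInt 0 0)) in
     (\<forall>v\<in>set R. v \<in> set S) \<and> (\<forall>v\<in>set S. v \<in> set R)"
  by code_simp

section \<open>Exact computations for the 24-cell\<close>

text \<open>The scales are \<open>sqrt 2\<close> for the vertices and 2 for the dual vertices.\<close>

definition reps_24cell :: "gvec list" where
  "reps_24cell = [GVec (GInt 1 0) (GInt 1 0) (GInt 0 0) (GInt 0 0)]"

definition reps_24cell_midpoints :: "gvec list" where
  "reps_24cell_midpoints = [GVec (GInt 2 0) (GInt 1 0) (GInt 1 0) (GInt 0 0)]"

definition reps_dual_24cell :: "gvec list" where
  "reps_dual_24cell =
    [GVec (GInt 2 0) (GInt 0 0) (GInt 0 0) (GInt 0 0), GVec (GInt 1 0) (GInt 1 0) (GInt 1 0) (GInt 1 0)]"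

text \<open>The equation \<open>energy\<close> for the balancing factor \<open>5 / 14\<close>, multiplied by \<open>64512 (r \<bullet> r) ^ 3\<close>.\<close>

lemma energy_24cell:
  "\<forall>r\<in>set (reps_dual_24cell @ reps_24cell @ reps_24cell_midpoints).
     GInt 15 0 * orbit_power_sum 6 reps_dual_24cell r + GInt 108 0 * orbit_power_sum 6 reps_24cell r
       + orbit_power_sum 6 reps_24cell_midpoints r = GInt 5040 0 * gdot r r ^ 3"
  by code_simp

lemma distinct_24cell: "distinct (gorbits reps_24cell)"
  by (rule distinct_gorbits) code_simp

lemma distinct_24cell_midpoints: "distinct (gorbits reps_24cell_midpoints)"
  by (rule distinct_gorbits) code_simp

lemma distinct_dual_24cell: "distinct (gorbits reps_dual_24cell)"
  by (rule distinct_gorbits) code_simp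

lemma length_24cell:
  "length (gorbits reps_24cell) = 24" "length (gorbits reps_24cell_midpoints) = 96"
  "length (gorbits reps_dual_24cell) = 24"
  by code_simp+

lemma norm_24cell:
  "\<forall>v\<in>set reps_24cell. gdot v v = GInt 2 0"
  "\<forall>v\<in>set reps_24cell_midpoints. gdot v v = GInt 6 0"
  "\<forall>v\<in>set reps_dual_24cell. gdot v v = GInt 4 0"
  by code_simp+

lemma closed_24cell:
  "\<forall>r\<in>set reps_24cell. \<forall>w\<in>set (filter (\<lambda>w. gdot r w = GInt 1 0) (gorbits reps_24cell)).
     gdiff (gscale (GInt 1 0) w) r \<in> set (gorbits reps_24cell)"
  by code_simp

lemma degree_24cell:
  "\<forall>r\<in>set reps_24cell. length (filter (\<lambda>w. gdot r w = GInt 1 0) (gorbits reps_24cell)) = 8"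
  by code_simp

lemma midpoint_24cell:
  "\<forall>r\<in>set reps_24cell. \<forall>w\<in>set (filter (\<lambda>w. gdot r w = GInt 1 0) (gorbits reps_24cell)).
     gadd r w \<in> set (gorbits reps_24cell_midpoints)"
  by code_simp

lemma fibre_24cell:
  "\<forall>e\<in>set reps_24cell_midpoints.
     length (filter (\<lambda>v. gdiff e v \<in> set (gorbits reps_24cell))
       (filter (\<lambda>v. gdot v (gdiff e v) = GInt 1 0) (gorbits reps_24cell))) = 2"
  by code_simp

section \<open>The 600-cell and the 120-cell in coordinates\<close>

lemma golden_ratio_pos: "golden_ratio > 0"
  by (simp add: golden_ratio_def add_pos_pos)

text \<open>From \<open>cos (3 x) = - cos (2 x)\<close> for \<open>x = \<pi> / 5\<close>.\<close>

lemma cos_pi_div_5: "cos (pi / 5) = golden_ratio / 2"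
proof -
  define c where "c = cos (pi / 5)"
  have "cos (3 * (pi / 5)) = - cos (2 * (pi / 5))"
  proof -
    have "3 * (pi / 5) = pi - 2 * (pi / 5)" by simp
    then show ?thesis by (simp only: cos_pi_minus)
  qed
  then have "4 * c ^ 3 - 3 * c = - (2 * c\<^sup>2 - 1)"
    by (simp only: cos_treble_cos cos_double_cos c_def)
  then have "(c + 1) * (4 * c\<^sup>2 - 2 * c - 1) = 0"
    by (simp add: algebra_simps power2_eq_square power3_eq_cube)
  moreover have "c > 0" unfolding c_def by (rule cos_gt_zero) simp_all
  ultimately have "4 * c\<^sup>2 - 2 * c - 1 = 0" by auto
  then have "(4 * c - 1)\<^sup>2 = 5" by (simp add: power2_eq_square algebra_simps)
  then have "\<bar>4 * c - 1\<bar> = sqrt 5" by (metis real_sqrt_abs)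
  moreover have "sqrt 5 > 1" by simp
  ultimately have "4 * c - 1 = sqrt 5" using \<open>c > 0\<close> by linarith
  then show ?thesis by (simp add: c_def golden_ratio_def)
qed

text \<open>An odd permutation can be composed with the exchange of two equal coordinates.\<close>

lemma coord_perms_eq_even_coord_perms:
  assumes "i \<noteq> j" "w $ i = w $ j"
  shows "coord_perms w = even_coord_perms w"
proof
  show "coord_perms w \<subseteq> even_coord_perms w"
  proof
    fix x assume "x \<in> coord_perms w"
    then obtain \<pi> where x: "x = (\<chi> k. w $ \<pi> k)" and \<pi>: "\<pi> permutes UNIV"
      unfolding coord_perms_def by blast
    define \<tau> where "\<tau> = Transposition.transpose i j"
    have perm: "permutation \<pi>" "permutation \<tau>"
      using permutes_imp_permutation[OF finite \<pi>] by (simp_all add: \<tau>_def permutation_swap_id)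
    have "evenperm \<pi> \<or> evenperm (\<tau> \<circ> \<pi>)"
      using perm assms(1) by (simp add: evenperm_comp \<tau>_def evenperm_swap)
    moreover have "x = (\<chi> k. w $ (\<tau> \<circ> \<pi>) k)"
      using assms(2) by (simp add: x vec_eq_iff \<tau>_def Transposition.transpose_def)
    moreover have "\<tau> \<circ> \<pi> permutes UNIV"
      unfolding \<tau>_def by (intro permutes_compose[OF \<pi>] permutes_swap_id) simp_all
    ultimately show "x \<in> even_coord_perms w"
      using x \<pi> unfolding even_coord_perms_def by blast
  qed
  show "even_coord_perms w \<subseteq> coord_perms w"
    unfolding coord_perms_def even_coord_perms_def by blast
qed

lemma even_coord_perms_scaleR: "even_coord_perms (s *\<^sub>R w) = (\<lambda>x. s *\<^sub>R x) ` even_coord_perms w"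
proof -
  have "(\<chi> i. (s *\<^sub>R w) $ \<pi> i) = s *\<^sub>R (\<chi> i. w $ \<pi> i)" for \<pi> :: "4 \<Rightarrow> 4"
    by (simp add: vec_eq_iff)
  then show ?thesis unfolding even_coord_perms_def by (auto simp: image_iff)
qed

lemma even_coord_perms_of_gvec:
  "even_coord_perms (of_gvec v) = of_gvec ` set (even_rearrangements v)"
  unfolding even_coord_perms_def of_gvec_even_rearrangements ..

lemma sgn_image_orbit_points:
  assumes "\<forall>v\<in>set vs. gdot v v = n"
  shows "sgn ` orbit_points vs = (\<lambda>v. inverse (sqrt (of_gint n)) *\<^sub>R of_gvec v) ` set (gorbits vs)"
proof -
  have "sgn (of_gvec v) = inverse (sqrt (of_gint n)) *\<^sub>R of_gvec v" if "v \<in> set (gorbits vs)" for v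
    by (intro sgn_eq_scaleR orbit_points_inner_self[of vs]) (use that assms in \<open>auto simp: orbit_points_def\<close>)
  then show ?thesis by (simp add: orbit_points_def image_image)
qed

lemma half_sign_vectors_eq:
  "half_sign_vectors = (\<lambda>v. (1/2) *\<^sub>R of_gvec v) ` set (gorbit (GVec (GInt 1 0) (GInt 1 0) (GInt 1 0) (GInt 1 0)))"
    (is "_ = _ ` set (gorbit ?r)")
proof -
  have "gorbit ?r = sign_changes ?r" by (simp add: gorbit_def)
  moreover have "set (sign_changes ?r) = {GVec a b c d | a b c d. {a, b, c, d} \<subseteq> {1, -1}}"
  proof (rule set_eqI)
    fix w show "w \<in> set (sign_changes ?r) \<longleftrightarrow> w \<in> {GVec a b c d | a b c d. {a, b, c, d} \<subseteq> {1, -1}}"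
      unfolding mem_sign_changes_iff using gint_square_eq_iff[of _ 1]
      by (cases w) (simp add: one_gint_def[symmetric])
  qed
  ultimately have "(\<lambda>v. (1/2) *\<^sub>R of_gvec v) ` set (gorbit ?r)
      = (\<lambda>v. (1/2) *\<^sub>R of_gvec v) ` {GVec a b c d | a b c d. {a, b, c, d} \<subseteq> {1, -1}}"
    by (simp only:)
  also have "\<dots> = half_sign_vectors"
  proof (intro equalityI subsetI)
    fix x assume "x \<in> half_sign_vectors"
    then obtain a b c d where x: "x = (1/2) *\<^sub>R vector [a, b, c, d]"
      and "a \<in> {1, -1}" "b \<in> {1, -1}" "c \<in> {1, -1}" "d \<in> {1, -1}"
      unfolding half_sign_vectors_def by blast
    moreover have "\<exists>g\<in>{1, -1}. of_gint g = s" if "s \<in> {1, -1}" for s using that by force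
    ultimately obtain a' b' c' d' where "of_gint a' = a" "of_gint b' = b" "of_gint c' = c" "of_gint d' = d"
      "{a', b', c', d'} \<subseteq> {1, -1}" by (metis empty_subsetI insert_subset)
    then show "x \<in> (\<lambda>v. (1/2) *\<^sub>R of_gvec v) ` {GVec a b c d | a b c d. {a, b, c, d} \<subseteq> {1, -1}}"
      by (intro image_eqI[of _ _ "GVec a' b' c' d'"]) (auto simp: x)
  next
    fix x :: "real ^ 4"
    assume "x \<in> (\<lambda>v. (1/2) *\<^sub>R of_gvec v) ` {GVec a b c d | a b c d. {a, b, c, d} \<subseteq> {1, -1}}"
    then obtain a b c d where "x = (1/2) *\<^sub>R of_gvec (GVec a b c d)" and signs: "{a, b, c, d} \<subseteq> {1, -1}"
      by blast
    then have x: "x = (1/2) *\<^sub>R vector [of_gint a, of_gint b, of_gint c, of_gint d]" by simp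
    from signs have "of_gint a \<in> {1, -1}" "of_gint b \<in> {1, -1}" "of_gint c \<in> {1, -1}" "of_gint d \<in> {1, -1}" by auto
    then show "x \<in> half_sign_vectors" unfolding x half_sign_vectors_def by blast
  qed
  finally show ?thesis ..
qed

lemma vertices_600cell_eq: "vertices_600cell = sgn ` orbit_points reps_600cell"
proof -
  let ?s = "\<lambda>v. (1/2) *\<^sub>R of_gvec v"
  let ?r1 = "GVec (GInt 2 0) (GInt 0 0) (GInt 0 0) (GInt 0 0)"
  let ?r2 = "GVec (GInt 1 0) (GInt 1 0) (GInt 1 0) (GInt 1 0)"
  let ?r3 = "GVec (GInt 0 1) (GInt 1 0) (GInt (- 1) 1) (GInt 0 0)"
  have "inverse (sqrt (of_gint (GInt 4 0))) = 1 / 2" by simp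
  then have "sgn ` orbit_points reps_600cell = ?s ` set (gorbits reps_600cell)"
    unfolding sgn_image_orbit_points[OF norm_600cell(1)] by simp
  also have "\<dots> = ?s ` set (gorbit ?r1) \<union> ?s ` set (gorbit ?r2) \<union> ?s ` set (gorbit ?r3)"
    unfolding gorbits_def reps_600cell_def by auto
  also have "?s ` set (gorbit ?r2) = half_sign_vectors" by (rule half_sign_vectors_eq[symmetric])
  also have "?s ` set (gorbit ?r1) = (\<Union>a\<in>{1, -1}. coord_perms (vector [a, 0, 0, 0]))"
  proof -
    have "coord_perms (vector [a, 0, 0, 0]) = ?s ` set (even_rearrangements (GVec (GInt b 0) (GInt 0 0) (GInt 0 0) (GInt 0 0)))"
      if "a = of_int b / 2" for a :: real and b
    proof -
      have even: "coord_perms (vector [a, 0, 0, 0]) = even_coord_perms (vector [a, 0, 0, 0])"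
        by (rule coord_perms_eq_even_coord_perms[of 3 4]) (simp_all add: vector_4)
      have "vector [a, 0, 0, 0] = ?s (GVec (GInt b 0) (GInt 0 0) (GInt 0 0) (GInt 0 0))"
        by (simp add: vec_eq_iff_4 vector_4 that)
      then show ?thesis
        unfolding even by (simp only: even_coord_perms_scaleR even_coord_perms_of_gvec image_image)
    qed
    from this[of 1 2] this[of "-1" "-2"] show ?thesis
      by (auto simp: gorbit_def sign_choices_def zero_gint_def)
  qed
  also have "?s ` set (gorbit ?r3) = (\<Union>a\<in>{1, -1}. \<Union>b\<in>{1, -1}. \<Union>c\<in>{1, -1}.
        even_coord_perms ((1/2) *\<^sub>R vector [a * golden_ratio, b, c * inverse golden_ratio, 0]))"
  proof -
    let ?v = "\<lambda>a b c. GVec (GInt 0 a) (GInt b 0) (GInt (- c) c) (GInt 0 0)"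
    have inv: "inverse golden_ratio = golden_ratio - 1"
      using golden_ratio_pos golden_ratio_square by (simp add: field_simps)
    have perms: "even_coord_perms ((1/2) *\<^sub>R vector [of_int a * golden_ratio, of_int b, of_int c * inverse golden_ratio, 0])
        = ?s ` set (even_rearrangements (?v a b c))" for a b c
    proof -
      have "vector [of_int a * golden_ratio, of_int b, of_int c * inverse golden_ratio, 0] = of_gvec (?v a b c)"
        by (simp add: vec_eq_iff_4 vector_4 inv algebra_simps)
      then show ?thesis
        unfolding even_coord_perms_scaleR by (simp only: even_coord_perms_of_gvec image_image)
    qed
    have "set (gorbit ?r3) = set (concat (map even_rearrangements [?v a b c. a \<leftarrow> [1, -1], b \<leftarrow> [1, -1], c \<leftarrow> [1, -1]]))"
      using gorbit_600cell unfolding Let_def by blast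
    also have "\<dots> = (\<Union>a\<in>{1, -1}. \<Union>b\<in>{1, -1}. \<Union>c\<in>{1, -1}. set (even_rearrangements (?v a b c)))"
      by (simp only: set_concat set_map concat.simps map_append list.map append_Nil2 set_append list.set UN_insert UN_empty Un_empty_right
          image_Un UN_Un Un_assoc image_insert image_empty Union_insert Union_empty append.simps)
    finally have "?s ` set (gorbit ?r3) = (\<Union>a\<in>{1, -1}. \<Union>b\<in>{1, -1}. \<Union>c\<in>{1, -1}. ?s ` set (even_rearrangements (?v a b c)))"
      by (simp only: image_UN)
    also have "\<dots> = (\<Union>a\<in>{1, -1}. \<Union>b\<in>{1, -1}. \<Union>c\<in>{1, -1}.
        even_coord_perms ((1/2) *\<^sub>R vector [of_int a * golden_ratio, of_int b, of_int c * inverse golden_ratio, 0]))"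
      by (simp only: perms)
    finally show ?thesis by simp
  qed
  finally show ?thesis unfolding vertices_600cell_def by (simp only: Un_ac)
qed

interpretation cell600: edge_orbits reps_600cell reps_600cell_midpoints "GInt 4 0" "GInt 8 4" "GInt 0 2" "GInt 0 1" 5 12
proof
  show "0 < of_gint (GInt 8 4)" using golden_ratio_pos by simp
  show "of_gint (GInt 0 1) = 2 * cos (pi / real 5)" by (simp add: cos_pi_div_5)
  show "2 * GInt 0 2 = GInt 0 1 * GInt 4 0" by (simp add: mult_2)
  show "gdiff (gscale (GInt 0 1) w) r \<in> set (gorbits reps_600cell)"
    if "r \<in> set reps_600cell" "w \<in> set (gorbits reps_600cell)" "gdot r w = GInt 0 2" for r w
    unfolding mem_gorbits_iff using closed_600cell that unfolding Let_def set_filter by blast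
  show "gadd r w \<in> set (gorbits reps_600cell_midpoints)"
    if "r \<in> set reps_600cell" "w \<in> set (gorbits reps_600cell)" "gdot r w = GInt 0 2" for r w
    unfolding mem_gorbits_iff using midpoint_600cell that unfolding Let_def set_filter by blast
  show "length (filter (\<lambda>w. gdot r w = GInt 0 2) (gorbits reps_600cell)) = 12" if "r \<in> set reps_600cell" for r
    using degree_600cell that by blast
  show "length (filter (\<lambda>v. gdiff e v \<in> set (gorbits reps_600cell))
      (filter (\<lambda>v. gdot v (gdiff e v) = GInt 0 2) (gorbits reps_600cell))) = 2"
    if "e \<in> set reps_600cell_midpoints" for e
    unfolding mem_gorbits_iff using fibre_600cell that unfolding Let_def by blast
qed (use norm_600cell distinct_600cell distinct_600cell_midpoints in \<open>simp_all\<close>)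

interpretation cell24: edge_orbits reps_24cell reps_24cell_midpoints "GInt 2 0" "GInt 6 0" "GInt 1 0" "GInt 1 0" 3 8
proof
  show "of_gint (GInt 1 0) = 2 * cos (pi / real 3)" by (simp add: cos_60)
  show "2 * GInt 1 0 = GInt 1 0 * GInt 2 0" by (simp add: mult_2)
  show "gdiff (gscale (GInt 1 0) w) r \<in> set (gorbits reps_24cell)"
    if "r \<in> set reps_24cell" "w \<in> set (gorbits reps_24cell)" "gdot r w = GInt 1 0" for r w
    using closed_24cell that unfolding set_filter by blast
  show "gadd r w \<in> set (gorbits reps_24cell_midpoints)"
    if "r \<in> set reps_24cell" "w \<in> set (gorbits reps_24cell)" "gdot r w = GInt 1 0" for r w
    using midpoint_24cell that unfolding set_filter by blast
  show "length (filter (\<lambda>w. gdot r w = GInt 1 0) (gorbits reps_24cell)) = 8" if "r \<in> set reps_24cell" for r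
    using degree_24cell that by blast
  show "length (filter (\<lambda>v. gdiff e v \<in> set (gorbits reps_24cell))
      (filter (\<lambda>v. gdot v (gdiff e v) = GInt 1 0) (gorbits reps_24cell))) = 2"
    if "e \<in> set reps_24cell_midpoints" for e
    using fibre_24cell that by blast
qed (use norm_24cell distinct_24cell distinct_24cell_midpoints in \<open>simp_all\<close>)

lemma edges_600cell_eq: "edges_600cell = {{x, y} | x y. (x, y) \<in> cell600.adjacent}"
  by (simp add: edges_600cell_def cell600.adjacent_def cell600.V_def vertices_600cell_eq cos_pi_div_5)

lemma edge_600cell_iff: "{x, y} \<in> edges_600cell \<longleftrightarrow> (x, y) \<in> cell600.adjacent"
  unfolding edges_600cell_eq using cell600.adjacent_sym by (auto simp: doubleton_eq_iff)

text \<open>A facet of the 600-cell can be moved by the group such that one of its vertices is a representative, where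
\<open>facet_sums_600cell\<close> applies. Conversely \<open>facets_600cell_sums\<close> provides a facet for each representative of the 120-cell.\<close>

lemma vertices_120cell_eq: "vertices_120cell = sgn ` orbit_points reps_120cell"
proof (intro equalityI subsetI)
  let ?k = "GInt 2 (-1)"
  have k: "of_gint ?k > 0"
  proof -
    have "sqrt 5 < 3" by (simp add: real_less_lsqrt)
    then show ?thesis by (simp add: golden_ratio_def field_simps)
  qed
  let ?sum = "\<lambda>w x y z. gscale ?k (gadd (gadd (gadd w x) y) z)"
  have sgn_sum: "sgn (sgn (T (of_gvec w)) + sgn (T (of_gvec x)) + sgn (T (of_gvec y)) + sgn (T (of_gvec z)))
      = sgn (T (of_gvec (?sum w x y z)))"
    if T: "T \<in> signed_even_perms" and "{T (of_gvec w), T (of_gvec x), T (of_gvec y), T (of_gvec z)} \<subseteq> orbit_points reps_600cell"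
    for T w x y z
  proof -
    have "sgn (T (of_gvec w)) + sgn (T (of_gvec x)) + sgn (T (of_gvec y)) + sgn (T (of_gvec z))
        = (1/2) *\<^sub>R T (of_gvec (gadd (gadd (gadd w x) y) z))"
      using that by (simp add: cell600.sgn_V signed_even_perms_linear[OF T] scaleR_add_right)
    then show ?thesis
      using k by (simp only: of_gvec_hom(2) signed_even_perms_linear(3)[OF T] sgn_scaleR) simp
  qed
  {
    fix u assume "u \<in> vertices_120cell"
    then obtain w x y z where u: "u = sgn (w + x + y + z)"
      and adj: "(w, x) \<in> cell600.adjacent" "(w, y) \<in> cell600.adjacent" "(w, z) \<in> cell600.adjacent"
        "(x, y) \<in> cell600.adjacent" "(x, z) \<in> cell600.adjacent" "(y, z) \<in> cell600.adjacent"
      unfolding vertices_120cell_def edge_600cell_iff by blast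
    then have V: "w \<in> cell600.V" "x \<in> cell600.V" "y \<in> cell600.V" "z \<in> cell600.V"
      by (auto simp: cell600.adjacent_def)
    then obtain w' where w': "w = sgn w'" "w' \<in> orbit_points reps_600cell" by (auto simp: cell600.V_def)
    obtain T r where T: "T \<in> signed_even_perms" "r \<in> set reps_600cell" "w' = T (of_gvec r)"
      using w'(2) by (rule orbit_points_cases)
    have ex: "\<exists>g\<in>set (gorbits reps_600cell). v = sgn (T (of_gvec g))" if "v \<in> cell600.V" for v
    proof -
      have "v \<in> sgn ` T ` orbit_points reps_600cell"
        using that by (simp only: cell600.V_def signed_even_perms_orbit_points[OF T(1)])
      then show ?thesis by (auto simp: orbit_points_def)
    qed
    obtain gx where gx: "gx \<in> set (gorbits reps_600cell)" "x = sgn (T (of_gvec gx))" using ex[OF V(2)] ..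
    obtain gy where gy: "gy \<in> set (gorbits reps_600cell)" "y = sgn (T (of_gvec gy))" using ex[OF V(3)] ..
    obtain gz where gz: "gz \<in> set (gorbits reps_600cell)" "z = sgn (T (of_gvec gz))" using ex[OF V(4)] ..
    note g = gx(2) gy(2) gz(2) and g_mem = gx(1) gy(1) gz(1)
    have r_mem: "r \<in> set (gorbits reps_600cell)"
      using orbit_pointsI[OF signed_even_perms_id T(2)] by (auto simp: orbit_points_def)
    have pts: "T (of_gvec v) \<in> orbit_points reps_600cell" if "v \<in> set (gorbits reps_600cell)" for v
      using that signed_even_perms_orbit_points[OF T(1), of reps_600cell] by (auto simp: orbit_points_def)
    have dot: "gdot v v' = GInt 0 2"
      if "(sgn (T (of_gvec v)), sgn (T (of_gvec v'))) \<in> cell600.adjacent"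
        "v \<in> set (gorbits reps_600cell)" "v' \<in> set (gorbits reps_600cell)" for v v'
    proof -
      have "T (of_gvec v) \<bullet> T (of_gvec v') = of_gint (GInt 0 2)"
        using that cell600.inner_sgn_V_iff[OF pts pts, of v v'] by (auto simp: cell600.adjacent_def)
      then show ?thesis by (simp only: signed_even_perms_inner[OF T(1)] of_gvec_hom(4) of_gint_inject)
    qed
    have "gsquares (?sum r gx gy gz) \<in> set (square_table reps_120cell)"
      using facet_sums_600cell[unfolded Let_def set_filter] T(2) g_mem
        adj[unfolded w'(1) T(3) g, THEN dot] r_mem by simp
    then have "of_gvec (?sum r gx gy gz) \<in> orbit_points reps_120cell"
      unfolding orbit_points_def mem_gorbits_iff[symmetric] by (rule imageI)
    then have "T (of_gvec (?sum r gx gy gz)) \<in> orbit_points reps_120cell"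
      using signed_even_perms_orbit_points[OF T(1), of reps_120cell] by blast
    moreover have "u = sgn (T (of_gvec (?sum r gx gy gz)))"
      unfolding u w'(1) T(3) g by (rule sgn_sum[OF T(1)]) (use pts r_mem g_mem in blast)
    ultimately show "u \<in> sgn ` orbit_points reps_120cell" by blast
  }
  {
    fix u assume "u \<in> sgn ` orbit_points reps_120cell"
    then obtain T r where T: "T \<in> signed_even_perms" "r \<in> set reps_120cell" "u = sgn (T (of_gvec r))"
      using orbit_points_cases by blast
    from facets_600cell_sums[unfolded Let_def] T(2) obtain q where
      "case q of [w, x, y, z] \<Rightarrow>
        (\<forall>v\<in>set q. gsquares v \<in> set (square_table reps_600cell)) \<and>
        (\<forall>(u, v)\<in>set [(w, x), (w, y), (w, z), (x, y), (x, z), (y, z)]. gdot u v = GInt 0 2) \<and>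
        ?sum w x y z = r | _ \<Rightarrow> False"
      by (auto simp: list_all2_conv_all_nth in_set_conv_nth)
    then obtain w x y z where q: "q = [w, x, y, z]"
      and mem: "\<forall>v\<in>set [w, x, y, z]. v \<in> set (gorbits reps_600cell)"
      and dot: "\<forall>(u, v)\<in>set [(w, x), (w, y), (w, z), (x, y), (x, z), (y, z)]. gdot u v = GInt 0 2"
      and r: "?sum w x y z = r"
      unfolding mem_gorbits_iff[symmetric] by (auto split: list.splits)
    have pts: "T (of_gvec v) \<in> orbit_points reps_600cell" if "v \<in> set [w, x, y, z]" for v
      using mem that signed_even_perms_orbit_points[OF T(1), of reps_600cell] by (auto simp: orbit_points_def)
    have "(sgn (T (of_gvec v)), sgn (T (of_gvec v'))) \<in> cell600.adjacent"
      if "(v, v') \<in> set [(w, x), (w, y), (w, z), (x, y), (x, z), (y, z)]" for v v'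
    proof -
      have "v \<in> set [w, x, y, z]" "v' \<in> set [w, x, y, z]" using that by auto
      note p = this[THEN pts]
      have "gdot v v' = GInt 0 2" using dot that by blast
      then have "T (of_gvec v) \<bullet> T (of_gvec v') = of_gint (GInt 0 2)"
        by (simp only: signed_even_perms_inner[OF T(1)] of_gvec_hom(4))
      then show ?thesis
        using p cell600.inner_sgn_V_iff[OF p] by (simp add: cell600.adjacent_def cell600.V_def)
    qed
    moreover have "u = sgn (sgn (T (of_gvec w)) + sgn (T (of_gvec x)) + sgn (T (of_gvec y)) + sgn (T (of_gvec z)))"
      unfolding T(3) r[symmetric] by (rule sgn_sum[OF T(1), symmetric]) (use pts in auto)
    ultimately show "u \<in> vertices_120cell"
      unfolding vertices_120cell_def edge_600cell_iff by (simp, blast)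
  }
qed

section \<open>The 24-cell and its dual in coordinates\<close>

lemma axis_vectors_eq:
  "{axis i a | i a. a \<in> {1, -1}}
    = (\<lambda>v. (1/2) *\<^sub>R of_gvec v) ` set (gorbit (GVec (GInt 2 0) (GInt 0 0) (GInt 0 0) (GInt 0 0)))"
proof -
  have "{axis i a | i a. a \<in> {1, -1}} = {axis 1 1, axis 2 1, axis 3 1, axis 4 1,
      axis 1 (-1), axis 2 (-1), axis 3 (-1), axis 4 (-1) :: real ^ 4}"
  proof -
    have "{axis i a | i a. a \<in> {1, -1}} = (\<lambda>i :: 4. axis i (1 :: real)) ` UNIV \<union> (\<lambda>i. axis i (- 1)) ` UNIV"
      by blast
    then show ?thesis unfolding UNIV_4 by (simp add: insert_commute Un_insert_right)
  qed
  moreover have "(1/2) *\<^sub>R of_gvec (GVec (GInt (2 * k) 0) (GInt 0 0) (GInt 0 0) (GInt 0 0)) = axis 1 (of_int k)"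
    "(1/2) *\<^sub>R of_gvec (GVec (GInt 0 0) (GInt (2 * k) 0) (GInt 0 0) (GInt 0 0)) = axis 2 (of_int k)"
    "(1/2) *\<^sub>R of_gvec (GVec (GInt 0 0) (GInt 0 0) (GInt (2 * k) 0) (GInt 0 0)) = axis 3 (of_int k)"
    "(1/2) *\<^sub>R of_gvec (GVec (GInt 0 0) (GInt 0 0) (GInt 0 0) (GInt (2 * k) 0)) = axis 4 (of_int k)" for k
    by (simp_all add: vec_eq_iff_4 vector_4 axis_def)
  note halves = this[of 1] this[of "-1"]
  have "set (gorbit (GVec (GInt 2 0) (GInt 0 0) (GInt 0 0) (GInt 0 0))) = {
      GVec (GInt (2 * 1) 0) (GInt 0 0) (GInt 0 0) (GInt 0 0), GVec (GInt 0 0) (GInt (2 * 1) 0) (GInt 0 0) (GInt 0 0),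
      GVec (GInt 0 0) (GInt 0 0) (GInt (2 * 1) 0) (GInt 0 0), GVec (GInt 0 0) (GInt 0 0) (GInt 0 0) (GInt (2 * 1) 0),
      GVec (GInt (2 * - 1) 0) (GInt 0 0) (GInt 0 0) (GInt 0 0), GVec (GInt 0 0) (GInt (2 * - 1) 0) (GInt 0 0) (GInt 0 0),
      GVec (GInt 0 0) (GInt 0 0) (GInt (2 * - 1) 0) (GInt 0 0), GVec (GInt 0 0) (GInt 0 0) (GInt 0 0) (GInt (2 * - 1) 0)}"
    by (auto simp: gorbit_def sign_choices_def zero_gint_def)
  ultimately show ?thesis
    by (simp only: image_insert image_empty halves of_int_1 of_int_minus)
qed

lemma vertices_dual_24cell_eq: "vertices_dual_24cell = sgn ` orbit_points reps_dual_24cell"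
proof -
  have "inverse (sqrt (of_gint (GInt 4 0))) = 1 / 2" by simp
  then have "sgn ` orbit_points reps_dual_24cell = (\<lambda>v. (1/2) *\<^sub>R of_gvec v) ` set (gorbits reps_dual_24cell)"
    unfolding sgn_image_orbit_points[OF norm_24cell(3)] by simp
  also have "\<dots> = {axis i a | i a. a \<in> {1, -1}} \<union> half_sign_vectors"
    unfolding axis_vectors_eq half_sign_vectors_eq gorbits_def reps_dual_24cell_def by (simp add: image_Un)
  finally show ?thesis by (simp only: vertices_dual_24cell_def)
qed

lemma gorbit_24cell:
  "let R = concat (map even_rearrangements [GVec (GInt a 0) (GInt b 0) (GInt 0 0) (GInt 0 0). a \<leftarrow> [1, -1], b \<leftarrow> [1, -1]]);
       S = gorbits reps_24cell in
     (\<forall>v\<in>set R. v \<in> set S) \<and> (\<forall>v\<in>set S. v \<in> set R)"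
  by code_simp

lemma vertices_24cell_eq: "vertices_24cell = sgn ` orbit_points reps_24cell"
proof -
  let ?s = "\<lambda>v. inverse (sqrt (of_gint (GInt 2 0))) *\<^sub>R of_gvec v"
  let ?v = "\<lambda>a b. GVec (GInt a 0) (GInt b 0) (GInt 0 0) (GInt 0 0)"
  have perms: "coord_perms (vector [of_int a / sqrt 2, of_int b / sqrt 2, 0, 0]) = ?s ` set (even_rearrangements (?v a b))" for a b
  proof -
    have even: "coord_perms (vector [of_int a / sqrt 2, of_int b / sqrt 2, 0, 0])
        = even_coord_perms (vector [of_int a / sqrt 2, of_int b / sqrt 2, 0, 0])"
      by (rule coord_perms_eq_even_coord_perms[of 3 4]) (simp_all add: vector_4)
    have "vector [of_int a / sqrt 2, of_int b / sqrt 2, 0, 0] = ?s (?v a b)"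
      by (simp add: vec_eq_iff_4 vector_4 field_simps)
    then show ?thesis
      unfolding even by (simp only: even_coord_perms_scaleR even_coord_perms_of_gvec image_image)
  qed
  have "set (gorbits reps_24cell) = set (concat (map even_rearrangements [?v a b. a \<leftarrow> [1, -1], b \<leftarrow> [1, -1]]))"
    using gorbit_24cell unfolding Let_def by blast
  also have "\<dots> = (\<Union>a\<in>{1, -1}. \<Union>b\<in>{1, -1}. set (even_rearrangements (?v a b)))"
    by (simp only: set_concat set_map concat.simps map_append list.map append_Nil2 set_append list.set UN_insert UN_empty Un_empty_right
        image_Un UN_Un Un_assoc image_insert image_empty Union_insert Union_empty append.simps)
  finally have "?s ` set (gorbits reps_24cell) = (\<Union>a\<in>{1, -1}. \<Union>b\<in>{1, -1}. ?s ` set (even_rearrangements (?v a b)))"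
    by (simp only: image_UN)
  then have "sgn ` orbit_points reps_24cell = (\<Union>a\<in>{1, -1}. \<Union>b\<in>{1, -1}. ?s ` set (even_rearrangements (?v a b)))"
    by (simp only: sgn_image_orbit_points[OF norm_24cell(1)])
  also have "\<dots> = vertices_24cell"
    unfolding vertices_24cell_def perms[symmetric] by simp
  finally show ?thesis ..
qed

lemma edges_24cell_eq: "edges_24cell = {{x, y} | x y. (x, y) \<in> cell24.adjacent}"
  by (simp add: edges_24cell_def cell24.adjacent_def cell24.V_def vertices_24cell_eq cos_60)

section \<open>The designs of the 24-cell and of the 600-cell\<close>

lemma of_gint_rational: "of_gint (GInt k 0) = of_int k"
  by simp

theorem hybrid_design_24cell:
  assumes \<sigma>: "invariant_sphere_measure \<sigma>" and euler: "euler_cycle edges_24cell \<gamma>"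
  shows "hybrid_design \<sigma> 7 (5 / 14) \<gamma> vertices_dual_24cell"
proof -
  have "hybrid_design \<sigma> (Suc (2 * 3)) (5 / 14) \<gamma> (sgn ` orbit_points reps_dual_24cell)"
  proof (rule cell24.hybrid_design_if_orbit_energies[OF \<sigma> euler[unfolded edges_24cell_eq], where nx = "GInt 4 0"])
    show "distinct (gorbits reps_dual_24cell)" by (rule distinct_dual_24cell)
    show "gorbits reps_dual_24cell \<noteq> []" "gorbits reps_24cell_midpoints \<noteq> []"
      using length_24cell by auto
    fix r assume r: "r \<in> set reps_dual_24cell \<union> set reps_24cell \<union> set reps_24cell_midpoints"
    define SX SV SE where "SX = of_gint (orbit_power_sum (2 * 3) reps_dual_24cell r)"
      and "SV = of_gint (orbit_power_sum (2 * 3) reps_24cell r)"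
      and "SE = of_gint (orbit_power_sum (2 * 3) reps_24cell_midpoints r)"
    define n where "n = of_gint (gdot r r)"
    have n: "n > 0" using r norm_24cell by (auto simp: n_def)
    have "of_gint (GInt 15 0 * orbit_power_sum 6 reps_dual_24cell r + GInt 108 0 * orbit_power_sum 6 reps_24cell r
        + orbit_power_sum 6 reps_24cell_midpoints r) = of_gint (GInt 5040 0 * gdot r r ^ 3)"
      using energy_24cell r by (intro arg_cong[of _ _ of_gint]) auto
    then have SE: "SE = 5040 * n ^ 3 - 15 * SX - 108 * SV"
      by (simp add: SX_def SV_def SE_def n_def)
    have "5 / 14 / 24 * (SX / (4 * n) ^ 3) + (1 - 5 / 14) / 2 * (SV / (2 * n) ^ 3 / 24 + SE / (6 * n) ^ 3 / 96) = 5 / 64"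
      unfolding SE using n by (simp add: power_mult_distrib field_simps)
    then show "5 / 14 / real (length (gorbits reps_dual_24cell)) *
        (of_gint (orbit_power_sum (2 * 3) reps_dual_24cell r) / (of_gint (GInt 4 0) * of_gint (gdot r r)) ^ 3) +
      (1 - 5 / 14) / 2 *
        (of_gint (orbit_power_sum (2 * 3) reps_24cell r) / (of_gint (GInt 2 0) * of_gint (gdot r r)) ^ 3 / real (length (gorbits reps_24cell)) +
         of_gint (orbit_power_sum (2 * 3) reps_24cell_midpoints r) / (of_gint (GInt 6 0) * of_gint (gdot r r)) ^ 3 / real (length (gorbits reps_24cell_midpoints)))
      = sphere_moment 4 (2 * 3)"
      unfolding SX_def[symmetric] SV_def[symmetric] SE_def[symmetric] n_def[symmetric] length_24cell
      by (simp add: sphere_moment_4)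
  qed (use norm_24cell in auto)
  then show ?thesis by (simp add: vertices_dual_24cell_eq)
qed

theorem hybrid_design_600cell:
  assumes \<sigma>: "invariant_sphere_measure \<sigma>" and euler: "euler_cycle edges_600cell \<gamma>"
  shows "hybrid_design \<sigma> 19 (176 / 301) \<gamma> vertices_120cell"
proof -
  have "hybrid_design \<sigma> (Suc (2 * 9)) (176 / 301) \<gamma> (sgn ` orbit_points reps_120cell)"
  proof (rule cell600.hybrid_design_if_orbit_energies[OF \<sigma> euler[unfolded edges_600cell_eq], where nx = "GInt 8 0"])
    show "distinct (gorbits reps_120cell)" by (rule distinct_120cell)
    show "gorbits reps_120cell \<noteq> []" "gorbits reps_600cell_midpoints \<noteq> []"
      using length_600cell by auto
    fix r assume r: "r \<in> set reps_120cell \<union> set reps_600cell \<union> set reps_600cell_midpoints"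
    define SX SV SE where "SX = of_gint (orbit_power_sum (2 * 9) reps_120cell r)"
      and "SV = of_gint (orbit_power_sum (2 * 9) reps_600cell r)"
      and "SE = of_gint (orbit_power_sum (2 * 9) reps_600cell_midpoints r)"
    define n p where "n = of_gint (gdot r r)" and "p = of_gint (GInt 2 1)"
    have n: "n > 0" and p: "p > 0"
      using r norm_600cell golden_ratio_pos by (auto simp: n_def p_def)
    have "(GInt 2112 0 * orbit_power_sum (2 * 9) reps_120cell r + GInt 1920000 0 * orbit_power_sum (2 * 9) reps_600cell r
          - GInt 5394906316800 0 * gdot r r ^ 9) * GInt 2 1 ^ 9
        + GInt 320000 0 * orbit_power_sum (2 * 9) reps_600cell_midpoints r = 0"
      using energy_120cell energy_600cell energy_600cell_midpoints r
      unfolding energy_check_600cell_def Let_def tallied_power_sum[OF ninth_power] ninth_power by blast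
    from arg_cong[OF this, of of_gint]
    have "(2112 * SX + 1920000 * SV - 5394906316800 * n ^ 9) * p ^ 9 + 320000 * SE = 0"
      unfolding SX_def SV_def SE_def n_def p_def by (simp del: of_gint.simps add: of_gint_rational)
    then have SE: "SE = (5394906316800 * n ^ 9 - 2112 * SX - 1920000 * SV) * p ^ 9 / 320000"
      by (simp add: field_simps)
    have "176 / 301 / 600 * (SX / (8 * n) ^ 9) + (1 - 176 / 301) / 2 * (SV / (4 * n) ^ 9 / 120 + SE / ((4 * p) * n) ^ 9 / 720)
        = 4862 / 4 ^ 9"
      unfolding SE power_mult_distrib using n p by (simp add: field_simps)
    moreover have "of_gint (GInt 8 4) = 4 * p" by (simp add: p_def)
    ultimately show "176 / 301 / real (length (gorbits reps_120cell)) *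
        (of_gint (orbit_power_sum (2 * 9) reps_120cell r) / (of_gint (GInt 8 0) * of_gint (gdot r r)) ^ 9) +
      (1 - 176 / 301) / 2 *
        (of_gint (orbit_power_sum (2 * 9) reps_600cell r) / (of_gint (GInt 4 0) * of_gint (gdot r r)) ^ 9 / real (length (gorbits reps_600cell)) +
         of_gint (orbit_power_sum (2 * 9) reps_600cell_midpoints r) / (of_gint (GInt 8 4) * of_gint (gdot r r)) ^ 9 / real (length (gorbits reps_600cell_midpoints)))
      = sphere_moment 4 (2 * 9)"
      unfolding SX_def[symmetric] SV_def[symmetric] SE_def[symmetric] n_def[symmetric] length_600cell
      by (simp add: sphere_moment_4)
  qed (use norm_600cell in auto)
  then show ?thesis by (simp add: vertices_120cell_eq)
qed

section \<open>The design of the regular simplex\<close>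

lemma tetrahedral_angle:
  defines "L \<equiv> arccos (- 1 / 4)"
  shows "0 < L" "L < pi" "cos L = - 1 / 4" "sin L = sqrt 15 / 4"
    "sin (L / 2) = sqrt 10 / 4" "cos (L / 2) = sqrt 6 / 4"
proof -
  show L: "0 < L" "L < pi" using arccos_lt_bounded[of "- 1 / 4"] by (simp_all add: L_def)
  show c: "cos L = - 1 / 4" by (simp add: L_def)
  have s: "sin L > 0" "sin (L / 2) > 0" "cos (L / 2) > 0"
    using L by (auto intro!: sin_gt_zero cos_gt_zero)
  have "(sin L)\<^sup>2 = 15 / 16" unfolding sin_squared_eq c by (simp add: power_divide)
  then have "(4 * sin L)\<^sup>2 = 15" by (simp add: power_mult_distrib)
  then show "sin L = sqrt 15 / 4" using s(1) real_sqrt_unique[of "4 * sin L" 15] by simp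
  have half: "cos L = 2 * (cos (L / 2))\<^sup>2 - 1" using cos_double_cos[of "L / 2"] by simp
  then have "(4 * cos (L / 2))\<^sup>2 = 6" by (simp add: c power_mult_distrib)
  then show "cos (L / 2) = sqrt 6 / 4" using s(3) real_sqrt_unique[of "4 * cos (L / 2)" 6] by simp
  have "(4 * sin (L / 2))\<^sup>2 = 10" using half by (simp add: c power_mult_distrib sin_squared_eq)
  then show "sin (L / 2) = sqrt 10 / 4" using s(2) real_sqrt_unique[of "4 * sin (L / 2)" 10] by simp
qed

text \<open>\<open>A\<close> and \<open>B\<close> are the coefficients of the end points along an arc of length \<open>L\<close>. Around the midpoint, with \<open>u = s - L / 2\<close>, the sum
\<open>A + B\<close> is a multiple of \<open>cos u\<close> and \<open>A B\<close> is a polynomial in \<open>sin u\<close>. The two combinations are those that arise when squares and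
cubes are summed over all arcs, see \<open>sum_pair_powers\<close>.\<close>

lemma tetrahedral_arc_coefficients:
  fixes s :: real
  defines "L \<equiv> arccos (- 1 / 4)"
  defines "A \<equiv> sin (L - s) / sin L" and "B \<equiv> sin s / sin L"
  shows "A\<^sup>2 + B\<^sup>2 - A * B / 2 = 1"
    and "4 * (A ^ 3 + B ^ 3) - 3 * A * B * (A + B)
      = (4 * cos (s - L / 2) - 16 / 3 * (5 / 8 - (sin (s - L / 2))\<^sup>2) * cos (s - L / 2)) / cos (L / 2)"
proof -
  note angle = tetrahedral_angle[folded L_def]
  define u h where "u = s - L / 2" and "h = L / 2"
  have su: "s = h + u" "L - s = h - u" "L = 2 * h" by (simp_all add: u_def h_def)
  have sc: "sin L = 2 * sin h * cos h" unfolding su(3) by (rule sin_double)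
  have h2: "(sin h)\<^sup>2 = 5 / 8" "(cos h)\<^sup>2 = 3 / 8"
    unfolding h_def angle by (simp_all add: power_divide)
  have ch: "cos h \<noteq> 0" "sin h \<noteq> 0" unfolding h_def angle by simp_all
  have A: "A = sin (h - u) / sin L" unfolding A_def su(2) ..
  have B: "B = sin (h + u) / sin L" unfolding B_def by (simp only: su(1)[symmetric])
  have sum: "A + B = cos u / cos h"
    unfolding A B sc using ch by (simp add: sin_add sin_diff field_simps)
  have prod: "A * B = 16 / 15 * (5 / 8 - (sin u)\<^sup>2)"
  proof -
    have "sin (h - u) * sin (h + u) = (sin h)\<^sup>2 * (cos u)\<^sup>2 - (cos h)\<^sup>2 * (sin u)\<^sup>2"
      by (simp add: sin_add sin_diff algebra_simps power2_eq_square)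
    also have "\<dots> = 5 / 8 - (sin u)\<^sup>2" unfolding h2 cos_squared_eq[of u]
      by (simp add: algebra_simps diff_divide_distrib)
    finally have "A * B = (5 / 8 - (sin u)\<^sup>2) / (sin L)\<^sup>2"
      unfolding A B by (simp add: power2_eq_square)
    also have "(sin L)\<^sup>2 = 15 / 16" by (simp add: angle(4) power_divide)
    finally show ?thesis by simp
  qed
  have "(A + B)\<^sup>2 = 8 / 3 * (cos u)\<^sup>2" by (simp add: sum power_divide h2)
  also have "\<dots> = 8 / 3 - 8 / 3 * (sin u)\<^sup>2"
    by (simp add: cos_squared_eq algebra_simps diff_divide_distrib)
  also have "\<dots> = 1 + 5 / 2 * (A * B)" by (simp add: prod algebra_simps)
  finally show one: "A\<^sup>2 + B\<^sup>2 - A * B / 2 = 1" by (simp add: power2_eq_square algebra_simps)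
  have "4 * (A ^ 3 + B ^ 3) - 3 * A * B * (A + B) = (A + B) * (4 * (A\<^sup>2 + B\<^sup>2 - A * B / 2) - 5 * (A * B))"
    by (simp add: power2_eq_square power3_eq_cube algebra_simps)
  also have "\<dots> = (A + B) * (4 - 5 * (A * B))" unfolding one by simp
  also have "\<dots> = cos u / cos h * (4 - 16 / 3 * (5 / 8 - (sin u)\<^sup>2))"
    unfolding sum prod by simp
  also have "\<dots> = (4 * cos u - 16 / 3 * (5 / 8 - (sin u)\<^sup>2) * cos u) / cos h"
    using ch by (simp add: field_simps)
  finally show "4 * (A ^ 3 + B ^ 3) - 3 * A * B * (A + B)
      = (4 * cos (s - L / 2) - 16 / 3 * (5 / 8 - (sin (s - L / 2))\<^sup>2) * cos (s - L / 2)) / cos (L / 2)"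
    by (simp only: u_def h_def)
qed

text \<open>In the variable \<open>w = sin (s - L / 2)\<close> the integrand is a quadratic polynomial times \<open>dw\<close>.\<close>

lemma integral_tetrahedral_cubic:
  fixes A B :: "real \<Rightarrow> real"
  defines "L \<equiv> arccos (- 1 / 4)"
  defines "A \<equiv> \<lambda>s. sin (L - s) / sin L" and "B \<equiv> \<lambda>s. sin s / sin L"
  shows "((\<lambda>s. 4 * (A s ^ 3 + B s ^ 3) - 3 * A s * B s * (A s + B s)) has_integral 32 * sqrt 15 / 27) {0..L}"
proof -
  note angle = tetrahedral_angle[folded L_def]
  define G where "G s = (4 * sin (s - L / 2) - 16 / 3 * (5 / 8 * sin (s - L / 2) - sin (s - L / 2) ^ 3 / 3)) / cos (L / 2)" for s
  have int: "((\<lambda>s. (4 * cos (s - L / 2) - 16 / 3 * (5 / 8 - (sin (s - L / 2))\<^sup>2) * cos (s - L / 2)) / cos (L / 2))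
      has_integral G L - G 0) {0..L}"
  proof (rule fundamental_theorem_of_calculus)
    show "0 \<le> L" using angle(1) by simp
    fix s assume "s \<in> {0..L}"
    show "(G has_vector_derivative
        (4 * cos (s - L / 2) - 16 / 3 * (5 / 8 - (sin (s - L / 2))\<^sup>2) * cos (s - L / 2)) / cos (L / 2))
        (at s within {0..L})"
    proof -
      have "((\<lambda>s. 4 * sin (s - L / 2) - 16 / 3 * (5 / 8 * sin (s - L / 2) - sin (s - L / 2) ^ 3 / 3)) has_real_derivative
          4 * cos (s - L / 2) - 16 / 3 * (5 / 8 - (sin (s - L / 2))\<^sup>2) * cos (s - L / 2)) (at s within {0..L})"
        by (auto intro!: derivative_eq_intros simp: algebra_simps power2_eq_square)
      from DERIV_cdivide[OF this] show ?thesis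
        unfolding has_real_derivative_iff_has_vector_derivative[symmetric] G_def .
    qed
  qed
  have val: "G L - G 0 = 32 * sqrt 15 / 27"
  proof -
    define w where "w = sin (L / 2)"
    define q where "q = 4 * w - 16 / 3 * (5 / 8 * w - w ^ 3 / 3)"
    have "L - L / 2 = L / 2" "0 - L / 2 = - (L / 2)" by simp_all
    moreover have "4 * - w - 16 / 3 * (5 / 8 * - w - (- w) ^ 3 / 3) = - q"
      by (simp add: q_def power3_eq_cube algebra_simps)
    ultimately have "G L = q / cos (L / 2)" "G 0 = - q / cos (L / 2)"
      by (simp_all only: G_def sin_minus w_def[symmetric] q_def)
    then have "G L - G 0 = 2 * q / cos (L / 2)" by (simp add: add_divide_distrib[symmetric])
    also have "2 * q / cos (L / 2) = 2 * (4 * w - 16 / 3 * (5 / 8 * w - w ^ 3 / 3)) / cos (L / 2)"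
      by (simp only: q_def)
    also have "w ^ 3 = 5 / 8 * w"
      by (simp add: w_def angle power3_eq_cube)
    also have "2 * (4 * w - 16 / 3 * (5 / 8 * w - 5 / 8 * w / 3)) / cos (L / 2) = 32 / 9 * (sqrt 10 / sqrt 6)"
      by (simp add: w_def angle)
    also have "sqrt 10 / sqrt 6 = sqrt 15 / 3"
    proof -
      have "sqrt 10 * sqrt 9 = sqrt 15 * sqrt 6" by (simp only: real_sqrt_mult[symmetric]) simp
      then show ?thesis by (simp add: field_simps)
    qed
    finally show ?thesis by simp
  qed
  show ?thesis
    using int[unfolded val] unfolding A_def B_def L_def tetrahedral_arc_coefficients(2) .
qed

lemma sum_off_diagonal:
  fixes f :: "'a \<Rightarrow> 'a \<Rightarrow> real"
  assumes "finite V"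
  shows "(\<Sum>(x, y) | x \<in> V \<and> y \<in> V \<and> x \<noteq> y. f x y) = (\<Sum>x\<in>V. \<Sum>y\<in>V. f x y) - (\<Sum>x\<in>V. f x x)"
proof -
  have "(\<Sum>x\<in>V. \<Sum>y\<in>V. f x y) = (\<Sum>x\<in>V. (\<Sum>y\<in>V - {x}. f x y) + f x x)"
    using assms by (intro sum.cong refl) (simp add: sum.remove add.commute)
  also have "\<dots> = (\<Sum>x\<in>V. \<Sum>y\<in>V - {x}. f x y) + (\<Sum>x\<in>V. f x x)" by (rule sum.distrib)
  also have "(\<Sum>x\<in>V. \<Sum>y\<in>V - {x}. f x y) = (\<Sum>(x, y) | x \<in> V \<and> y \<in> V \<and> x \<noteq> y. f x y)"
    using assms by (subst sum.Sigma) (auto intro!: sum.cong)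
  finally show ?thesis by simp
qed

text \<open>All mixed terms contain a factor \<open>\<Sum>x\<in>V. t x = 0\<close>, except for those on the diagonal, which are subtracted.\<close>

lemma sum_pair_powers:
  fixes t :: "'a \<Rightarrow> real"
  assumes V: "finite V" "card V = 5" and t: "(\<Sum>x\<in>V. t x) = 0"
  shows "(\<Sum>(x, y) | x \<in> V \<and> y \<in> V \<and> x \<noteq> y. (a * t x + b * t y)\<^sup>2)
      = 4 * (a\<^sup>2 + b\<^sup>2 - a * b / 2) * (\<Sum>x\<in>V. (t x)\<^sup>2)"
    and "(\<Sum>(x, y) | x \<in> V \<and> y \<in> V \<and> x \<noteq> y. (a * t x + b * t y) ^ 3)
      = (4 * (a ^ 3 + b ^ 3) - 3 * a * b * (a + b)) * (\<Sum>x\<in>V. t x ^ 3)"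
proof -
  have "(a * t x + b * t y)\<^sup>2 = a\<^sup>2 * (t x)\<^sup>2 + 2 * a * b * t x * t y + b\<^sup>2 * (t y)\<^sup>2" for x y
    by (simp add: power2_eq_square algebra_simps)
  then have "(\<Sum>x\<in>V. \<Sum>y\<in>V. (a * t x + b * t y)\<^sup>2) = 5 * (a\<^sup>2 + b\<^sup>2) * (\<Sum>x\<in>V. (t x)\<^sup>2)"
    by (simp add: sum.distrib sum_distrib_left[symmetric] V(2) t) (simp add: algebra_simps)
  moreover have "(\<Sum>x\<in>V. (a * t x + b * t x)\<^sup>2) = (a + b)\<^sup>2 * (\<Sum>x\<in>V. (t x)\<^sup>2)"
    by (simp add: sum_distrib_left power_mult_distrib[symmetric] distrib_right)
  ultimately show "(\<Sum>(x, y) | x \<in> V \<and> y \<in> V \<and> x \<noteq> y. (a * t x + b * t y)\<^sup>2)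
      = 4 * (a\<^sup>2 + b\<^sup>2 - a * b / 2) * (\<Sum>x\<in>V. (t x)\<^sup>2)"
    unfolding sum_off_diagonal[OF V(1)] by (simp add: power2_eq_square algebra_simps)
  have "(a * t x + b * t y) ^ 3 = a ^ 3 * t x ^ 3 + 3 * a\<^sup>2 * b * (t x)\<^sup>2 * t y + 3 * a * b\<^sup>2 * (t y)\<^sup>2 * t x + b ^ 3 * t y ^ 3" for x y
    by (simp add: power2_eq_square power3_eq_cube algebra_simps)
  moreover have "(\<Sum>x\<in>V. \<Sum>y\<in>V. 3 * a * b\<^sup>2 * (t y)\<^sup>2 * t x) = 0"
    by (subst sum.swap) (simp add: sum_distrib_left[symmetric] t)
  moreover have "(\<Sum>x\<in>V. \<Sum>y\<in>V. 3 * a\<^sup>2 * b * (t x)\<^sup>2 * t y) = 0"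
    by (simp add: sum_distrib_left[symmetric] t)
  ultimately have "(\<Sum>x\<in>V. \<Sum>y\<in>V. (a * t x + b * t y) ^ 3) = 5 * (a ^ 3 + b ^ 3) * (\<Sum>x\<in>V. t x ^ 3)"
    by (simp add: sum.distrib sum_distrib_left[symmetric] V(2)) (simp add: algebra_simps)
  moreover have "(\<Sum>x\<in>V. (a * t x + b * t x) ^ 3) = (a + b) ^ 3 * (\<Sum>x\<in>V. t x ^ 3)"
    by (simp add: sum_distrib_left power_mult_distrib[symmetric] distrib_right)
  ultimately show "(\<Sum>(x, y) | x \<in> V \<and> y \<in> V \<and> x \<noteq> y. (a * t x + b * t y) ^ 3)
      = (4 * (a ^ 3 + b ^ 3) - 3 * a * b * (a + b)) * (\<Sum>x\<in>V. t x ^ 3)"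
    unfolding sum_off_diagonal[OF V(1)] by (simp add: power3_eq_cube algebra_simps)
qed

text \<open>The quadratic part does not depend on \<open>\<beta>\<close>: the coefficients of an arc satisfy \<open>A\<^sup>2 + B\<^sup>2 - A B / 2 = 1\<close>, so the mean over the edges of
\<open>(x \<bullet> z)\<^sup>2\<close> is the mean over the vertices. For cubes, the mean over the edges is a positive multiple of the mean over
\<open>V\<close>, whereas the dual vertices contribute the negative of the latter; \<open>\<beta>\<close> balances both.\<close>

theorem hybrid_design_4simplex:
  fixes V :: "(real ^ 4) set"
  assumes \<sigma>: "invariant_sphere_measure \<sigma>" and V: "regular_4simplex V"
    and euler: "euler_cycle (complete_edges V) \<gamma>"
  shows "hybrid_design \<sigma> 3 (8 * sqrt 15 / (8 * sqrt 15 + 27 * arccos (- 1 / 4))) \<gamma> (uminus ` V)"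
proof -
  define L where "L = arccos (- 1 / 4 :: real)"
  define \<beta> where "\<beta> = 8 * sqrt 15 / (8 * sqrt 15 + 27 * L)"
  define A B where "A s = sin (L - s) / sin L" and "B s = sin s / sin L" for s
  note angle = tetrahedral_angle[folded L_def]
  have den: "8 * sqrt 15 + 27 * L > 0" using angle(1) by (simp add: add_pos_pos)
  have \<beta>: "0 \<le> \<beta>" "\<beta> \<le> 1" using angle(1) den by (simp_all add: \<beta>_def)
  have card: "card V = 5" and sphere: "V \<subseteq> sphere 0 1"
    and ip: "\<And>x y. x \<in> V \<Longrightarrow> y \<in> V \<Longrightarrow> x \<noteq> y \<Longrightarrow> x \<bullet> y = - 1 / 4"
    using V unfolding regular_4simplex_def by auto
  have fin: "finite V" using card by (metis card.infinite zero_neq_numeral)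
  have self: "x \<bullet> x = 1" if "x \<in> V" for x using that sphere by (auto simp: dot_square_norm)
  have row: "(\<Sum>x\<in>V. (x \<bullet> y) ^ k) = 1 + 4 * (- 1 / 4) ^ k" if y: "y \<in> V" for y k
  proof -
    have "(\<Sum>x\<in>V. (x \<bullet> y) ^ k) = (y \<bullet> y) ^ k + (\<Sum>x\<in>V - {y}. (x \<bullet> y) ^ k)"
      by (rule sum.remove[OF fin y])
    also have "(\<Sum>x\<in>V - {y}. (x \<bullet> y) ^ k) = (\<Sum>x\<in>V - {y}. (- 1 / 4) ^ k)"
      using ip y by (intro sum.cong) auto
    finally show ?thesis using y card fin by (simp add: self)
  qed
  have "(\<Sum>x\<in>V. x) = 0"
  proof -
    have "(\<Sum>x\<in>V. x) \<bullet> (\<Sum>y\<in>V. y) = (\<Sum>y\<in>V. \<Sum>x\<in>V. (x \<bullet> y) ^ 1)"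
      by (simp add: inner_sum_left inner_sum_right)
    also have "\<dots> = 0" by (simp only: row cong: sum.cong) simp
    finally show ?thesis by simp
  qed
  then have zero: "(\<Sum>x\<in>V. x \<bullet> z) = 0" for z by (simp add: inner_sum_left[symmetric])
  define R where "R = {(x, y). x \<in> V \<and> y \<in> V \<and> x \<noteq> y}"
  have edges: "complete_edges V = {{x, y} | x y. (x, y) \<in> R}"
    by (simp add: complete_edges_def R_def)
  note euler = euler[unfolded edges]
  have finR: "finite R" by (rule finite_subset[of _ "V \<times> V"]) (auto simp: R_def fin)
  have sym: "(y, x) \<in> R" if "(x, y) \<in> R" for x y using that by (auto simp: R_def)
  have irrefl: "(x, x) \<notin> R" for x by (simp add: R_def)
  have cardR: "card R = 20"
    using sum_off_diagonal[OF fin, of "\<lambda>_ _. 1"] card by (simp add: R_def split_def)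
  have arc: "norm x = 1 \<and> norm y = 1 \<and> y \<noteq> x \<and> y \<noteq> - x" if "(x, y) \<in> R" for x y
    using that ip[of x y] self[of x] sphere by (auto simp: R_def)
  have arcs_sub: "set (arcs \<gamma>) \<subseteq> R"
    by (rule sum_list_arcs_euler_cycle(2)[OF euler sym irrefl, of "\<lambda>_. 0"]) simp_all
  have cyc: "geodesic_cycle \<gamma>"
    using cardR by (intro geodesic_cycle_if_euler_cycle[OF euler _ arcs_sub arc]) auto
  have cycle: "cycle_integral \<gamma> p = (\<Sum>e\<in>R. arc_integral p e) / 2" for p
    unfolding cycle_integral_eq_sum_arcs
    by (rule sum_list_arcs_euler_cycle(1)[OF euler sym irrefl]) (simp_all add: arc_integral_swap)
  have "arc_integral (\<lambda>_. 1) (x, y) = L" if "(x, y) \<in> R" for x y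
    using that ip[of x y] by (simp add: arc_integral_one R_def L_def)
  then have "(\<Sum>e\<in>R. arc_integral (\<lambda>_. 1) e) = 20 * L"
    using cardR by (simp add: sum.cong[of R R _ "\<lambda>_. L"] split_paired_all)
  then have len: "cycle_length \<gamma> = 10 * L" by (simp add: cycle_length_def cycle)
  have sum_arcs: "(\<Sum>e\<in>R. arc_integral (\<lambda>x. (x \<bullet> z) ^ k) e)
      = integral {0..L} (\<lambda>s. \<Sum>(x, y) | x \<in> V \<and> y \<in> V \<and> x \<noteq> y. (A s * (x \<bullet> z) + B s * (y \<bullet> z)) ^ k)" for k z
  proof -
    have sL: "sin L \<noteq> 0" unfolding angle(4) by simp
    have "arc_integral (\<lambda>x. (x \<bullet> z) ^ k) (x, y) = integral {0..L} (\<lambda>s. (A s * (x \<bullet> z) + B s * (y \<bullet> z)) ^ k)"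
      if "(x, y) \<in> R" for x y
    proof -
      have L: "arccos (x \<bullet> y) = L" using that ip by (simp add: R_def L_def)
      have "geodesic_arc x y s \<bullet> z = A s * (x \<bullet> z) + B s * (y \<bullet> z)" for s
        by (simp add: geodesic_arc_def L A_def B_def inner_add_left divide_inverse distrib_left mult_ac)
      then show ?thesis by (simp add: arc_integral_def L)
    qed
    then have "(\<Sum>e\<in>R. arc_integral (\<lambda>x. (x \<bullet> z) ^ k) e)
        = (\<Sum>e\<in>R. integral {0..L} (\<lambda>s. (A s * (fst e \<bullet> z) + B s * (snd e \<bullet> z)) ^ k))"
      by (intro sum.cong refl) auto
    also have "\<dots> = integral {0..L} (\<lambda>s. \<Sum>e\<in>R. (A s * (fst e \<bullet> z) + B s * (snd e \<bullet> z)) ^ k)"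
      by (rule Henstock_Kurzweil_Integration.integral_sum[OF finR, symmetric])
        (auto intro!: integrable_continuous_real continuous_intros simp: A_def B_def sL)
    finally show ?thesis by (simp add: R_def split_def)
  qed
  have quadratic: "cycle_integral \<gamma> (\<lambda>x. (x \<bullet> z)\<^sup>2) = 2 * L * (\<Sum>x\<in>V. (x \<bullet> z)\<^sup>2)" for z
  proof -
    have "(A s)\<^sup>2 + (B s)\<^sup>2 - A s * B s / 2 = 1" for s
      unfolding A_def B_def L_def by (rule tetrahedral_arc_coefficients(1))
    then show ?thesis
      unfolding cycle sum_arcs sum_pair_powers(1)[OF fin card zero] using angle(1) by simp
  qed
  have cubic: "cycle_integral \<gamma> (\<lambda>x. (x \<bullet> z) ^ 3) = 16 * sqrt 15 / 27 * (\<Sum>x\<in>V. (x \<bullet> z) ^ 3)" for z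
    unfolding cycle sum_arcs sum_pair_powers(2)[OF fin card zero]
    using integral_unique[OF integral_tetrahedral_cubic[folded L_def], folded A_def B_def] by simp
  define X where "X = uminus ` V"
  have sum_X: "(\<Sum>x\<in>X. p x) = (\<Sum>x\<in>V. p (- x))" for p :: "real ^ 4 \<Rightarrow> real"
    by (simp add: X_def sum.reindex)
  have card_X: "card X = 5" using card by (simp add: X_def card_image)
  have X: "finite X" "X \<noteq> {}" "X \<subseteq> sphere 0 1" using fin card sphere by (auto simp: X_def)
  define \<Lambda> where "\<Lambda> = design_defect \<sigma> \<beta> \<gamma> X"
  have \<Lambda>: "sphere_functional \<Lambda>"
    unfolding \<Lambda>_def by (rule sphere_functional_design_defect[OF \<sigma> cyc X(3)])
  have \<Lambda>2: "\<Lambda> (\<lambda>x. (x \<bullet> z)\<^sup>2) = (\<Sum>x\<in>V. 1 / 5 * (x \<bullet> z)\<^sup>2) - 1 / 4" if "norm z = 1" for z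
  proof -
    have "(\<integral>x. (x \<bullet> z)\<^sup>2 \<partial>\<sigma>) = 1 / 4"
      using integral_inner_power[OF \<sigma>, of z 2] that by (simp add: sphere_moment_4)
    moreover have "\<beta> / real 5 * S + (1 - \<beta>) / (10 * L) * (2 * L * S) = 1 / 5 * S" for S
      using angle(1) by (simp add: field_simps)
    ultimately show ?thesis
      unfolding \<Lambda>_def design_defect_def card_X sum_X inner_minus_left power2_minus quadratic len
        sum_distrib_left[symmetric] by (simp only:)
  qed
  have \<Lambda>3: "\<Lambda> (\<lambda>x. (x \<bullet> z) ^ 3) = 0" for z
  proof -
    have "- \<beta> / 5 + (1 - \<beta>) / (10 * L) * (16 * sqrt 15 / 27) = 0"
    proof -
      define D where "D = 8 * sqrt 15 + 27 * L"
      have D: "D > 0" using den by (simp only: D_def)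
      have \<beta>_D: "\<beta> = 8 * sqrt 15 / D" by (simp only: \<beta>_def D_def)
      have "D - 8 * sqrt 15 = 27 * L" by (simp add: D_def)
      moreover have "1 - \<beta> = (D - 8 * sqrt 15) / D" using D by (simp add: \<beta>_D diff_divide_distrib)
      ultimately have one_minus: "1 - \<beta> = 27 * L / D" by (simp only:)
      show ?thesis using angle(1) D by (subst one_minus, subst \<beta>_D) (simp add: field_simps)
    qed
    then have "(- \<beta> / 5 + (1 - \<beta>) / (10 * L) * (16 * sqrt 15 / 27)) * S = 0" for S by (simp only: mult_zero_left)
    then have "\<beta> / real 5 * - S + (1 - \<beta>) / (10 * L) * (16 * sqrt 15 / 27 * S) = 0" for S
      by (simp only: distrib_right mult.assoc) simp
    moreover have "(\<integral>x. (x \<bullet> z) ^ 3 \<partial>\<sigma>) = 0"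
      using integral_inner_power[OF \<sigma>, of z 3] by (simp add: sphere_moment_4)
    moreover have "(\<Sum>x\<in>V. (- x \<bullet> z) ^ 3) = - (\<Sum>x\<in>V. (x \<bullet> z) ^ 3)"
      by (simp add: sum_negf)
    ultimately show ?thesis
      unfolding \<Lambda>_def design_defect_def card_X sum_X cubic len by (simp only: diff_self)
  qed
  have "\<Lambda> (\<lambda>z. \<Lambda> (\<lambda>x. (x \<bullet> z)\<^sup>2)) = 0"
  proof (rule energy_zero_if_zero_on_support[OF \<Lambda> _ \<Lambda>2])
    show "\<Lambda> (\<lambda>_. 1) = 0"
      unfolding \<Lambda>_def using angle(1) by (intro design_defect_one[OF \<sigma> X(1,2)]) (simp add: len)
    fix y assume y: "y \<in> V"
    then have ny: "norm y = 1" using sphere by auto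
    have frame: "(\<Sum>x\<in>V. (x \<bullet> y)\<^sup>2) = 5 / 4"
      unfolding row[OF y] by (simp add: power_divide)
    show "\<Lambda> (\<lambda>x. (x \<bullet> y)\<^sup>2) = 0"
      unfolding \<Lambda>2[OF ny] sum_distrib_left[symmetric] frame by simp
  qed
  moreover have "\<Lambda> (\<lambda>z. \<Lambda> (\<lambda>x. (x \<bullet> z) ^ Suc 2)) = 0"
    using \<Lambda>3 sphere_functional_zero[OF \<Lambda>] by (simp add: numeral_3_eq_3[symmetric])
  ultimately have "\<Lambda> p = 0" if "p \<in> Pol_le 3" for p
    using vanishes_on_Pol_le[OF \<Lambda>, of 2 p] that by (simp add: numeral_3_eq_3 numeral_2_eq_2)
  then show ?thesis
    using cyc X \<beta> unfolding hybrid_design_def X_def[symmetric] L_def[symmetric] \<beta>_def[symmetric] \<Lambda>_def design_defect_def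
    by simp
qed

theorem theorem6p2:
  fixes \<sigma> :: "(real ^ 4) measure"
  assumes "invariant_sphere_measure \<sigma>"
  shows "(\<forall>\<gamma>. euler_cycle edges_600cell \<gamma> \<longrightarrow>
             hybrid_design \<sigma> 19 (176 / 301) \<gamma> vertices_120cell) \<and>
         (\<forall>\<gamma>. euler_cycle edges_24cell \<gamma> \<longrightarrow>
             hybrid_design \<sigma> 7 (5 / 14) \<gamma> vertices_dual_24cell) \<and>
         (\<forall>V. regular_4simplex V \<longrightarrow>
            (\<forall>\<gamma>. euler_cycle (complete_edges V) \<gamma> \<longrightarrow>
               hybrid_design \<sigma> 3
                 (8 * sqrt 15 / (8 * sqrt 15 + 27 * arccos (- 1 / 4))) \<gamma> (uminus ` V)))"
  using hybrid_design_600cell[OF assms] hybrid_design_24cell[OF assms] hybrid_design_4simplex[OF assms]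
  by blast

end
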